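(* Let $\Sigma\subset\mathbb{R}^{n+1}$ be a pure, hereditary, $(n+1)$-dimensional fan with smoothness parameters $\alpha$, and set $S=\mathbb{R}[x_0,\ldots,x_n]$. For every $i$ with $1\le i\le n$: (1) $\mathrm{Ass}_S\big(H_i(\mathcal{R}/\mathcal{J}[\Sigma,\Sigma^{-1}])\big)\subseteq\{I(W)\mid W\in L_{\Sigma,\Sigma^{-1}},\ \dim W\le i-1\}$. (2) If $H_i(\mathcal{R}[\Sigma_{W,\sigma},\Sigma^{-1}_{W,\sigma}])=0$ for every $W\in L_{\Sigma,\Sigma^{-1}}$ with $\dim W=i-1$ and every facet $\sigma\in\Sigma_{n+1}$, then $\mathrm{Ass}_S\big(H_i(\mathcal{R}/\mathcal{J}[\Sigma,\Sigma^{-1}])\big)\subseteq\{I(W)\mid W\in L_{\Sigma,\Sigma^{-1}},\ \dim W\le i-2\}$. (3) If $\Sigma$ is simplicial, then $\mathrm{Ass}_S\big(H_i(\mathcal{R}/\mathcal{J}[\Sigma,\Sigma^{-1}])\big)\subseteq\{I(\gamma)\mid \gamma\in\Sigma,\ \mathrm{aff}(\gamma)\in L_{\Sigma,\Sigma^{-1}},\ \dim\gamma\le i-2\}$.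
   Context: A cone in $\mathbb{R}^{n+1}$ is the positive hull of a finite set of vectors; its dimension is that of its linear span $\mathrm{aff}(\gamma)$; its faces are itself and its intersections with supporting hyperplanes through the origin. A fan $\Sigma$ is a finite set of cones closed under taking faces such that any two meet in a common face; $\Sigma_i$ denotes its $i$-dimensional cones (so $\Sigma_0=\{\{0\}\}$), facets are maximal cones. $\Sigma$ is pure $(n+1)$-dimensional if all facets have dimension $n+1$. For a face $\psi$, $\mathrm{st}_\Sigma(\psi)$ is the subfan of all faces of facets containing $\psi$; its dual graph has a vertex per facet and an edge when two facets meet in an $n$-dimensional face. $\Sigma$ is hereditary if the dual graph of $\mathrm{st}_\Sigma(\psi)$ is connected for every face $\psi$. The boundary $\partial\Sigma$ is the subfan of faces contained in an $n$-face lying in exactly one facet; other faces are interior. $\Sigma$ is simplicial if every cone is generated by linearly independent vectors. For a cone $\gamma$, $I(\gamma)\subset S$ is the ideal of $\mathrm{aff}(\gamma)$, and for a linear subspace $W$, $I(W)$ its ideal; for $\tau\in\Sigma_n$, $l_\tau$ is a linear form generating $I(\tau)$. Smoothness parameters: integers $\alpha(\tau)\ge -1$ for $\tau\in\Sigma_n$, with $\alpha(\tau)\ge0$ for interior $\tau$. $\Sigma^{-1}$ is the subfan of $\partial\Sigma$ of cones contained in some $\tau\in\Sigma_n$ with $\alpha(\tau)=-1$, and $\Sigma^{\ge0}_i=\Sigma_i\setminus\Sigma^{-1}_i$. Complexes: let $u_\rho$ be the unit generator of a ray $\rho$; for a cone $\gamma$ let $P(\gamma)=\mathrm{conv}(\{0\}\cup\{u_\rho:\rho\subseteq\gamma\text{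 a ray}\})$ and $\mathrm{lk}(\gamma)=\mathrm{conv}\{u_\rho:\rho\subseteq\gamma\}$, giving polytopal complexes $P(\Gamma),\mathrm{lk}(\Gamma)$ for any fan $\Gamma$. For a fan $\Gamma$ and subfan $\Gamma'$, $\mathcal{R}[\Gamma,\Gamma']$ is the complex with $\mathcal{R}[\Gamma,\Gamma']_i=\bigoplus_{\gamma\in\Gamma_i\setminus\Gamma'_i}S$ ($0\le i\le n+1$) whose differential is the cellular boundary map of the relative cellular chain complex of the pair $(P(\Gamma),\mathrm{lk}(\Gamma)\cup P(\Gamma'))$ with coefficients in $S$ (the summand of $\gamma$ corresponding to the cell $P(\gamma)$). Given a subfan $\Gamma^{-}\subseteq\Gamma$ playing the role of $\Sigma^{-1}$, set $J(\tau)=\langle l_\tau^{\alpha(\tau)+1}\rangle$ for $\tau\in\Gamma_n\setminus\Gamma^-_n$, $J(\gamma)=\sum_{\tau\in\Gamma_n\setminus\Gamma^-_n,\ \gamma\subseteq\tau}J(\tau)$ for non-facets $\gamma$, $J(\sigma)=0$ for facets. $\mathcal{J}[\Gamma,\Gamma']_i=\bigoplus_{\gamma\in\Gamma_i\setminus\Gamma'_i}J(\gamma)$ is a subcomplex of $\mathcal{R}[\Gamma,\Gamma']$ and $\mathcal{R}/\mathcal{J}[\Gamma,\Gamma']$ is the quotient complex, $\mathcal{R}/\mathcal{J}[\Gamma,\Gamma']_i=\bigoplus_{\gamma\in\Gamma_i\setminus\Gamma'_i}S/J(\gamma)$. For $\mathcal{R}/\mathcal{J}[\Sigma,\Sigma^{-1}]$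 take $\Gamma^-=\Sigma^{-1}$; for $\mathcal{R}/\mathcal{J}[\Sigma_{W,\sigma},\Sigma^{-1}_{W,\sigma}]$ take $\Gamma=\Sigma_{W,\sigma}$, $\Gamma^-=\Sigma^{-1}_{W,\sigma}$. Lattice: $L_{\Sigma,\Sigma^{-1}}$ is the set of all intersections of subsets of the hyperplanes $\{\mathrm{aff}(\tau):\tau\in\Sigma_n\setminus\Sigma^{-1}_n\}$ (including $\mathbb{R}^{n+1}$). For $W\in L_{\Sigma,\Sigma^{-1}}$ and a facet $\sigma$, $\Sigma_{W,\sigma}$ is the subfan of all faces of facets $\sigma'$ for which there is a chain of facets $\sigma=\sigma_0,\ldots,\sigma_k=\sigma'$ with $\sigma_{j-1}\cap\sigma_j=\tau_j\in\Sigma_n$ and $W\subseteq\mathrm{aff}(\tau_j)$ for all $j$. $\Sigma^c_W$ is the subfan of faces $\gamma$ with $W\not\subseteq\mathrm{aff}(\gamma)$, and $\Sigma^{-1}_{W,\sigma}=(\Sigma^c_W\cup\Sigma^{-1})\cap\Sigma_{W,\sigma}$. *)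

theory Defs
  imports "HOL-Analysis.Analysis" "HOL-Library.Poly_Mapping"
begin

text \<open>Ambient space R^(n+1) is real^'n with CARD('n) = n+1.
 The polynomial ring S = R[x_v | v :: 'n] is the type 'n spoly below.\<close>

type_synonym 'n spoly = "('n \<Rightarrow>\<^sub>0 nat) \<Rightarrow>\<^sub>0 real"
type_synonym 'n cone = "(real^'n) set"

definition peval :: "'n::finite spoly \<Rightarrow> real^'n \<Rightarrow> real" where
  "peval p x = (\<Sum>m\<in>Poly_Mapping.keys p.
      Poly_Mapping.lookup p m * (\<Prod>v\<in>UNIV. (x $ v) ^ Poly_Mapping.lookup m v))"

definition ideal_of :: "(real^'n::finite) set \<Rightarrow> 'n spoly set" where
  "ideal_of W = {p. \<forall>x\<in>W. peval p x = 0}"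

definition prime_ideal :: "'n::finite spoly set \<Rightarrow> bool" where
  "prime_ideal P \<longleftrightarrow> 0 \<in> P \<and> (\<forall>a\<in>P. \<forall>b\<in>P. a + b \<in> P) \<and> (\<forall>r. \<forall>a\<in>P. r * a \<in> P)
     \<and> 1 \<notin> P \<and> (\<forall>a b. a * b \<in> P \<longrightarrow> a \<in> P \<or> b \<in> P)"

definition pideal :: "'n::finite spoly \<Rightarrow> 'n spoly set" where
  "pideal g = range (\<lambda>c. c * g)"

definition ideal_sum :: "'c set \<Rightarrow> ('c \<Rightarrow> 'n::finite spoly set) \<Rightarrow> 'n spoly set" where
  "ideal_sum T J = {(\<Sum>t\<in>T. f t) | f. \<forall>t\<in>T. f t \<in> J t}"

definition linform :: "'n::finite spoly \<Rightarrow> bool" where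
  "linform l \<longleftrightarrow> (\<forall>m\<in>Poly_Mapping.keys l. (\<Sum>v\<in>UNIV. Poly_Mapping.lookup m v) = 1)"

definition lform :: "'n::finite cone \<Rightarrow> 'n spoly" where
  "lform \<tau> = (SOME l. linform l \<and> pideal l = ideal_of (span \<tau>))"

definition pos_hull :: "(real^'n::finite) set \<Rightarrow> 'n cone" where
  "pos_hull F = {(\<Sum>v\<in>F. c v *\<^sub>R v) | c. \<forall>v\<in>F. 0 \<le> c v}"

definition is_cone :: "'n::finite cone \<Rightarrow> bool" where
  "is_cone \<gamma> \<longleftrightarrow> (\<exists>F. finite F \<and> \<gamma> = pos_hull F)"

definition cone_face :: "'n::finite cone \<Rightarrow> 'n cone \<Rightarrow> bool" where
  "cone_face f \<gamma> \<longleftrightarrow> (\<exists>a. (\<forall>x\<in>\<gamma>. 0 \<le> a \<bullet> x) \<and> f = {x\<in>\<gamma>. a \<bullet> x = 0})"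

definition is_fan :: "'n::finite cone set \<Rightarrow> bool" where
  "is_fan \<Sigma> \<longleftrightarrow> finite \<Sigma> \<and> (\<forall>\<gamma>\<in>\<Sigma>. is_cone \<gamma>)
     \<and> (\<forall>\<gamma>\<in>\<Sigma>. \<forall>f. cone_face f \<gamma> \<longrightarrow> f \<in> \<Sigma>)
     \<and> (\<forall>\<gamma>\<in>\<Sigma>. \<forall>\<gamma>'\<in>\<Sigma>. cone_face (\<gamma> \<inter> \<gamma>') \<gamma> \<and> cone_face (\<gamma> \<inter> \<gamma>') \<gamma>')"

definition facet :: "'n::finite cone set \<Rightarrow> 'n cone \<Rightarrow> bool" where
  "facet \<Sigma> \<sigma> \<longleftrightarrow> \<sigma> \<in> \<Sigma> \<and> (\<forall>\<gamma>\<in>\<Sigma>. \<sigma> \<subseteq> \<gamma> \<longrightarrow> \<gamma> = \<sigma>)"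

definition pure_full :: "'n::finite cone set \<Rightarrow> bool" where
  "pure_full \<Sigma> \<longleftrightarrow> (\<forall>\<sigma>. facet \<Sigma> \<sigma> \<longrightarrow> dim \<sigma> = CARD('n))"

definition hereditary :: "'n::finite cone set \<Rightarrow> bool" where
  "hereditary \<Sigma> \<longleftrightarrow> (\<forall>\<psi>\<in>\<Sigma>. \<forall>\<sigma> \<sigma>'.
     facet \<Sigma> \<sigma> \<and> \<psi> \<subseteq> \<sigma> \<and> facet \<Sigma> \<sigma>' \<and> \<psi> \<subseteq> \<sigma>' \<longrightarrow>
     (\<lambda>s s'. facet \<Sigma> s \<and> \<psi> \<subseteq> s \<and> facet \<Sigma> s' \<and> \<psi> \<subseteq> s' \<and> dim (s \<inter> s') + 1 = CARD('n))\<^sup>*\<^sup>* \<sigma> \<sigma>')"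

definition simplicial :: "'n::finite cone set \<Rightarrow> bool" where
  "simplicial \<Sigma> \<longleftrightarrow> (\<forall>\<gamma>\<in>\<Sigma>. \<exists>F. finite F \<and> independent F \<and> \<gamma> = pos_hull F)"

definition boundary_nface :: "'n::finite cone set \<Rightarrow> 'n cone \<Rightarrow> bool" where
  "boundary_nface \<Sigma> \<tau> \<longleftrightarrow> \<tau> \<in> \<Sigma> \<and> dim \<tau> + 1 = CARD('n) \<and> card {\<sigma>. facet \<Sigma> \<sigma> \<and> \<tau> \<subseteq> \<sigma>} = 1"

definition fan_boundary :: "'n::finite cone set \<Rightarrow> 'n cone set" where
  "fan_boundary \<Sigma> = {\<gamma>\<in>\<Sigma>. \<exists>\<tau>. boundary_nface \<Sigma> \<tau> \<and> \<gamma> \<subseteq> \<tau>}"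

definition smoothness_params :: "'n::finite cone set \<Rightarrow> ('n cone \<Rightarrow> int) \<Rightarrow> bool" where
  "smoothness_params \<Sigma> \<alpha> \<longleftrightarrow> (\<forall>\<tau>\<in>\<Sigma>. dim \<tau> + 1 = CARD('n) \<longrightarrow>
      -1 \<le> \<alpha> \<tau> \<and> (\<tau> \<notin> fan_boundary \<Sigma> \<longrightarrow> 0 \<le> \<alpha> \<tau>))"

definition sigma_m1 :: "'n::finite cone set \<Rightarrow> ('n cone \<Rightarrow> int) \<Rightarrow> 'n cone set" where
  "sigma_m1 \<Sigma> \<alpha> = {\<gamma>\<in>fan_boundary \<Sigma>. \<exists>\<tau>\<in>\<Sigma>. dim \<tau> + 1 = CARD('n) \<and> \<alpha> \<tau> = -1 \<and> \<gamma> \<subseteq> \<tau>}"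

definition hyp_lattice :: "'n::finite cone set \<Rightarrow> 'n cone set \<Rightarrow> (real^'n) set set" where
  "hyp_lattice \<Sigma> \<Sigma>m = (\<lambda>H. \<Inter>H) ` Pow ((\<lambda>\<tau>. span \<tau>) ` {\<tau>\<in>\<Sigma>. dim \<tau> + 1 = CARD('n) \<and> \<tau> \<notin> \<Sigma>m})"

definition W_adj :: "'n::finite cone set \<Rightarrow> (real^'n) set \<Rightarrow> 'n cone \<Rightarrow> 'n cone \<Rightarrow> bool" where
  "W_adj \<Sigma> W s s' \<longleftrightarrow> facet \<Sigma> s \<and> facet \<Sigma> s' \<and> s \<inter> s' \<in> \<Sigma> \<and> dim (s \<inter> s') + 1 = CARD('n)
     \<and> W \<subseteq> span (s \<inter> s')"

definition sigma_W :: "'n::finite cone set \<Rightarrow> (real^'n) set \<Rightarrow> 'n cone \<Rightarrow> 'n cone set" where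
  "sigma_W \<Sigma> W \<sigma> = {\<gamma>\<in>\<Sigma>. \<exists>\<sigma>'. (W_adj \<Sigma> W)\<^sup>*\<^sup>* \<sigma> \<sigma>' \<and> facet \<Sigma> \<sigma>' \<and> \<gamma> \<subseteq> \<sigma>'}"

definition sigma_c :: "'n::finite cone set \<Rightarrow> (real^'n) set \<Rightarrow> 'n cone set" where
  "sigma_c \<Sigma> W = {\<gamma>\<in>\<Sigma>. \<not> W \<subseteq> span \<gamma>}"

definition sigma_m1_W :: "'n::finite cone set \<Rightarrow> ('n cone \<Rightarrow> int) \<Rightarrow> (real^'n) set \<Rightarrow> 'n cone \<Rightarrow> 'n cone set" where
  "sigma_m1_W \<Sigma> \<alpha> W \<sigma> = (sigma_c \<Sigma> W \<union> sigma_m1 \<Sigma> \<alpha>) \<inter> sigma_W \<Sigma> W \<sigma>"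

definition ndet :: "nat \<Rightarrow> (nat \<Rightarrow> nat \<Rightarrow> real) \<Rightarrow> real" where
  "ndet k M = (\<Sum>p\<in>{p. p permutes {..<k}}. of_int (sign p) * (\<Prod>i<k. M i (p i)))"

text \<open>Orientation of the cell P(gamma): an ordered basis of aff(gamma).\<close>
definition ori :: "'n::finite cone \<Rightarrow> (real^'n) list" where
  "ori \<gamma> = (SOME b. length b = dim \<gamma> \<and> distinct b \<and> independent (set b) \<and> span (set b) = span \<gamma>)"

text \<open>Incidence number [P(gamma) : P(gamma')] for a facet gamma' of gamma, using the
 outward-normal-first boundary orientation convention.  The relative orientation of two
 ordered bases b, c of the same subspace is the sign of det(b_i . c_j).\<close>
definition incidence :: "'n::finite cone \<Rightarrow> 'n cone \<Rightarrow> int" where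
  "incidence \<gamma> \<gamma>' = (let b = ori \<gamma>; w = (SOME w. w \<in> \<gamma> \<and> w \<notin> span \<gamma>');
      c = (- w) # ori \<gamma>' in
      if ndet (dim \<gamma>) (\<lambda>i j. (b ! i) \<bullet> (c ! j)) > 0 then 1 else -1)"

definition cells :: "'n::finite cone set \<Rightarrow> 'n cone set \<Rightarrow> nat \<Rightarrow> 'n cone set" where
  "cells G G' i = {\<gamma>\<in>G. dim \<gamma> = i} - G'"

definition chains :: "'n::finite cone set \<Rightarrow> 'n cone set \<Rightarrow> nat \<Rightarrow> ('n cone \<Rightarrow> 'n spoly) set" where
  "chains G G' i = {c. \<forall>\<gamma>. \<gamma> \<notin> cells G G' i \<longrightarrow> c \<gamma> = 0}"

definition bd :: "'n::finite cone set \<Rightarrow> 'n cone set \<Rightarrow> nat \<Rightarrow> ('n cone \<Rightarrow> 'n spoly) \<Rightarrow> ('n cone \<Rightarrow> 'n spoly)" where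
  "bd G G' i c = (\<lambda>\<gamma>'. if \<gamma>' \<in> cells G G' (i - 1)
      then (\<Sum>\<gamma>\<in>cells G G' i. if \<gamma>' \<subseteq> \<gamma> then of_int (incidence \<gamma> \<gamma>') * c \<gamma> else 0)
      else 0)"

definition Jfun :: "'n::finite cone set \<Rightarrow> 'n cone set \<Rightarrow> ('n cone \<Rightarrow> int) \<Rightarrow> 'n cone \<Rightarrow> 'n spoly set" where
  "Jfun G Gm \<alpha> \<gamma> = (if facet G \<gamma> then {0} else
      ideal_sum {\<tau>\<in>G. dim \<tau> + 1 = CARD('n) \<and> \<tau> \<notin> Gm \<and> \<gamma> \<subseteq> \<tau>}
        (\<lambda>\<tau>. pideal (lform \<tau> ^ nat (\<alpha> \<tau> + 1))))"

text \<open>Homology of the quotient complex (components of chains taken modulo Jf), via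
 representatives: cycles and boundaries in the free complex modulo the submodule.\<close>
definition cycles :: "'n::finite cone set \<Rightarrow> 'n cone set \<Rightarrow> ('n cone \<Rightarrow> 'n spoly set) \<Rightarrow> nat \<Rightarrow> ('n cone \<Rightarrow> 'n spoly) set" where
  "cycles G G' Jf i = {z\<in>chains G G' i. \<forall>\<gamma>. bd G G' i z \<gamma> \<in> Jf \<gamma>}"

definition bounds :: "'n::finite cone set \<Rightarrow> 'n cone set \<Rightarrow> ('n cone \<Rightarrow> 'n spoly set) \<Rightarrow> nat \<Rightarrow> ('n cone \<Rightarrow> 'n spoly) set" where
  "bounds G G' Jf i = {(\<lambda>\<gamma>. bd G G' (i + 1) b \<gamma> + j \<gamma>) | b j.
      b \<in> chains G G' (i + 1) \<and> j \<in> chains G G' i \<and> (\<forall>\<gamma>. j \<gamma> \<in> Jf \<gamma>)}"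

definition hom_ann :: "'n::finite cone set \<Rightarrow> 'n cone set \<Rightarrow> ('n cone \<Rightarrow> 'n spoly set) \<Rightarrow> nat \<Rightarrow> ('n cone \<Rightarrow> 'n spoly) \<Rightarrow> 'n spoly set" where
  "hom_ann G G' Jf i z = {f. (\<lambda>\<gamma>. f * z \<gamma>) \<in> bounds G G' Jf i}"

definition Ass_H :: "'n::finite cone set \<Rightarrow> 'n cone set \<Rightarrow> ('n cone \<Rightarrow> 'n spoly set) \<Rightarrow> nat \<Rightarrow> 'n spoly set set" where
  "Ass_H G G' Jf i = {P. prime_ideal P \<and> (\<exists>z\<in>cycles G G' Jf i. P = hom_ann G G' Jf i z)}"

definition H_zero :: "'n::finite cone set \<Rightarrow> 'n cone set \<Rightarrow> ('n cone \<Rightarrow> 'n spoly set) \<Rightarrow> nat \<Rightarrow> bool" where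
  "H_zero G G' Jf i \<longleftrightarrow> cycles G G' Jf i \<subseteq> bounds G G' Jf i"

end

theory Submission
  imports "Jordan_Normal_Form.Determinant" Defs
begin

text \<open>
Let \<open>P\<close> be the annihilator of a class \<open>z\<close> in \<open>H\<^sub>i\<close>, and let \<open>W\<close> be the intersection of the
hyperplanes whose linear forms lie in \<open>P\<close>. The product \<open>h\<close> of the powers of the remaining forms is
not in \<open>P\<close> and kills every cell whose span does not contain \<open>W\<close>. The remaining cells split into
the complexes of the subfans \<open>\<Sigma>\<^bsub>W,\<sigma>\<^esub>\<close>, so \<open>P\<close> is already the annihilator of the component of \<open>z\<close>
in one of them. There all ideals are stable under derivatives in directions of \<open>W\<close>, hence so is
\<open>P\<close>, and since \<open>P\<close> contains the ideal of \<open>W\<close> this forces \<open>P = I(W)\<close>.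

For \<open>dim W \<ge> i\<close> every \<open>i\<close>-chain of that component is a boundary. For \<open>dim W = i - 1\<close> the ideal part
of the complex is onto in degree \<open>i - 1\<close>, so the homology is a quotient of the homology with
coefficients \<open>S\<close>. In a simplicial fan all cells of the component contain one common face \<open>\<gamma>\<close>,
stability under derivatives in directions of \<open>\<gamma>\<close> gives \<open>W = aff(\<gamma>)\<close>, and connectedness of the
link of \<open>\<gamma>\<close> gives the vanishing needed in (2).
\<close>

text \<open>Localising at \<open>P\<close> would make every linear form outside \<open>P\<close>
  invertible. Multiplication by \<open>h\<close> takes its place and keeps all arguments inside
  polynomials. It works because an \<open>i\<close>-cell whose span does not contain
  \<open>W\<close> lies in a wall whose span does not contain \<open>W\<close> either; the power
  belonging to this wall is both a factor of \<open>h\<close> and a generator of the ideal of the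
  cell.

  A priori \<open>P\<close> need not be generated by the linear forms that it contains. Derivatives
  settle this: the ideal of a cell is generated by powers of forms that vanish on the span of the
  cell, and the boundary map has integer coefficients. Differentiation along \<open>W\<close>
  therefore acts on chains modulo boundaries of a class, and it is locally nilpotent there. In
  characteristic zero such an action preserves prime annihilators.

  Signs of incidence numbers enter in two ways: each is a unit, and the two paths from a simplicial
  cone down to a face of codimension two have opposite signs.\<close>

no_notation scalar_prod (infix "\<bullet>" 70)
no_notation vec_index (infixl "$" 100)

section \<open>Polynomials and polynomial functions\<close>

lemma poly_mapping_additive_induct [case_names zero single add]:
  fixes p :: "'a \<Rightarrow>\<^sub>0 'b::comm_monoid_add"
  assumes "P 0" "\<And>k v. P (Poly_Mapping.single k v)" "\<And>a b. P a \<Longrightarrow> P b \<Longrightarrow> P (a + b)"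
  shows "P p"
proof (induct p rule: Poly_Mapping.update_induct)
  case const
  then show ?case by (rule assms(1))
next
  case (update f a b)
  have "Poly_Mapping.update a b f = f + Poly_Mapping.single a b"
    using update(1) by (intro poly_mapping_eqI)
      (auto simp: lookup_update lookup_add lookup_single when_def in_keys_iff)
  then show ?case using assms update by metis
qed

definition Const :: "real \<Rightarrow> 'n::finite spoly" where
  "Const c = Poly_Mapping.single 0 c"

definition Var :: "'n::finite \<Rightarrow> 'n spoly" where
  "Var v = Poly_Mapping.single (Poly_Mapping.single v 1) 1"

lemma Const_mult: "Const a * Const b = Const (a * b)"
  by (simp add: Const_def mult_single)

lemma Const_1: "Const 1 = 1"
  by (simp add: Const_def)

lemma spoly_induct [case_names Const Var add mult]:
  fixes p :: "'n::finite spoly"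
  assumes C: "\<And>c. P (Const c)" and V: "\<And>v. P (Var v)"
    and A: "\<And>a b. P a \<Longrightarrow> P b \<Longrightarrow> P (a + b)" and M: "\<And>a b. P a \<Longrightarrow> P b \<Longrightarrow> P (a * b)"
  shows "P p"
proof (induct p rule: poly_mapping_additive_induct)
  case zero
  show ?case using C[of 0] by (simp add: Const_def)
next
  case (single m c)
  have one: "P (Poly_Mapping.single m 1)"
  proof (induct m rule: poly_mapping_additive_induct)
    case zero
    show ?case using C[of 1] by (simp add: Const_def)
  next
    case (single v k)
    show ?case
    proof (induct k)
      case 0
      show ?case using C[of 1] by (simp add: Const_def)
    next
      case (Suc k)
      have "Poly_Mapping.single (Poly_Mapping.single v (Suc k)) (1::real)
          = Var v * Poly_Mapping.single (Poly_Mapping.single v k) 1"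
        by (simp add: Var_def mult_single single_add[symmetric])
      then show ?case using M V Suc by metis
    qed
  next
    case (add a b)
    have "Poly_Mapping.single (a + b) (1::real) = Poly_Mapping.single a 1 * Poly_Mapping.single b 1"
      by (simp add: mult_single)
    then show ?case using M add by metis
  qed
  have "Poly_Mapping.single m c = Const c * Poly_Mapping.single m 1"
    by (simp add: Const_def mult_single)
  then show ?case using M one C by metis
next
  case (add a b)
  then show ?case by (rule A)
qed

lemma peval_superset:
  assumes "finite M" "Poly_Mapping.keys p \<subseteq> M"
  shows "peval p x = (\<Sum>m\<in>M. Poly_Mapping.lookup p m * (\<Prod>v\<in>UNIV. (x $ v) ^ Poly_Mapping.lookup m v))"
  unfolding peval_def
  by (rule sum.mono_neutral_left) (use assms in \<open>auto simp: in_keys_iff\<close>)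

lemma peval_0 [simp]: "peval 0 x = 0"
  by (simp add: peval_def)

lemma peval_single:
  "peval (Poly_Mapping.single m c) x = c * (\<Prod>v\<in>UNIV. (x $ v) ^ Poly_Mapping.lookup m v)"
  by (subst peval_superset[of "{m}"]) auto

lemma peval_add [simp]: "peval (p + q) x = peval p x + peval q x"
proof -
  let ?M = "Poly_Mapping.keys p \<union> Poly_Mapping.keys q"
  have M: "finite ?M" "Poly_Mapping.keys p \<subseteq> ?M" "Poly_Mapping.keys q \<subseteq> ?M"
    "Poly_Mapping.keys (p + q) \<subseteq> ?M"
    using keys_add[of p q] by auto
  show ?thesis
    unfolding peval_superset[OF M(1,2)] peval_superset[OF M(1,3)] peval_superset[OF M(1,4)]
    by (simp add: lookup_add distrib_right sum.distrib)
qed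

lemma peval_mult [simp]: "peval (p * q) x = peval p x * peval q x"
proof (induct p rule: poly_mapping_additive_induct)
  case (single m c)
  show ?case
    by (induct q rule: poly_mapping_additive_induct)
      (auto simp: mult_single peval_single lookup_add power_add prod.distrib distrib_left)
qed (auto simp: distrib_right)

lemma peval_Const [simp]: "peval (Const c) x = c"
  by (simp add: Const_def peval_single)

lemma peval_1 [simp]: "peval 1 x = 1"
  using peval_Const[of 1 x] by (simp add: Const_1)

lemma peval_Var [simp]: "peval (Var v) x = x $ v"
proof -
  have "(\<Prod>u\<in>UNIV. (x $ u) ^ Poly_Mapping.lookup (Poly_Mapping.single v (1::nat)) u)
      = (\<Prod>u\<in>UNIV. if u = v then x $ v else 1)"
    by (intro prod.cong) (auto simp: lookup_single when_def)
  then show ?thesis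
    by (simp add: Var_def peval_single)
qed

lemma peval_uminus [simp]: "peval (- p) x = - peval p x"
  using peval_add[of p "- p" x] by simp

lemma peval_diff [simp]: "peval (p - q) x = peval p x - peval q x"
  using peval_add[of "p - q" q x] by simp

lemma peval_sum [simp]: "peval (sum f A) x = (\<Sum>a\<in>A. peval (f a) x)"
  by (induct A rule: infinite_finite_induct) auto

text \<open>Freezing all variables except \<open>u\<close> and grouping by the exponent of
  \<open>u\<close> leaves a univariate polynomial that vanishes identically, so each of its
  coefficients vanishes for every choice of the other variables. Exponents are compared on
  \<open>V\<close> only, which lets the induction continue with the terms of one fixed exponent in
  \<open>u\<close>.\<close>

lemma vanishing_monomial_sum:
  fixes c :: "('a \<Rightarrow> nat) \<Rightarrow> real"
  assumes "finite V" "finite M"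
    and "\<And>x. (\<Sum>m\<in>M. c m * (\<Prod>v\<in>V. x v ^ m v)) = 0"
  shows "(\<Sum>m\<in>{m\<in>M. \<forall>v\<in>V. m v = k v}. c m) = 0"
  using assms
proof (induct V arbitrary: M rule: finite_induct)
  case empty
  then show ?case by simp
next
  case (insert u V)
  \<comment> \<open>\<open>k u\<close> is included so that the wanted exponent is among those below
    the bound even if no term of \<open>M\<close> has it.\<close>
  define N where "N = Max (insert (k u) ((\<lambda>m. m u) ` M))"
  have N: "k u \<le> N" "m \<in> M \<Longrightarrow> m u \<le> N" for m
    unfolding N_def using insert.prems by auto
  have "(\<Sum>m\<in>{m\<in>M. m u = k u}. c m * (\<Prod>v\<in>V. x v ^ m v)) = 0" for x
  proof -
    define d where "d j = (\<Sum>m\<in>{m\<in>M. m u = j}. c m * (\<Prod>v\<in>V. x v ^ m v))" for j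
    have "(\<Sum>j\<le>N. d j * t ^ j) = 0" for t :: real
    proof -
      have "0 = (\<Sum>m\<in>M. c m * (\<Prod>v\<in>insert u V. (x(u := t)) v ^ m v))"
        using insert.prems(2) by metis
      also have "\<dots> = (\<Sum>m\<in>M. (c m * (\<Prod>v\<in>V. x v ^ m v)) * t ^ m u)"
      proof (intro sum.cong refl)
        fix m assume "m \<in> M"
        have "(\<Prod>v\<in>V. (x(u := t)) v ^ m v) = (\<Prod>v\<in>V. x v ^ m v)"
          using insert.hyps by (intro prod.cong) auto
        then show "c m * (\<Prod>v\<in>insert u V. (x(u := t)) v ^ m v) = c m * (\<Prod>v\<in>V. x v ^ m v) * t ^ m u"
          using insert.hyps by simp
      qed
      also have "\<dots> = (\<Sum>j\<le>N. \<Sum>m\<in>{m\<in>M. m u = j}. (c m * (\<Prod>v\<in>V. x v ^ m v)) * t ^ m u)"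
        by (rule sum.group[symmetric]) (use insert.prems N in auto)
      also have "\<dots> = (\<Sum>j\<le>N. d j * t ^ j)"
        unfolding d_def sum_distrib_right by (intro sum.cong) auto
      finally show ?thesis by simp
    qed
    then have "\<forall>j\<le>N. d j = 0"
      using Transcendental.polyfun_eq_0[of d N] by blast
    then show ?thesis using N by (simp add: d_def)
  qed
  then have "(\<Sum>m\<in>{m \<in> {m\<in>M. m u = k u}. \<forall>v\<in>V. m v = k v}. c m) = 0"
    using insert by (intro insert.hyps(3)) auto
  moreover have "{m \<in> {m\<in>M. m u = k u}. \<forall>v\<in>V. m v = k v} = {m\<in>M. \<forall>v\<in>insert u V. m v = k v}"
    by auto
  ultimately show ?case by metis
qed

lemma peval_eq_0_imp:
  fixes p :: "'n::finite spoly"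
  assumes "\<And>x. peval p x = 0"
  shows "p = 0"
proof (rule poly_mapping_eqI)
  fix k :: "'n \<Rightarrow>\<^sub>0 nat"
  let ?l = "Poly_Mapping.lookup :: ('n \<Rightarrow>\<^sub>0 nat) \<Rightarrow> _"
  define c where "c f = Poly_Mapping.lookup p (Abs_poly_mapping f)" for f
  have inj: "inj_on ?l A" for A
    by (simp add: inj_on_def lookup_inject)
  have cl: "c (?l m) = Poly_Mapping.lookup p m" for m
    by (simp add: c_def lookup_inverse)
  have "(\<Sum>m\<in>{m\<in>?l ` Poly_Mapping.keys p. \<forall>v\<in>UNIV. m v = ?l k v}. c m) = 0"
  proof (rule vanishing_monomial_sum)
    fix x :: "'n \<Rightarrow> real"
    have "0 = peval p (\<chi> v. x v)" using assms by simp
    also have "\<dots> = (\<Sum>m\<in>?l ` Poly_Mapping.keys p. c m * (\<Prod>v\<in>UNIV. x v ^ m v))"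
      unfolding peval_def by (subst sum.reindex[OF inj]) (simp add: cl)
    finally show "(\<Sum>m\<in>?l ` Poly_Mapping.keys p. c m * (\<Prod>v\<in>UNIV. x v ^ m v)) = 0" by simp
  qed auto
  moreover have "{m\<in>?l ` Poly_Mapping.keys p. \<forall>v\<in>UNIV. m v = ?l k v} = {?l k}"
    if "k \<in> Poly_Mapping.keys p"
    using that by (auto intro: ext)
  ultimately have "c (?l k) = 0" if "k \<in> Poly_Mapping.keys p"
    using that by simp
  then show "Poly_Mapping.lookup p k = Poly_Mapping.lookup 0 k"
    unfolding cl in_keys_iff lookup_zero by argo
qed

lemma peval_eqI:
  assumes "\<And>x. peval p x = peval q x"
  shows "p = q"
  using peval_eq_0_imp[of "p - q"] assms by simp

section \<open>Linear forms and ideals\<close>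

definition lin :: "real^'n::finite \<Rightarrow> 'n spoly" where
  "lin a = (\<Sum>v\<in>UNIV. Const (a $ v) * Var v)"

lemma peval_lin [simp]: "peval (lin a) x = a \<bullet> x"
  by (simp add: lin_def inner_vec_def)

lemma linform_lin: "linform (lin a)"
  unfolding linform_def
proof
  fix m assume m: "m \<in> Poly_Mapping.keys (lin a)"
  have "lin a = (\<Sum>v\<in>UNIV. Poly_Mapping.single (Poly_Mapping.single v 1) (a $ v))"
    by (simp add: lin_def Const_def Var_def mult_single)
  then have "Poly_Mapping.lookup (lin a) m
      = (\<Sum>v\<in>UNIV. Poly_Mapping.lookup (Poly_Mapping.single (Poly_Mapping.single v 1) (a $ v)) m)"
    by (simp add: lookup_sum)
  with m have "(\<Sum>v\<in>UNIV. Poly_Mapping.lookup (Poly_Mapping.single (Poly_Mapping.single v 1) (a $ v)) m) \<noteq> 0"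
    by (simp add: in_keys_iff)
  then obtain v where "Poly_Mapping.lookup (Poly_Mapping.single (Poly_Mapping.single v 1) (a $ v)) m \<noteq> 0"
    by (rule sum.not_neutral_contains_not_neutral)
  then have "m = Poly_Mapping.single v 1"
    by (auto simp: lookup_single when_def split: if_splits)
  then show "(\<Sum>v\<in>UNIV. Poly_Mapping.lookup m v) = 1"
    by (simp add: lookup_single when_def)
qed

definition is_ideal :: "'n::finite spoly set \<Rightarrow> bool" where
  "is_ideal I \<longleftrightarrow> 0 \<in> I \<and> (\<forall>a\<in>I. \<forall>b\<in>I. a + b \<in> I) \<and> (\<forall>r. \<forall>a\<in>I. r * a \<in> I)"

lemma is_idealD:
  assumes "is_ideal I"
  shows "0 \<in> I" "a \<in> I \<Longrightarrow> b \<in> I \<Longrightarrow> a + b \<in> I" "a \<in> I \<Longrightarrow> r * a \<in> I" "a \<in> I \<Longrightarrow> a * r \<in> I"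
    "a \<in> I \<Longrightarrow> - a \<in> I" "a \<in> I \<Longrightarrow> b \<in> I \<Longrightarrow> a - b \<in> I"
proof -
  show a: "0 \<in> I" "a \<in> I \<Longrightarrow> b \<in> I \<Longrightarrow> a + b \<in> I" "a \<in> I \<Longrightarrow> r * a \<in> I" for a b r
    using assms by (auto simp: is_ideal_def)
  show "a \<in> I \<Longrightarrow> a * r \<in> I" using a(3)[of a r] by (simp add: mult.commute)
  show m: "a \<in> I \<Longrightarrow> - a \<in> I" for a using a(3)[of a "- 1"] by simp
  show "a \<in> I \<Longrightarrow> b \<in> I \<Longrightarrow> a - b \<in> I" using a(2)[of a "- b"] m by simp
qed

lemma prime_ideal_is_ideal: "prime_ideal P \<Longrightarrow> is_ideal P"
  by (auto simp: prime_ideal_def is_ideal_def)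

lemma prime_ideal_mult: "prime_ideal P \<Longrightarrow> a * b \<in> P \<Longrightarrow> a \<in> P \<or> b \<in> P"
  unfolding prime_ideal_def by blast

lemma prime_ideal_power:
  assumes "prime_ideal P" "a ^ k \<in> P"
  shows "a \<in> P"
  using assms(2)
proof (induct k)
  case (Suc k)
  then show ?case using assms(1) unfolding prime_ideal_def by (metis power_Suc)
qed (use assms(1) in \<open>simp add: prime_ideal_def\<close>)

lemma prime_ideal_prod:
  assumes "prime_ideal P" "finite A" "(\<Prod>a\<in>A. f a) \<in> P"
  shows "\<exists>a\<in>A. f a \<in> P"
  using assms(2,3)
proof (induct A rule: finite_induct)
  case (insert a A)
  then show ?case
    using assms(1) unfolding prime_ideal_def by (metis insert_iff prod.insert)
qed (use assms(1) in \<open>simp add: prime_ideal_def\<close>)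

lemma prime_ideal_Const:
  assumes "prime_ideal P" "Const c \<in> P"
  shows "c = 0"
proof (rule ccontr)
  assume "c \<noteq> 0"
  then have "Const (1 / c) * Const c = 1" by (simp add: Const_mult Const_1)
  then show False using assms by (metis prime_ideal_def)
qed

text \<open>Modulo an ideal containing the linear forms that vanish on \<open>W\<close>, a polynomial is congruent
  to its composition with the orthogonal projection onto \<open>W\<close>.\<close>

lemma ideal_of_subspace_le:
  fixes W :: "(real^'n::finite) set"
  assumes W: "subspace W" and I: "is_ideal I"
    and lin: "\<And>a. (\<forall>x\<in>W. a \<bullet> x = 0) \<Longrightarrow> lin a \<in> I"
  shows "ideal_of W \<subseteq> I"
proof
  fix f assume f: "f \<in> ideal_of W"
  obtain B where B: "B \<subseteq> W" "pairwise orthogonal B" "\<And>x. x \<in> B \<Longrightarrow> norm x = 1"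
    "independent B" "card B = dim W" "span B = W"
    using orthonormal_basis_subspace[OF W] by blast
  have finB: "finite B" using B(4) by (simp add: independent_imp_finite)
  define p where "p x = (\<Sum>b\<in>B. (b \<bullet> x) *\<^sub>R b)" for x
  have pW: "p x \<in> W" for x
    unfolding p_def using B W by (intro subspace_sum) (auto intro: subspace_scale)
  have px: "p x = x" if "x \<in> W" for x
  proof -
    have x: "x \<in> span B" using that B by simp
    have "\<forall>b\<in>B. orthogonal (x - p x) b"
    proof
      fix b assume b: "b \<in> B"
      have "p x \<bullet> b = (\<Sum>c\<in>B. (c \<bullet> x) * (c \<bullet> b))"
        by (simp add: p_def inner_sum_left)
      also have "\<dots> = (\<Sum>c\<in>B. if c = b then b \<bullet> x else 0)"
        using b B(2,3) by (intro sum.cong) (auto simp: pairwise_def orthogonal_def norm_eq_1)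
      finally have "p x \<bullet> b = b \<bullet> x" using b finB by simp
      then show "orthogonal (x - p x) b"
        by (simp add: orthogonal_def inner_diff_left inner_commute[of x])
    qed
    moreover have "x - p x \<in> span B"
      using that pW[of x] W B(6) by (simp add: subspace_diff)
    ultimately have "orthogonal (x - p x) (x - p x)"
      using orthogonal_to_span by blast
    then show ?thesis by (simp add: orthogonal_def)
  qed
  have sym: "p a \<bullet> x = a \<bullet> p x" for a x
    by (simp add: p_def inner_sum_left inner_sum_right inner_commute mult.commute)
  \<comment> \<open>The composition of \<open>q\<close> with the projection is again a polynomial.
    Only variables need an argument: there the difference is a linear form whose coefficient vector
    is orthogonal to \<open>W\<close>.\<close>
  have "\<exists>g. (\<forall>x. peval g x = peval q (p x)) \<and> q - g \<in> I" for q
  proof (induct q rule: spoly_induct)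
    case (Const c)
    then show ?case by (intro exI[of _ "Const c"]) (use I in \<open>auto simp: is_idealD\<close>)
  next
    case (Var v)
    let ?e = "axis v 1 :: real^'n"
    have v: "Var v = lin ?e"
      by (rule peval_eqI) (simp add: inner_axis inner_commute)
    have "lin ?e - lin (p ?e) = lin (?e - p ?e)"
      by (rule peval_eqI) (simp add: inner_diff_left)
    moreover have "lin (?e - p ?e) \<in> I"
      by (rule lin) (auto simp: inner_diff_left sym px)
    ultimately show ?case
      unfolding v by (intro exI[of _ "lin (p ?e)"]) (auto simp: sym)
  next
    case (add a b)
    then obtain g h where gh: "\<forall>x. peval g x = peval a (p x)" "a - g \<in> I"
      "\<forall>x. peval h x = peval b (p x)" "b - h \<in> I" by blast
    have "a + b - (g + h) = (a - g) + (b - h)" by simp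
    also have "\<dots> \<in> I" using gh by (intro is_idealD(2)[OF I])
    finally show ?case using gh by (intro exI[of _ "g + h"]) simp
  next
    case (mult a b)
    then obtain g h where gh: "\<forall>x. peval g x = peval a (p x)" "a - g \<in> I"
      "\<forall>x. peval h x = peval b (p x)" "b - h \<in> I" by blast
    have "a * b - (g * h) = (a - g) * b + g * (b - h)" by (simp add: algebra_simps)
    also have "\<dots> \<in> I" using gh by (intro is_idealD(2)[OF I] is_idealD(3,4)[OF I])
    finally show ?case using gh by (intro exI[of _ "g * h"]) simp
  qed
  then obtain g where g: "\<forall>x. peval g x = peval f (p x)" "f - g \<in> I" by blast
  have "g = 0" using g(1) f pW by (intro peval_eq_0_imp) (auto simp: ideal_of_def)
  then show "f \<in> I" using g by simp
qed

lemma is_ideal_pideal: "is_ideal (pideal g)"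
  unfolding is_ideal_def pideal_def
proof (intro conjI ballI allI)
  show "0 \<in> range (\<lambda>c. c * g)" by (rule range_eqI[of _ _ 0]) simp
next
  fix a b assume "a \<in> range (\<lambda>c. c * g)" "b \<in> range (\<lambda>c. c * g)"
  then obtain c d where "a = c * g" "b = d * g" by blast
  then show "a + b \<in> range (\<lambda>c. c * g)" by (intro range_eqI[of _ _ "c + d"]) (simp add: distrib_right)
next
  fix r a assume "a \<in> range (\<lambda>c. c * g)"
  then obtain c where "a = c * g" by blast
  then show "r * a \<in> range (\<lambda>c. c * g)" by (intro range_eqI[of _ _ "r * c"]) (simp add: mult.assoc)
qed

lemma self_in_pideal: "g \<in> pideal g"
  unfolding pideal_def by (rule range_eqI[of _ _ 1]) simp

text \<open>A linear form that vanishes on a hyperplane is a multiple of the equation of the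
  hyperplane, so the principal ideal satisfies the assumption of
  \<open>ideal_of_subspace_le\<close>.\<close>

lemma pideal_lin:
  fixes a :: "real^'n::finite"
  assumes "a \<noteq> 0"
  shows "pideal (lin a) = ideal_of {x. a \<bullet> x = 0}"
proof
  show "pideal (lin a) \<subseteq> ideal_of {x. a \<bullet> x = 0}"
    by (auto simp: pideal_def ideal_of_def)
  show "ideal_of {x. a \<bullet> x = 0} \<subseteq> pideal (lin a)"
  proof (rule ideal_of_subspace_le)
    show "subspace {x. a \<bullet> x = 0}" by (rule subspace_hyperplane)
    show "is_ideal (pideal (lin a))" by (rule is_ideal_pideal)
    fix b assume b: "\<forall>x\<in>{x. a \<bullet> x = 0}. b \<bullet> x = 0"
    define c where "c = (a \<bullet> b) / (a \<bullet> a)"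
    have aa: "a \<bullet> a \<noteq> 0" using assms by simp
    have o: "a \<bullet> (b - c *\<^sub>R a) = 0"
      using aa by (simp add: c_def inner_diff_right)
    then have "b \<bullet> (b - c *\<^sub>R a) = 0" using b by simp
    with o have "(b - c *\<^sub>R a) \<bullet> (b - c *\<^sub>R a) = 0"
      by (simp add: inner_diff_left)
    then have "b = c *\<^sub>R a" by simp
    then have "lin b = Const c * lin a" by (intro peval_eqI) simp
    then show "lin b \<in> pideal (lin a)"
      by (simp add: is_idealD(3)[OF is_ideal_pideal self_in_pideal])
  qed
qed

lemma pideal_power_cong:
  assumes "pideal g = pideal h"
  shows "pideal (g ^ k) = pideal (h ^ k)"
proof -
  have "pideal (g ^ k) \<subseteq> pideal (h ^ k)" if gh: "pideal g = pideal h" for g h :: "'a spoly"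
  proof -
    obtain c where "g = c * h"
      using self_in_pideal[of g] unfolding gh by (auto simp: pideal_def)
    then have "g ^ k \<in> pideal (h ^ k)"
      by (simp add: power_mult_distrib is_idealD(3)[OF is_ideal_pideal] self_in_pideal)
    then show ?thesis
      using is_idealD(3)[OF is_ideal_pideal] by (auto simp: pideal_def[of "g ^ k"])
  qed
  then show ?thesis using assms by blast
qed

text \<open>\<open>lform\<close> is an arbitrary choice, so it is compared with the explicit form
  \<open>lin a\<close> through the ideals that both generate.\<close>

lemma pideal_lform:
  fixes \<tau> :: "'n::finite cone"
  assumes "span \<tau> = {x. a \<bullet> x = 0}" "a \<noteq> 0"
  shows "pideal (lform \<tau>) = pideal (lin a)"
proof -
  have "linform (lin a) \<and> pideal (lin a) = ideal_of (span \<tau>)"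
    using assms by (simp add: linform_lin pideal_lin)
  then have "linform (lform \<tau>) \<and> pideal (lform \<tau>) = ideal_of (span \<tau>)"
    unfolding lform_def by (rule someI)
  then show ?thesis using assms by (simp add: pideal_lin)
qed

text \<open>The directional derivative is characterised through evaluation: over the infinite field
  of reals a polynomial is determined by its values.\<close>

definition dirderiv :: "real^'n::finite \<Rightarrow> 'n spoly \<Rightarrow> 'n spoly" where
  "dirderiv w p = (THE q. \<forall>x. ((\<lambda>t. peval p (x + t *\<^sub>R w)) has_real_derivative peval q x) (at 0))"

lemma has_derivative_dirderiv:
  "((\<lambda>t. peval p (x + t *\<^sub>R w)) has_real_derivative peval (dirderiv w p) x) (at 0)"
proof -
  let ?Q = "\<lambda>p q. \<forall>x. ((\<lambda>t. peval p (x + t *\<^sub>R w)) has_real_derivative peval q x) (at 0)"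
  have ex: "\<exists>q. ?Q p q"
  proof (induct p rule: spoly_induct)
    case (Const c)
    show ?case by (intro exI[of _ 0]) simp
  next
    case (Var v)
    show ?case by (intro exI[of _ "Const (w $ v)"]) (auto intro!: derivative_eq_intros)
  next
    case (add a b)
    then obtain q r where "?Q a q" "?Q b r" by blast
    then show ?case by (intro exI[of _ "q + r"]) (auto intro: DERIV_add)
  next
    case (mult a b)
    then obtain q r where qr: "?Q a q" "?Q b r" by blast
    show ?case
    proof (intro exI[of _ "q * b + r * a"] allI)
      fix x
      show "((\<lambda>t. peval (a * b) (x + t *\<^sub>R w)) has_real_derivative peval (q * b + r * a) x) (at 0)"
        using DERIV_mult[OF qr(1)[rule_format, of x] qr(2)[rule_format, of x]] by simp
    qed
  qed
  have "\<exists>!q. ?Q p q"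
  proof (rule ex_ex1I[OF ex])
    fix q r assume q: "?Q p q" and r: "?Q p r"
    show "q = r"
      by (rule peval_eqI) (rule DERIV_unique[OF q[rule_format] r[rule_format]])
  qed
  then have "?Q p (dirderiv w p)" unfolding dirderiv_def by (rule theI')
  then show ?thesis by (rule spec[where x = x])
qed

lemma dirderiv_eqI:
  assumes "\<And>x. ((\<lambda>t. peval p (x + t *\<^sub>R w)) has_real_derivative peval q x) (at 0)"
  shows "dirderiv w p = q"
  by (intro peval_eqI DERIV_unique[OF has_derivative_dirderiv assms])

lemma dirderiv_add: "dirderiv w (p + q) = dirderiv w p + dirderiv w q"
  by (rule dirderiv_eqI) (auto intro!: DERIV_add has_derivative_dirderiv)

lemma dirderiv_mult: "dirderiv w (p * q) = dirderiv w p * q + p * dirderiv w q"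
proof (rule dirderiv_eqI)
  fix x
  show "((\<lambda>t. peval (p * q) (x + t *\<^sub>R w)) has_real_derivative
      peval (dirderiv w p * q + p * dirderiv w q) x) (at 0)"
    using DERIV_mult[OF has_derivative_dirderiv[of p x w] has_derivative_dirderiv[of q x w]]
    by (simp add: mult.commute add.commute)
qed

lemma dirderiv_Const: "dirderiv w (Const c) = 0"
  by (rule dirderiv_eqI) simp

lemma dirderiv_lin: "dirderiv w (lin a) = Const (a \<bullet> w)"
  by (rule dirderiv_eqI) (auto intro!: derivative_eq_intros simp: inner_add_right)

lemma dirderiv_0 [simp]: "dirderiv w 0 = 0"
  by (rule dirderiv_eqI) simp

lemma dirderiv_sum: "dirderiv w (sum f A) = (\<Sum>a\<in>A. dirderiv w (f a))"
  by (induct A rule: infinite_finite_induct) (auto simp: dirderiv_add)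

lemma dirderiv_uminus: "dirderiv w (- p) = - dirderiv w p"
  using dirderiv_add[of w p "- p"] by (simp add: add_eq_0_iff)

lemma dirderiv_power:
  "dirderiv w (p ^ Suc k) = of_nat (Suc k) * p ^ k * dirderiv w p"
proof (induct k)
  case (Suc k)
  have "dirderiv w (p ^ Suc (Suc k)) = dirderiv w p * p ^ Suc k + p * dirderiv w (p ^ Suc k)"
    by (simp only: power_Suc[of p "Suc k"] dirderiv_mult)
  also have "\<dots> = of_nat (Suc (Suc k)) * p ^ Suc k * dirderiv w p"
    unfolding Suc by (simp add: algebra_simps)
  finally show ?case .
qed simp

lemma dirderiv_lin_power_eq_0:
  assumes "a \<bullet> w = 0"
  shows "dirderiv w (lin a ^ k) = 0"
proof (cases k)
  case 0
  then show ?thesis using dirderiv_Const[of w 1] by (simp add: Const_1)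
next
  case (Suc m)
  then show ?thesis
    unfolding Suc dirderiv_power using assms by (simp add: dirderiv_lin Const_def)
qed

text \<open>Total degree below \<open>d\<close>, with only the zero polynomial for
  \<open>d = 0\<close>. Expressing it by iterated directional derivatives makes nilpotence of
  differentiation immediate and gives the induction used for prime ideals.\<close>

fun deg_less :: "nat \<Rightarrow> 'n::finite spoly \<Rightarrow> bool" where
  "deg_less 0 p \<longleftrightarrow> p = 0"
| "deg_less (Suc d) p \<longleftrightarrow> (\<forall>w. deg_less d (dirderiv w p))"

lemma deg_less_0: "deg_less d 0"
  by (induct d) auto

lemma deg_less_Suc: "deg_less d p \<Longrightarrow> deg_less (Suc d) p"
  by (induct d arbitrary: p) (auto simp: deg_less_0)

lemma deg_less_mono: "d \<le> e \<Longrightarrow> deg_less d p \<Longrightarrow> deg_less e p"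
  by (induct e rule: dec_induct) (auto intro: deg_less_Suc simp del: deg_less.simps)

lemma deg_less_add: "deg_less d p \<Longrightarrow> deg_less d q \<Longrightarrow> deg_less d (p + q)"
  by (induct d arbitrary: p q) (auto simp: dirderiv_add)

text \<open>The sum of the bounds exceeds the sharp bound by one, but it fits the product rule: each
  summand of the derivative lowers one of the two bounds, and a bound of 0 means that the factor is
  0.\<close>

lemma deg_less_mult: "deg_less d p \<Longrightarrow> deg_less e q \<Longrightarrow> deg_less (d + e) (p * q)"
proof (induct "d + e" arbitrary: d e p q)
  case (Suc k)
  show ?case
  proof (cases d)
    case 0
    then show ?thesis using Suc by (simp add: deg_less_0)
  next
    case d: (Suc d')
    show ?thesis
    proof (cases e)
      case 0
      then show ?thesis using Suc by (simp add: deg_less_0)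
    next
      case e: (Suc e')
      have "deg_less (d' + e) (dirderiv w p * q)" "deg_less (d + e') (p * dirderiv w q)" for w
        using Suc.hyps(1)[of d' e "dirderiv w p" q] Suc.hyps(1)[of d e' p "dirderiv w q"]
          Suc.hyps(2) Suc.prems d e by auto
      then have "deg_less k (dirderiv w (p * q))" for w
        using d e Suc.hyps(2) deg_less_add[of k "dirderiv w p * q" "p * dirderiv w q"]
        by (simp add: dirderiv_mult del: deg_less.simps)
      then show ?thesis using Suc.hyps(2)[symmetric] by simp
    qed
  qed
qed auto

lemma deg_less_exists: "\<exists>d. deg_less d p"
proof (induct p rule: spoly_induct)
  case (Const c)
  show ?case by (intro exI[of _ 1]) (simp add: dirderiv_Const)
next
  case (Var v)
  have v: "Var v = lin (axis v 1)"
    by (rule peval_eqI) (simp add: inner_axis inner_commute)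
  show ?case by (intro exI[of _ "Suc (Suc 0)"]) (simp add: v dirderiv_lin dirderiv_Const)
next
  case (add a b)
  then obtain d e where "deg_less d a" "deg_less e b" by blast
  then show ?case by (intro exI[of _ "max d e"]) (auto intro!: deg_less_add elim: deg_less_mono[rotated])
next
  case (mult a b)
  then show ?case by (blast intro: deg_less_mult)
qed

lemma deg_less_iterate: "deg_less d p \<Longrightarrow> (dirderiv w ^^ d) p = 0"
  by (induct d arbitrary: p) (auto simp: funpow_Suc_right simp del: funpow.simps)

lemma deg_less_uniform:
  assumes "finite A"
  shows "\<exists>d. \<forall>a\<in>A. deg_less d (z a)"
  using assms
proof (induct A rule: finite_induct)
  case (insert a A)
  then obtain d where d: "\<forall>a\<in>A. deg_less d (z a)" by blast
  obtain e where e: "deg_less e (z a)" using deg_less_exists by blast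
  have "deg_less (max d e) (z b)" if "b \<in> insert a A" for b
    using that d e deg_less_mono[of d "max d e"] deg_less_mono[of e "max d e"] by auto
  then show ?case by blast
qed auto

section \<open>Submodules, annihilators and derivations\<close>

definition is_submodule :: "('c \<Rightarrow> 'n::finite spoly) set \<Rightarrow> bool" where
  "is_submodule B \<longleftrightarrow> (\<lambda>_. 0) \<in> B \<and> (\<forall>x\<in>B. \<forall>y\<in>B. (\<lambda>c. x c + y c) \<in> B)
     \<and> (\<forall>r. \<forall>x\<in>B. (\<lambda>c. r * x c) \<in> B)"

lemma is_submoduleD:
  assumes "is_submodule B"
  shows "(\<lambda>_. 0) \<in> B" "x \<in> B \<Longrightarrow> y \<in> B \<Longrightarrow> (\<lambda>c. x c + y c) \<in> B" "x \<in> B \<Longrightarrow> (\<lambda>c. r * x c) \<in> B"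
    "x \<in> B \<Longrightarrow> y \<in> B \<Longrightarrow> (\<lambda>c. x c - y c) \<in> B"
proof -
  show a: "(\<lambda>_. 0) \<in> B" "x \<in> B \<Longrightarrow> y \<in> B \<Longrightarrow> (\<lambda>c. x c + y c) \<in> B" "x \<in> B \<Longrightarrow> (\<lambda>c. r * x c) \<in> B" for x y r
    using assms by (auto simp: is_submodule_def)
  show "x \<in> B \<Longrightarrow> y \<in> B \<Longrightarrow> (\<lambda>c. x c - y c) \<in> B"
    using a(2)[of x "\<lambda>c. - 1 * y c"] a(3)[of y "- 1"] by simp
qed

lemma is_submodule_sum:
  assumes "is_submodule B" "\<And>a. a \<in> A \<Longrightarrow> x a \<in> B"
  shows "(\<lambda>c. \<Sum>a\<in>A. x a c) \<in> B"
  using assms(2)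
  by (induct A rule: infinite_finite_induct) (auto simp: is_submoduleD[OF assms(1)])

definition quot_ann :: "('c \<Rightarrow> 'n::finite spoly) set \<Rightarrow> ('c \<Rightarrow> 'n spoly) \<Rightarrow> 'n spoly set" where
  "quot_ann B z = {f. (\<lambda>c. f * z c) \<in> B}"

lemma is_ideal_quot_ann:
  assumes "is_submodule B"
  shows "is_ideal (quot_ann B z)"
  unfolding is_ideal_def quot_ann_def
proof (intro conjI ballI allI, simp_all add: is_submoduleD[OF assms])
  fix a b assume "(\<lambda>c. a * z c) \<in> B" "(\<lambda>c. b * z c) \<in> B"
  from is_submoduleD(2)[OF assms this] show "(\<lambda>c. (a + b) * z c) \<in> B"
    by (simp add: distrib_right)
next
  fix r a assume "(\<lambda>c. a * z c) \<in> B"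
  from is_submoduleD(3)[OF assms this, of r] show "(\<lambda>c. r * a * z c) \<in> B"
    by (simp add: mult.assoc)
qed

text \<open>A derivation acting on a module maps a prime annihilator into itself: differentiating
  \<open>f z = 0\<close> repeatedly gives \<open>f\<^sup>k D\<^sup>k z = (-1)\<^sup>k k! (D f)\<^sup>k z\<close>, and the left side vanishes for large \<open>k\<close>.\<close>

lemma quot_ann_dirderiv:
  fixes B :: "('c \<Rightarrow> 'n::finite spoly) set"
  assumes B: "is_submodule B" and D: "\<And>x. x \<in> B \<Longrightarrow> (\<lambda>c. dirderiv w (x c)) \<in> B"
    and fin: "finite {c. z c \<noteq> 0}"
    and P: "prime_ideal (quot_ann B z)" and f: "f \<in> quot_ann B z"
  shows "dirderiv w f \<in> quot_ann B z"
proof -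
  let ?D = "dirderiv w"
  define g where "g = ?D f"
  define zk where "zk k c = (?D ^^ k) (z c)" for k c
  have zS: "?D (zk k c) = zk (Suc k) c" for k c by (simp add: zk_def)
  have fz: "(\<lambda>c. f * z c) \<in> B" using f by (simp add: quot_ann_def)
  have fz1: "(\<lambda>c. g * z c + f * zk 1 c) \<in> B"
    using D[OF fz] by (simp add: dirderiv_mult g_def zk_def)
  \<comment> \<open>Of the constant only its nonvanishing is kept; passing from \<open>k\<close> to
    \<open>k + 1\<close> multiplies it by \<open>-(k + 1)\<close>.\<close>
  have key: "\<exists>r. r \<noteq> 0 \<and> (\<lambda>c. f ^ k * zk k c - Const r * g ^ k * z c) \<in> B" for k
  proof (induct k)
    case 0
    show ?case by (intro exI[of _ 1]) (simp add: zk_def Const_1 is_submoduleD(1)[OF B])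
  next
    case (Suc k)
    then obtain r where r: "r \<noteq> 0" and m: "(\<lambda>c. f ^ k * zk k c - Const r * g ^ k * z c) \<in> B" by blast
    define a where "a = ?D (f ^ k)"
    define b where "b = ?D (g ^ k)"
    have fa: "f * a = of_nat k * f ^ k * g"
    proof (cases k)
      case 0
      then show ?thesis using dirderiv_Const[of w 1] by (simp add: a_def Const_1)
    next
      case (Suc j)
      then show ?thesis unfolding a_def Suc dirderiv_power by (simp add: g_def algebra_simps)
    qed
    have D': "?D (f ^ k * zk k c - Const r * g ^ k * z c)
        = a * zk k c + f ^ k * zk (Suc k) c - Const r * (b * z c + g ^ k * zk 1 c)" for c
    proof -
      have "?D (f ^ k * zk k c - Const r * g ^ k * z c)
          = ?D (f ^ k * zk k c + - (Const r * (g ^ k * z c)))" by (simp add: mult.assoc)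
      also have "\<dots> = a * zk k c + f ^ k * zk (Suc k) c - Const r * (b * z c + g ^ k * zk 1 c)"
        unfolding dirderiv_add dirderiv_uminus dirderiv_mult dirderiv_Const
        by (simp add: a_def b_def zS) (simp add: zk_def)
      finally show ?thesis .
    qed
    have "(\<lambda>c. a * zk k c + f ^ k * zk (Suc k) c - Const r * (b * z c + g ^ k * zk 1 c)) \<in> B"
      using D[OF m] unfolding D' .
    from is_submoduleD(3)[OF B this, of f]
    have 1: "(\<lambda>c. f * (a * zk k c + f ^ k * zk (Suc k) c - Const r * (b * z c + g ^ k * zk 1 c))) \<in> B" .
    have 2: "(\<lambda>c. of_nat k * g * (f ^ k * zk k c - Const r * g ^ k * z c)) \<in> B"
      using is_submoduleD(3)[OF B m, of "of_nat k * g"] .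
    have 3: "(\<lambda>c. Const r * b * (f * z c)) \<in> B"
      using is_submoduleD(3)[OF B fz, of "Const r * b"] .
    have 4: "(\<lambda>c. Const r * g ^ k * (g * z c + f * zk 1 c)) \<in> B"
      using is_submoduleD(3)[OF B fz1, of "Const r * g ^ k"] .
    \<comment> \<open>The first term is \<open>f\<close> times the derivative of the induction
      hypothesis. The other three remove all unwanted parts: \<open>f * a\<close> equals
      \<open>k * f^k * g\<close>, the multiple of \<open>f * z\<close> cancels the term with
      \<open>b\<close>, and the derivative of \<open>f * z\<close> trades \<open>f * D z\<close> for
      \<open>- g * z\<close>.\<close>
    have sum: "(\<lambda>c. ((f * (a * zk k c + f ^ k * zk (Suc k) c - Const r * (b * z c + g ^ k * zk 1 c))
         - of_nat k * g * (f ^ k * zk k c - Const r * g ^ k * z c)) + Const r * b * (f * z c))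
         + Const r * g ^ k * (g * z c + f * zk 1 c)) \<in> B"
      by (intro is_submoduleD(2)[OF B _ 4] is_submoduleD(2)[OF B _ 3] is_submoduleD(4)[OF B 1 2])
    have eq: "((f * (a * zk k c + f ^ k * zk (Suc k) c - Const r * (b * z c + g ^ k * zk 1 c))
         - of_nat k * g * (f ^ k * zk k c - Const r * g ^ k * z c)) + Const r * b * (f * z c))
         + Const r * g ^ k * (g * z c + f * zk 1 c)
        = f ^ Suc k * zk (Suc k) c - Const (- (of_nat (Suc k)) * r) * g ^ Suc k * z c" (is "?L = ?R") for c
    proof -
      have C: "Const (- (of_nat (Suc k)) * r) = - (of_nat (Suc k)) * (Const r :: 'n spoly)"
        by (rule peval_eqI)
          (simp add: Const_def flip: single_of_nat, simp add: peval_single algebra_simps)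
      have "?L = (f * a) * zk k c - of_nat k * f ^ k * g * zk k c
          + f ^ Suc k * zk (Suc k) c + (of_nat k + 1) * Const r * g ^ Suc k * z c"
        by (simp add: algebra_simps)
      also have "\<dots> = ?R" unfolding fa C by (simp add: algebra_simps)
      finally show ?thesis .
    qed
    have "(\<lambda>c. f ^ Suc k * zk (Suc k) c - Const (- (of_nat (Suc k)) * r) * g ^ Suc k * z c) \<in> B"
      using sum unfolding eq .
    moreover have "- (of_nat (Suc k)) * r \<noteq> 0" using r by (simp del: of_nat_Suc)
    ultimately show ?case by blast
  qed
  \<comment> \<open>As \<open>z\<close> has finite support, one order of differentiation annihilates
    all components. The congruence \<open>key\<close> for this order then puts a nonzero constant
    times \<open>g ^ d\<close> into the annihilator.\<close>
  obtain d where d: "\<forall>c\<in>{c. z c \<noteq> 0}. deg_less d (z c)"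
    using deg_less_uniform[OF fin, of z] by blast
  have "deg_less d (z c)" for c
    using d deg_less_0 by (cases "z c = 0") auto
  then have z0: "zk d c = 0" for c
    unfolding zk_def by (rule deg_less_iterate)
  obtain r where r: "r \<noteq> 0" "(\<lambda>c. f ^ d * zk d c - Const r * g ^ d * z c) \<in> B"
    using key by blast
  have "(\<lambda>c. - (Const r * g ^ d * z c)) \<in> B"
    using r(2) by (simp only: z0 mult_zero_right diff_0)
  from is_submoduleD(3)[OF B this, of "- 1"]
  have "Const r * g ^ d \<in> quot_ann B z" by (simp add: quot_ann_def)
  then have "Const r \<in> quot_ann B z \<or> g ^ d \<in> quot_ann B z"
    by (rule prime_ideal_mult[OF P])
  then have "g ^ d \<in> quot_ann B z"
    using prime_ideal_Const[OF P, of r] r(1) by blast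
  from prime_ideal_power[OF P this] show ?thesis by (simp add: g_def)
qed

text \<open>By induction on the degree all derivatives of \<open>f\<close> along \<open>W\<close>
  vanish on \<open>W\<close>, so \<open>f\<close> is constant on \<open>W\<close>. Subtracting this
  constant gives an element of \<open>ideal_of W\<close>, hence of \<open>P\<close>; so the constant
  lies in the proper ideal \<open>P\<close> and is 0.\<close>

lemma prime_ideal_eq_ideal_of:
  fixes W :: "(real^'n::finite) set"
  assumes P: "prime_ideal P" and W: "subspace W" and le: "ideal_of W \<subseteq> P"
    and D: "\<And>w f. w \<in> W \<Longrightarrow> f \<in> P \<Longrightarrow> dirderiv w f \<in> P"
  shows "P = ideal_of W"
proof
  note I = prime_ideal_is_ideal[OF P]
  have "f \<in> ideal_of W" if "deg_less d f" "f \<in> P" for d f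
    using that
  proof (induct d arbitrary: f)
    case 0
    then show ?case by (simp add: ideal_of_def)
  next
    case (Suc d)
    have d0: "peval (dirderiv w f) x = 0" if "w \<in> W" "x \<in> W" for w x
      using Suc D[OF that(1)] that(2) by (auto simp: ideal_of_def)
    \<comment> \<open>The value at \<open>w\<close> is compared with that at 0 along the line
      through both, which stays in \<open>W\<close>.\<close>
    have const: "peval f w = peval f 0" if w: "w \<in> W" for w
    proof -
      have "((\<lambda>t. peval f (t *\<^sub>R w)) has_real_derivative 0) (at s)" for s
      proof -
        have "((\<lambda>t. peval f (s *\<^sub>R w + t *\<^sub>R w)) has_real_derivative peval (dirderiv w f) (s *\<^sub>R w)) (at 0)"
          by (rule has_derivative_dirderiv)
        moreover have "peval (dirderiv w f) (s *\<^sub>R w) = 0"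
          using W w by (intro d0) (auto intro: subspace_scale)
        ultimately have "((\<lambda>t. peval f ((t + s) *\<^sub>R w)) has_real_derivative 0) (at 0)"
          by (simp add: scaleR_left_distrib add.commute)
        then show ?thesis
          using DERIV_shift[of "\<lambda>t. peval f (t *\<^sub>R w)" 0 0 s] by simp
      qed
      then have "(\<lambda>t. peval f (t *\<^sub>R w)) 1 = (\<lambda>t. peval f (t *\<^sub>R w)) 0"
        by (intro DERIV_isconst_all) auto
      then show ?thesis by simp
    qed
    have "f - Const (peval f 0) \<in> ideal_of W"
      using const by (simp add: ideal_of_def)
    then have "f - (f - Const (peval f 0)) \<in> P"
      by (rule is_idealD(6)[OF I Suc.prems(2) subsetD[OF le]])
    then have "peval f 0 = 0" using prime_ideal_Const[OF P] by simp
    then show ?case using const by (simp add: ideal_of_def)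
  qed
  then show "P \<subseteq> ideal_of W" using deg_less_exists by blast
qed (rule le)

section \<open>Faces of polyhedral cones and fans\<close>

text \<open>This makes every cone of a fan a polyhedron, so that the theory of faces and facets of
  polyhedra applies to it.\<close>

lemma pos_hull_eq_convex_cone_hull:
  fixes F :: "(real^'n::finite) set"
  assumes "finite F"
  shows "pos_hull F = convex_cone hull F"
proof
  show "pos_hull F \<subseteq> convex_cone hull F"
  proof
    fix x assume "x \<in> pos_hull F"
    then obtain c where c: "x = (\<Sum>v\<in>F. c v *\<^sub>R v)" "\<forall>v\<in>F. 0 \<le> c v"
      by (auto simp: pos_hull_def)
    have "(\<Sum>v\<in>G. c v *\<^sub>R v) \<in> convex_cone hull F" if "G \<subseteq> F" for G
      using finite_subset[OF that assms] that
    proof (induct G rule: finite_induct)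
      case empty
      then show ?case by (simp add: convex_cone_hull_contains_0)
    next
      case (insert v G)
      then show ?case
        using c(2) by (auto intro!: convex_cone_hull_add convex_cone_hull_mul intro: hull_inc)
    qed
    then show "x \<in> convex_cone hull F" using c by blast
  qed
  show "convex_cone hull F \<subseteq> pos_hull F"
  proof (rule hull_minimal)
    show "F \<subseteq> pos_hull F"
    proof
      fix v assume v: "v \<in> F"
      have "(\<Sum>u\<in>F. (if u = v then 1 else 0) *\<^sub>R u) = (\<Sum>u\<in>F. if u = v then v else 0)"
        by (intro sum.cong) auto
      then have "v = (\<Sum>u\<in>F. (if u = v then 1 else 0) *\<^sub>R u)"
        using v assms by simp
      then show "v \<in> pos_hull F"
        unfolding pos_hull_def by (auto intro!: exI[of _ "\<lambda>u. if u = v then 1 else 0"])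
    qed
    show "convex_cone (pos_hull F)"
      unfolding convex_cone_iff
    proof (intro conjI ballI allI impI)
      show "0 \<in> pos_hull F"
        unfolding pos_hull_def by (auto intro!: exI[of _ "\<lambda>_. 0"])
    next
      fix x y assume "x \<in> pos_hull F" "y \<in> pos_hull F"
      then obtain c d where "x = (\<Sum>v\<in>F. c v *\<^sub>R v)" "\<forall>v\<in>F. 0 \<le> c v"
        "y = (\<Sum>v\<in>F. d v *\<^sub>R v)" "\<forall>v\<in>F. 0 \<le> d v" by (auto simp: pos_hull_def)
      then show "x + y \<in> pos_hull F"
        unfolding pos_hull_def
        by (auto intro!: exI[of _ "\<lambda>v. c v + d v"] simp: scaleR_left_distrib sum.distrib)
    next
      fix x :: "real^'n" and t :: real assume "x \<in> pos_hull F" "0 \<le> t"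
      then obtain c where "x = (\<Sum>v\<in>F. c v *\<^sub>R v)" "\<forall>v\<in>F. 0 \<le> c v" by (auto simp: pos_hull_def)
      with \<open>0 \<le> t\<close> show "t *\<^sub>R x \<in> pos_hull F"
        unfolding pos_hull_def
        by (auto intro!: exI[of _ "\<lambda>v. t * c v"] simp: scaleR_sum_right)
    qed
  qed
qed

lemma is_cone_polyhedron: "is_cone \<gamma> \<Longrightarrow> polyhedron \<gamma>"
  unfolding is_cone_def using pos_hull_eq_convex_cone_hull polyhedron_convex_cone_hull by metis

lemma is_cone_convex_cone: "is_cone \<gamma> \<Longrightarrow> convex_cone \<gamma>"
  unfolding is_cone_def using pos_hull_eq_convex_cone_hull convex_cone_convex_cone_hull by metis

lemma is_cone_0: "is_cone \<gamma> \<Longrightarrow> 0 \<in> \<gamma>"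
  by (simp add: convex_cone_contains_0 is_cone_convex_cone)

lemma is_cone_convex: "is_cone \<gamma> \<Longrightarrow> convex \<gamma>"
  using is_cone_convex_cone[of \<gamma>] by (simp add: convex_cone_def)

lemma cone_face_imp_face_of:
  assumes "is_cone \<gamma>" "cone_face f \<gamma>"
  shows "f face_of \<gamma>"
proof -
  obtain a where a: "\<forall>x\<in>\<gamma>. 0 \<le> a \<bullet> x" "f = {x\<in>\<gamma>. a \<bullet> x = 0}"
    using assms(2) by (auto simp: cone_face_def)
  have "(\<gamma> \<inter> {x. a \<bullet> x = 0}) face_of \<gamma>"
    by (rule face_of_Int_supporting_hyperplane_ge) (use a is_cone_convex[OF assms(1)] in auto)
  then show ?thesis using a by (simp add: Int_def)
qed

text \<open>A nonempty face of a cone contains 0: a nonzero point \<open>x\<close> of the face lies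
  between 0 and \<open>2 x\<close>, both of which are in the cone. Faces of polyhedra are exposed,
  and the supporting hyperplane passes through 0, which is what \<open>cone_face\<close> asks
  for.\<close>

lemma face_of_imp_cone_face:
  assumes g: "is_cone \<gamma>" and f: "f face_of \<gamma>" and ne: "f \<noteq> {}"
  shows "cone_face f \<gamma>"
proof -
  obtain x where x: "x \<in> f" using ne by blast
  have xg: "x \<in> \<gamma>" using f x face_of_imp_subset by blast
  have 0: "0 \<in> f"
  proof (cases "x = 0")
    case False
    have "2 *\<^sub>R x \<in> \<gamma>"
      using is_cone_convex_cone[OF g] xg by (simp add: convex_cone_def conic_def)
    moreover have "x \<in> open_segment 0 (2 *\<^sub>R x)"
      using False by (auto simp: in_segment intro!: exI[of _ "1 / 2"])
    ultimately show ?thesis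
      using face_ofD[OF f, of x 0 "2 *\<^sub>R x"] is_cone_0[OF g] x by blast
  qed (use x in simp)
  have "f exposed_face_of \<gamma>"
    using exposed_face_of_polyhedron[OF is_cone_polyhedron[OF g]] f by blast
  then obtain a b where ab: "\<gamma> \<subseteq> {x. a \<bullet> x \<le> b}" "f = \<gamma> \<inter> {x. a \<bullet> x = b}"
    unfolding exposed_face_of_def by blast
  have "b = 0" using ab 0 by auto
  then show ?thesis
    unfolding cone_face_def using ab by (intro exI[of _ "- a"]) auto
qed

text \<open>A face is recovered from its span. Two faces of one cone with the same span therefore
  coincide, which is how cells are counted in low dimension.\<close>

lemma cone_face_Int_span:
  assumes "cone_face f \<gamma>"
  shows "\<gamma> \<inter> span f = f"
proof -
  obtain a where a: "f = {x\<in>\<gamma>. a \<bullet> x = 0}" using assms by (auto simp: cone_face_def)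
  have "span f \<subseteq> {x. a \<bullet> x = 0}"
    by (rule span_minimal) (use a subspace_hyperplane in auto)
  then show ?thesis using a span_superset[of f] by auto
qed

section \<open>Faces inside a fan\<close>

lemma is_fanD:
  assumes "is_fan \<Sigma>"
  shows "finite \<Sigma>" "\<gamma> \<in> \<Sigma> \<Longrightarrow> is_cone \<gamma>" "\<gamma> \<in> \<Sigma> \<Longrightarrow> cone_face f \<gamma> \<Longrightarrow> f \<in> \<Sigma>"
    "\<gamma> \<in> \<Sigma> \<Longrightarrow> \<delta> \<in> \<Sigma> \<Longrightarrow> cone_face (\<gamma> \<inter> \<delta>) \<gamma>"
  using assms by (auto simp: is_fan_def)

lemma fan_Int_mem: "is_fan \<Sigma> \<Longrightarrow> \<gamma> \<in> \<Sigma> \<Longrightarrow> \<delta> \<in> \<Sigma> \<Longrightarrow> \<gamma> \<inter> \<delta> \<in> \<Sigma>"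
  using is_fanD(3,4) by blast

lemma fan_subset_face:
  assumes "is_fan \<Sigma>" "\<gamma> \<in> \<Sigma>" "\<delta> \<in> \<Sigma>" "\<gamma> \<subseteq> \<delta>"
  shows "cone_face \<gamma> \<delta>"
  using is_fanD(4)[OF assms(1,3,2)] assms(4) by (simp add: Int_absorb1)

lemma fan_subset_Int_span:
  assumes "is_fan \<Sigma>" "\<gamma> \<in> \<Sigma>" "\<delta> \<in> \<Sigma>" "\<gamma> \<subseteq> \<delta>"
  shows "\<delta> \<inter> span \<gamma> = \<gamma>"
  using cone_face_Int_span[OF fan_subset_face[OF assms]] .

lemma fan_subset_dim_eq:
  assumes "is_fan \<Sigma>" "\<gamma> \<in> \<Sigma>" "\<delta> \<in> \<Sigma>" "\<gamma> \<subseteq> \<delta>" "dim \<delta> \<le> dim \<gamma>"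
  shows "\<gamma> = \<delta>"
  using dim_eq_span[OF assms(4,5)] fan_subset_Int_span[OF assms(1-4)] span_superset[of \<delta>] by auto

lemma cone_aff_dim:
  fixes \<gamma> :: "'n::finite cone"
  shows "0 \<in> \<gamma> \<Longrightarrow> aff_dim \<gamma> = int (dim \<gamma>)"
  by (simp add: aff_dim_zero hull_inc)

text \<open>\<open>facet_of\<close> means a face of codimension one and differs from
  \<open>facet\<close>, a maximal cone of the fan. Its condition on affine dimension turns into one
  on \<open>dim\<close> because all cones contain 0.\<close>

lemma fan_facet_of_mem:
  fixes \<Sigma> :: "'n::finite cone set"
  assumes "is_fan \<Sigma>" "\<tau> \<in> \<Sigma>" "F facet_of \<tau>"
  shows "F \<in> \<Sigma>" "dim \<tau> = Suc (dim F)"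
proof -
  have F: "F face_of \<tau>" "F \<noteq> {}" "aff_dim F = aff_dim \<tau> - 1"
    using assms(3) by (auto simp: facet_of_def)
  note c = is_fanD(2)[OF assms(1,2)]
  show Fin: "F \<in> \<Sigma>"
    using is_fanD(3)[OF assms(1,2)] face_of_imp_cone_face[OF c F(1,2)] by blast
  have "0 \<in> F" "0 \<in> \<tau>" using is_cone_0 is_fanD(2)[OF assms(1)] Fin assms(2) by blast+
  then show "dim \<tau> = Suc (dim F)" using F(3) by (simp add: cone_aff_dim)
qed

text \<open>A proper face of a polyhedron lies in a face of codimension one, so the dimension of
  \<open>\<tau>\<close> can be lowered one by one above \<open>\<gamma>\<close>.\<close>

lemma fan_intermediate_face:
  fixes \<Sigma> :: "'n::finite cone set"
  assumes fan: "is_fan \<Sigma>" and "\<gamma> \<in> \<Sigma>" "\<tau> \<in> \<Sigma>" "\<gamma> \<subseteq> \<tau>" "dim \<gamma> \<le> k" "k \<le> dim \<tau>"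
  shows "\<exists>\<delta>\<in>\<Sigma>. \<gamma> \<subseteq> \<delta> \<and> \<delta> \<subseteq> \<tau> \<and> dim \<delta> = k"
  using assms(3-)
proof (induct "dim \<tau> - k" arbitrary: \<tau>)
  case 0
  then show ?case by auto
next
  case (Suc m)
  note c = is_fanD(2)[OF fan \<open>\<tau> \<in> \<Sigma>\<close>]
  have f: "\<gamma> face_of \<tau>"
    using cone_face_imp_face_of[OF c fan_subset_face[OF fan \<open>\<gamma> \<in> \<Sigma>\<close>]] Suc.prems by blast
  have "\<gamma> \<noteq> \<tau>" "\<gamma> \<noteq> {}" using Suc is_cone_0[OF is_fanD(2)[OF fan \<open>\<gamma> \<in> \<Sigma>\<close>]] by auto
  then obtain F where F: "F facet_of \<tau>" "\<gamma> \<subseteq> F"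
    using face_of_polyhedron_subset_facet[OF is_cone_polyhedron[OF c] f] by blast
  note Fm = fan_facet_of_mem[OF fan \<open>\<tau> \<in> \<Sigma>\<close> F(1)]
  have "\<exists>\<delta>\<in>\<Sigma>. \<gamma> \<subseteq> \<delta> \<and> \<delta> \<subseteq> F \<and> dim \<delta> = k"
    using Suc F Fm by (intro Suc.hyps(1)) auto
  then show ?case using facet_of_imp_subset[OF F(1)] by blast
qed

text \<open>Moving a relative interior point of \<open>\<gamma>\<close> slightly in a direction \<open>w \<in> W\<close> stays on all facets of
  \<open>\<sigma>\<close> through \<open>\<gamma>\<close> and respects the other, strict inequalities, hence stays in \<open>\<gamma>\<close>.\<close>

lemma subset_span_if_subset_facet_spans:
  fixes \<Sigma> :: "'n::finite cone set"
  assumes fan: "is_fan \<Sigma>" and s: "\<sigma> \<in> \<Sigma>" "dim \<sigma> = CARD('n)"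
    and g: "\<gamma> \<in> \<Sigma>" "\<gamma> \<subseteq> \<sigma>" "\<gamma> \<noteq> \<sigma>"
    and W: "\<And>\<tau>. \<tau> \<in> \<Sigma> \<Longrightarrow> dim \<tau> + 1 = CARD('n) \<Longrightarrow> \<gamma> \<subseteq> \<tau> \<Longrightarrow> W \<subseteq> span \<tau>"
  shows "W \<subseteq> span \<gamma>"
proof
  fix w assume w: "w \<in> W"
  note cs = is_fanD(2)[OF fan s(1)]
  note cg = is_fanD(2)[OF fan g(1)]
  note poly = is_cone_polyhedron[OF cs]
  have f: "\<gamma> face_of \<sigma>" by (rule cone_face_imp_face_of[OF cs fan_subset_face[OF fan g(1) s(1) g(2)]])
  have g0: "0 \<in> \<gamma>" by (rule is_cone_0[OF cg])
  obtain x where x: "x \<in> rel_interior \<gamma>"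
    using rel_interior_eq_empty[OF is_cone_convex[OF cg]] g0 by blast
  have xg: "x \<in> \<gamma>" using x rel_interior_subset by blast
  have facet_W: "w \<in> span F" if "F facet_of \<sigma>" "\<gamma> \<subseteq> F" for F
    using W[of F] fan_facet_of_mem[OF fan s(1) that(1)] that w s(2) by auto
  have aff: "affine hull \<sigma> = UNIV"
    using is_cone_0[OF cs] s(2) dim_eq_full[of \<sigma>] by (simp add: affine_hull_span_0 hull_inc)
  \<comment> \<open>The system of half-spaces is minimal, so that each bounding hyperplane meets
    \<open>\<sigma>\<close> in a facet.\<close>
  obtain H where H: "finite H" "\<sigma> = (affine hull \<sigma>) \<inter> \<Inter>H"
    "\<forall>h\<in>H. \<exists>a b. a \<noteq> 0 \<and> h = {x. a \<bullet> x \<le> b}"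
    "\<forall>F'. F' \<subset> H \<longrightarrow> \<sigma> \<subset> (affine hull \<sigma>) \<inter> \<Inter>F'"
    using poly unfolding polyhedron_Int_affine_minimal by blast
  from H(3) obtain a b where ab: "\<And>h. h \<in> H \<Longrightarrow> a h \<noteq> 0 \<and> h = {x. a h \<bullet> x \<le> b h}"
    by metis
  have small: "\<forall>\<^sub>F e in at_right 0. x + e *\<^sub>R w \<in> h" if h: "h \<in> H" for h
  proof -
    have xh: "a h \<bullet> x \<le> b h" using xg g(2) H(2) ab[OF h] h by blast
    have hmem: "x + e *\<^sub>R w \<in> h \<longleftrightarrow> a h \<bullet> x + e * (a h \<bullet> w) \<le> b h" for e
      using ab[OF h] by (metis (no_types, lifting) inner_add_right inner_scaleR_right mem_Collect_eq)
    show ?thesis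
    proof (cases "a h \<bullet> x = b h")
      case True
      let ?F = "\<sigma> \<inter> {x. a h \<bullet> x = b h}"
      have F: "?F facet_of \<sigma>"
        using facet_of_polyhedron_explicit[OF H(1,2) ab, of ?F] H(4) h by blast
      have "\<gamma> \<subseteq> ?F"
        by (rule subset_of_face_of[OF facet_of_imp_face_of[OF F] g(2)])
          (use x xg g(2) True in \<open>auto simp: disjnt_def\<close>)
      then have wF: "w \<in> span ?F" and "b h = 0"
        using facet_W[OF F] g0 by auto
      have "span ?F \<subseteq> {x. a h \<bullet> x = 0}"
        by (rule span_minimal) (use \<open>b h = 0\<close> subspace_hyperplane in auto)
      then have "a h \<bullet> w = 0" using wF by blast
      then show ?thesis using hmem xh by simp
    next
      case False
      then have "a h \<bullet> x + 0 * (a h \<bullet> w) < b h" using xh by simp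
      moreover have "((\<lambda>e. a h \<bullet> x + e * (a h \<bullet> w)) \<longlongrightarrow> a h \<bullet> x + 0 * (a h \<bullet> w)) (at_right 0)"
        by (intro tendsto_intros)
      ultimately have "\<forall>\<^sub>F e in at_right 0. a h \<bullet> x + e * (a h \<bullet> w) < b h"
        by (rule order_tendstoD(2)[rotated])
      then show ?thesis unfolding hmem by (rule eventually_mono) simp
    qed
  qed
  have "\<forall>\<^sub>F e in at_right (0::real). (\<forall>h\<in>H. x + e *\<^sub>R w \<in> h) \<and> 0 < e"
    by (intro eventually_conj eventually_ball_finite H(1) ballI small eventually_at_right_less)
  then obtain e :: real where e: "\<forall>h\<in>H. x + e *\<^sub>R w \<in> h" "0 < e"
    using eventually_happens[of _ "at_right (0::real)"] by auto
  have y: "x + e *\<^sub>R w \<in> \<sigma>" using e(1) H(2) aff by blast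
  have "x + e *\<^sub>R w \<in> F" if F: "F facet_of \<sigma>" "\<gamma> \<subseteq> F" for F
  proof -
    have "x + e *\<^sub>R w \<in> span F"
      using xg F facet_W[OF F] by (intro span_add span_scale) (auto intro: span_base)
    then show ?thesis
      using y fan_subset_Int_span[OF fan fan_facet_of_mem(1)[OF fan s(1) F(1)] s(1)
          facet_of_imp_subset[OF F(1)]] by blast
  qed
  \<comment> \<open>A proper face of a polyhedron is the intersection of the facets that contain it,
    so membership of the moved point can be checked facet by facet.\<close>
  moreover have "\<gamma> = \<Inter>{F. F facet_of \<sigma> \<and> \<gamma> \<subseteq> F}"
    using face_of_polyhedron[OF poly f] g0 g(3) by blast
  ultimately have "x + e *\<^sub>R w \<in> \<gamma>" by blast
  then have "(x + e *\<^sub>R w) - x \<in> span \<gamma>"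
    using xg by (intro span_diff) (auto intro: span_base)
  then have "e *\<^sub>R w \<in> span \<gamma>" by simp
  from span_scale[OF this, of "1 / e"] have "(1 / e) *\<^sub>R (e *\<^sub>R w) \<in> span \<gamma>" .
  then show "w \<in> span \<gamma>" using e(2) by simp
qed

lemma fan_facet_exists:
  assumes "is_fan \<Sigma>" "\<gamma> \<in> \<Sigma>"
  shows "\<exists>\<sigma>. facet \<Sigma> \<sigma> \<and> \<gamma> \<subseteq> \<sigma>"
  using finite_has_maximal2[OF is_fanD(1)[OF assms(1)] assms(2)] unfolding facet_def by metis

lemma facet_iff_dim:
  fixes \<Sigma> :: "'n::finite cone set"
  assumes "is_fan \<Sigma>" "pure_full \<Sigma>" "\<gamma> \<in> \<Sigma>"
  shows "facet \<Sigma> \<gamma> \<longleftrightarrow> dim \<gamma> = CARD('n)"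
proof
  show "facet \<Sigma> \<gamma> \<Longrightarrow> dim \<gamma> = CARD('n)" using assms(2) by (simp add: pure_full_def)
  assume d: "dim \<gamma> = CARD('n)"
  have "\<delta> = \<gamma>" if "\<delta> \<in> \<Sigma>" "\<gamma> \<subseteq> \<delta>" for \<delta>
    using fan_subset_dim_eq[OF assms(1,3) that] d dim_subset_UNIV[of \<delta>] by simp
  then show "facet \<Sigma> \<gamma>" using assms(3) by (simp add: facet_def)
qed

section \<open>Generators and faces of simplicial cones\<close>

lemma pos_hull_subset_span: "pos_hull F \<subseteq> span F"
  unfolding pos_hull_def by (auto intro!: span_sum span_scale intro: span_base)

lemma pos_hull_superset:
  assumes "finite F"
  shows "F \<subseteq> pos_hull F"
  using hull_subset[of F convex_cone] by (simp add: pos_hull_eq_convex_cone_hull[OF assms])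

lemma span_pos_hull:
  assumes "finite F"
  shows "span (pos_hull F) = span F"
  using span_mono[OF pos_hull_superset[OF assms]] span_minimal[OF pos_hull_subset_span subspace_span]
  by blast

lemma dim_pos_hull:
  fixes F :: "(real^'n::finite) set"
  assumes "independent F"
  shows "dim (pos_hull F) = card F"
  using span_pos_hull[OF independent_imp_finite[OF assms]] dim_span dim_eq_card_independent[OF assms]
  by metis

lemma pos_hull_mono:
  assumes "finite B" "A \<subseteq> B"
  shows "pos_hull A \<subseteq> pos_hull B"
  unfolding pos_hull_eq_convex_cone_hull[OF assms(1)]
    pos_hull_eq_convex_cone_hull[OF finite_subset[OF assms(2,1)]]
  by (rule hull_mono[OF assms(2)])

lemma pos_hull_subset_iff:
  fixes F :: "(real^'n::finite) set"
  assumes F: "independent F" and AB: "A \<subseteq> F" "B \<subseteq> F"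
  shows "pos_hull A \<subseteq> pos_hull B \<longleftrightarrow> A \<subseteq> B"
proof
  have fin: "finite A" "finite B" using independent_imp_finite[OF F] AB finite_subset by blast+
  assume le: "pos_hull A \<subseteq> pos_hull B"
  show "A \<subseteq> B"
  proof (rule ccontr)
    assume "\<not> A \<subseteq> B"
    then obtain v where v: "v \<in> A" "v \<notin> B" by blast
    have "v \<in> span B" using v pos_hull_superset[OF fin(1)] le pos_hull_subset_span by blast
    then have "v \<in> span (F - {v})" using span_mono[of B "F - {v}"] v AB by blast
    then show False using F v AB unfolding dependent_def by blast
  qed
qed (use pos_hull_mono finite_subset[OF AB(2) independent_imp_finite[OF F]] in blast)

text \<open>Independence provides a linear functional with value 0 on \<open>A\<close> and 1 on the
  remaining generators; the vector representing it is the normal of a supporting hyperplane.\<close>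

lemma cone_face_pos_hull_subset:
  fixes F :: "(real^'n::finite) set"
  assumes F: "independent F" and A: "A \<subseteq> F"
  shows "cone_face (pos_hull A) (pos_hull F)"
proof -
  have fin: "finite F" by (rule independent_imp_finite[OF F])
  obtain g where g: "linear g" "\<forall>v\<in>F. g v = (if v \<in> A then 0 else 1 :: real)"
    using linear_independent_extend[OF F, of "\<lambda>v. if v \<in> A then 0 else 1"] by blast
  define a where "a = adjoint g 1"
  have a: "a \<bullet> x = g x" for x
    using adjoint_works[OF g(1), of x 1] by (simp add: a_def inner_commute)
  have val: "a \<bullet> (\<Sum>v\<in>F. c v *\<^sub>R v) = (\<Sum>v\<in>F - A. c v)" for c
  proof -
    have "a \<bullet> (\<Sum>v\<in>F. c v *\<^sub>R v) = (\<Sum>v\<in>F. if v \<in> F - A then c v else 0)"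
      unfolding inner_sum_right by (intro sum.cong) (auto simp: a g(2))
    also have "\<dots> = (\<Sum>v\<in>F - A. c v)"
      by (rule sum.mono_neutral_cong_right) (use fin in auto)
    finally show ?thesis .
  qed
  show ?thesis
    unfolding cone_face_def
  proof (intro exI[of _ a] conjI)
    show "\<forall>x\<in>pos_hull F. 0 \<le> a \<bullet> x"
      unfolding pos_hull_def by (auto simp: val intro!: sum_nonneg)
    have "x \<in> pos_hull A" if x: "x \<in> pos_hull F" "a \<bullet> x = 0" for x
    proof -
      obtain c where c: "x = (\<Sum>v\<in>F. c v *\<^sub>R v)" "\<forall>v\<in>F. 0 \<le> c v"
        using x(1) by (auto simp: pos_hull_def)
      have "\<forall>v\<in>F - A. c v = 0"
        using x(2) c fin unfolding c(1) val by (subst (asm) sum_nonneg_eq_0_iff) auto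
      then have "x = (\<Sum>v\<in>A. c v *\<^sub>R v)"
        unfolding c(1) by (intro sum.mono_neutral_right) (use fin A in auto)
      then show ?thesis using c(2) A unfolding pos_hull_def by blast
    qed
    moreover have "a \<bullet> x = 0" if x: "x \<in> pos_hull A" for x
    proof -
      obtain c where c: "x = (\<Sum>v\<in>A. c v *\<^sub>R v)" using x unfolding pos_hull_def by blast
      show ?thesis unfolding c inner_sum_right using A g(2)
        by (intro sum.neutral) (auto simp: a)
    qed
    ultimately show "pos_hull A = {x \<in> pos_hull F. a \<bullet> x = 0}"
      using pos_hull_mono[OF fin A] by blast
  qed
qed

text \<open>The generators of the face are those on the supporting hyperplane: a sum of nonnegative
  terms vanishes only if each term does.\<close>

lemma cone_face_pos_hull:
  fixes F :: "(real^'n::finite) set"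
  assumes fin: "finite F" and f: "cone_face f (pos_hull F)"
  shows "\<exists>A\<subseteq>F. f = pos_hull A"
proof -
  obtain a where a: "\<forall>x\<in>pos_hull F. 0 \<le> a \<bullet> x" "f = {x \<in> pos_hull F. a \<bullet> x = 0}"
    using f by (auto simp: cone_face_def)
  define A where "A = {v\<in>F. a \<bullet> v = 0}"
  have A: "A \<subseteq> F" by (auto simp: A_def)
  have "x \<in> pos_hull A" if x: "x \<in> f" for x
  proof -
    obtain c where c: "x = (\<Sum>v\<in>F. c v *\<^sub>R v)" "\<forall>v\<in>F. 0 \<le> c v"
      using x a(2) by (auto simp: pos_hull_def)
    have "(\<Sum>v\<in>F. c v * (a \<bullet> v)) = 0" using x a(2) by (simp add: c(1) inner_sum_right)
    moreover have "\<And>v. v \<in> F \<Longrightarrow> 0 \<le> c v * (a \<bullet> v)"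
      using c(2) a(1) pos_hull_superset[OF fin] by (intro mult_nonneg_nonneg) auto
    ultimately have "\<forall>v\<in>F. c v * (a \<bullet> v) = 0"
      by (simp add: sum_nonneg_eq_0_iff[OF fin, of "\<lambda>v. c v * (a \<bullet> v)"])
    then have "x = (\<Sum>v\<in>A. c v *\<^sub>R v)"
      unfolding c(1) by (intro sum.mono_neutral_right) (use fin A in \<open>auto simp: A_def\<close>)
    then show ?thesis using c(2) A unfolding pos_hull_def by blast
  qed
  moreover have "a \<bullet> x = 0" if x: "x \<in> pos_hull A" for x
  proof -
    obtain c where c: "x = (\<Sum>v\<in>A. c v *\<^sub>R v)" using x unfolding pos_hull_def by blast
    show ?thesis unfolding c inner_sum_right by (intro sum.neutral) (auto simp: A_def)
  qed
  ultimately have "f = pos_hull A" using a(2) pos_hull_mono[OF fin A] by blast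
  then show ?thesis using A by blast
qed

lemma simplicial_face:
  assumes "is_fan \<Sigma>" "pos_hull F \<in> \<Sigma>" "finite F" "\<delta> \<in> \<Sigma>" "\<delta> \<subseteq> pos_hull F"
  obtains A where "A \<subseteq> F" "\<delta> = pos_hull A"
  using cone_face_pos_hull[OF assms(3) fan_subset_face[OF assms(1,4,2,5)]] by blast

text \<open>The face is generated by the generators that occur with nonzero coordinate in some
  vector of \<open>W\<close>. Coordinates with respect to an independent set are unique, so every
  face whose span contains \<open>W\<close> needs all of them.\<close>

lemma simplicial_minimal_face:
  fixes \<Sigma> :: "'n::finite cone set"
  assumes fan: "is_fan \<Sigma>" and simp: "simplicial \<Sigma>" and s: "\<sigma> \<in> \<Sigma>" and W: "W \<subseteq> span \<sigma>"
  shows "\<exists>\<gamma>\<in>\<Sigma>. \<gamma> \<subseteq> \<sigma> \<and> W \<subseteq> span \<gamma> \<and> (\<forall>\<delta>\<in>\<Sigma>. \<delta> \<subseteq> \<sigma> \<and> W \<subseteq> span \<delta> \<longrightarrow> \<gamma> \<subseteq> \<delta>)"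
proof -
  obtain F where F: "finite F" "independent F" "\<sigma> = pos_hull F"
    using simp s by (auto simp: simplicial_def)
  have WF: "W \<subseteq> span F" using W F span_pos_hull by blast
  define A where "A = {v\<in>F. \<exists>w\<in>W. representation F w v \<noteq> 0}"
  have A: "A \<subseteq> F" by (auto simp: A_def)
  have finA: "finite A" using A F finite_subset by blast
  have "pos_hull A \<in> \<Sigma>"
    using is_fanD(3)[OF fan s] cone_face_pos_hull_subset[OF F(2) A] F(3) by blast
  moreover have "pos_hull A \<subseteq> \<sigma>" using pos_hull_mono[OF F(1) A] F(3) by blast
  moreover have "W \<subseteq> span (pos_hull A)"
  proof
    fix w assume w: "w \<in> W"
    have "(\<Sum>v | representation F w v \<noteq> 0. representation F w v *\<^sub>R v) = w"
      using sum_nonzero_representation_eq[OF F(2)] WF w by blast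
    moreover have "(\<Sum>v | representation F w v \<noteq> 0. representation F w v *\<^sub>R v) \<in> span A"
      using w representation_ne_zero[of F w] by (intro span_sum span_scale span_base) (auto simp: A_def)
    ultimately show "w \<in> span (pos_hull A)" unfolding span_pos_hull[OF finA] by simp
  qed
  moreover have "pos_hull A \<subseteq> \<delta>" if d: "\<delta> \<in> \<Sigma>" "\<delta> \<subseteq> \<sigma>" "W \<subseteq> span \<delta>" for \<delta>
  proof -
    obtain B where B: "B \<subseteq> F" "\<delta> = pos_hull B"
      using simplicial_face[OF fan _ F(1) d(1)] d(2) F(3) s by blast
    have finB: "finite B" using B F finite_subset by blast
    have "A \<subseteq> B"
    proof
      fix v assume "v \<in> A"
      then obtain w where w: "w \<in> W" "representation F w v \<noteq> 0" by (auto simp: A_def)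
      have "w \<in> span B" using w d(3) B span_pos_hull[OF finB] by blast
      then have "representation F w = representation B w"
        by (rule representation_extend[OF F(2) _ B(1)])
      then show "v \<in> B" using w representation_ne_zero[of B w v] by simp
    qed
    then show ?thesis using B pos_hull_mono[OF finB] by blast
  qed
  ultimately show ?thesis by blast
qed

text \<open>Each coface adds one generator to \<open>\<gamma>\<close>, and both generators belong to
  the same independent set because a common cone \<open>\<sigma>\<close> contains the cofaces. This
  is the configuration of \<open>incidence_diamond\<close>.\<close>

lemma simplicial_two_cofaces:
  fixes \<Sigma> :: "'n::finite cone set"
  assumes fan: "is_fan \<Sigma>" and simp: "simplicial \<Sigma>"
    and mem: "\<sigma> \<in> \<Sigma>" "\<gamma> \<in> \<Sigma>" "\<delta> \<in> \<Sigma>" "\<delta>' \<in> \<Sigma>"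
    and sub: "\<gamma> \<subseteq> \<delta>" "\<gamma> \<subseteq> \<delta>'" "\<delta> \<subseteq> \<sigma>" "\<delta>' \<subseteq> \<sigma>"
    and d: "dim \<delta> = Suc (dim \<gamma>)" "dim \<delta>' = Suc (dim \<gamma>)" "\<delta> \<noteq> \<delta>'"
  obtains C v v' where "independent (insert v (insert v' C))" "v \<noteq> v'" "v \<notin> C" "v' \<notin> C"
    "\<gamma> = pos_hull C" "\<delta> = pos_hull (insert v C)" "\<delta>' = pos_hull (insert v' C)"
    "pos_hull (insert v (insert v' C)) \<in> \<Sigma>"
proof -
  obtain F where F: "finite F" "independent F" "\<sigma> = pos_hull F"
    using simp mem(1) by (auto simp: simplicial_def)
  have s: "pos_hull F \<in> \<Sigma>" using mem F by simp
  obtain C where C: "C \<subseteq> F" "\<gamma> = pos_hull C"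
    using simplicial_face[OF fan s F(1) mem(2)] sub F(3) by blast
  obtain A where A: "A \<subseteq> F" "\<delta> = pos_hull A"
    using simplicial_face[OF fan s F(1) mem(3)] sub F(3) by blast
  obtain B where B: "B \<subseteq> F" "\<delta>' = pos_hull B"
    using simplicial_face[OF fan s F(1) mem(4)] sub F(3) by blast
  have ind: "independent G" "finite G" if "G \<subseteq> F" for G
    using that F independent_mono finite_subset by blast+
  have CA: "C \<subseteq> A" "C \<subseteq> B" using sub pos_hull_subset_iff[OF F(2)] A B C by auto
  have card: "card A = Suc (card C)" "card B = Suc (card C)"
    using d dim_pos_hull ind A B C by metis+
  have step: "\<exists>v. v \<notin> C \<and> G = insert v C" if "C \<subseteq> G" "card G = Suc (card C)" "G \<subseteq> F" for G
  proof -
    have "card (G - C) = 1" using that ind[OF C(1)] by (simp add: card_Diff_subset)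
    then obtain v where "G - C = {v}" by (auto simp: card_1_singleton_iff)
    then show ?thesis using that(1) by blast
  qed
  obtain v where v: "v \<notin> C" "A = insert v C" using step[OF CA(1) card(1) A(1)] by blast
  obtain v' where v': "v' \<notin> C" "B = insert v' C" using step[OF CA(2) card(2) B(1)] by blast
  have "v \<noteq> v'" using v v' A B d(3) by blast
  moreover have G: "insert v (insert v' C) \<subseteq> F" using A B v v' by blast
  moreover have "pos_hull (insert v (insert v' C)) \<in> \<Sigma>"
    using is_fanD(3)[OF fan s] cone_face_pos_hull_subset[OF F(2) G] by blast
  ultimately show ?thesis using that[of v v' C] ind[OF G] v v' A B C by blast
qed

text \<open>Thus the boundary of the cone over both generators has just two components among the
  cofaces of \<open>pos_hull C\<close>.\<close>

lemma simplicial_between: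
  fixes \<Sigma> :: "'n::finite cone set"
  assumes fan: "is_fan \<Sigma>" and ind: "independent (insert v (insert v' C))"
    and vC: "v \<noteq> v'" "v \<notin> C" "v' \<notin> C" and eps: "pos_hull (insert v (insert v' C)) \<in> \<Sigma>"
    and \<eta>: "\<eta> \<in> \<Sigma>" "pos_hull C \<subseteq> \<eta>" "\<eta> \<subseteq> pos_hull (insert v (insert v' C))" "dim \<eta> = Suc (card C)"
  shows "\<eta> = pos_hull (insert v C) \<or> \<eta> = pos_hull (insert v' C)"
proof -
  let ?F = "insert v (insert v' C)"
  have fin: "finite ?F" by (rule independent_imp_finite[OF ind])
  obtain A where A: "A \<subseteq> ?F" "\<eta> = pos_hull A"
    using simplicial_face[OF fan eps fin \<eta>(1,3)] by blast
  have CA: "C \<subseteq> A" using \<eta>(2) pos_hull_subset_iff[OF ind _ A(1), of C] A(2) by blast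
  have "card A = Suc (card C)"
    using dim_pos_hull[OF independent_mono[OF ind A(1)]] \<eta>(4) A(2) by simp
  then have "card (A - C) = 1" using CA fin by (simp add: card_Diff_subset)
  then obtain u where u: "A - C = {u}" by (auto simp: card_1_singleton_iff)
  then have "A = insert u C" using CA by blast
  moreover have "u = v \<or> u = v'" using u A by blast
  ultimately show ?thesis using A(2) by blast
qed

section \<open>Signs of incidence numbers\<close>

text \<open>For two ordered bases of one subspace the sign of this determinant of inner products
  compares their orientations; \<open>incidence\<close> reads it in this way.\<close>

definition gdet :: "(real^'n::finite) list \<Rightarrow> (real^'n) list \<Rightarrow> real" where
  "gdet b c = ndet (length b) (\<lambda>i j. (b ! i) \<bullet> (c ! j))"

definition gmat :: "(real^'n::finite) list \<Rightarrow> (real^'n) list \<Rightarrow> real mat" where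
  "gmat b c = Matrix.mat (length b) (length b) (\<lambda>(i, j). (b ! i) \<bullet> (c ! j))"

lemma gmat_carrier: "gmat b c \<in> carrier_mat (length b) (length b)"
  by (simp add: gmat_def)

lemma gdet_eq_det: "gdet b c = Determinant.det (gmat b c)"
proof -
  have "(\<Prod>i = 0..<length b. gmat b c $$ (i, p i)) = (\<Prod>i<length b. (b ! i) \<bullet> (c ! p i))"
    if "p permutes {0..<length b}" for p
  proof (intro prod.cong)
    fix i assume "i \<in> {..<length b}"
    then have "i < length b" "p i < length b" using permutes_in_image[OF that, of i] by auto
    then show "gmat b c $$ (i, p i) = (b ! i) \<bullet> (c ! p i)" by (simp add: gmat_def)
  qed auto
  then show ?thesis
    unfolding gdet_def ndet_def det_def'[OF gmat_carrier]
    by (intro sum.cong) (auto simp: atLeast0LessThan)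
qed

section \<open>Orthonormal bases as lists\<close>

definition onb :: "(real^'n::finite) list \<Rightarrow> (real^'n) set \<Rightarrow> bool" where
  "onb e V \<longleftrightarrow> span (set e) = V \<and> (\<forall>i<length e. \<forall>j<length e. (e ! i) \<bullet> (e ! j) = (if i = j then 1 else 0))"

lemma onb_nth:
  "onb e V \<Longrightarrow> i < length e \<Longrightarrow> j < length e \<Longrightarrow> (e ! i) \<bullet> (e ! j) = (if i = j then 1 else 0)"
  by (simp add: onb_def)

lemma onb_expand:
  assumes "onb e V" "x \<in> V"
  shows "(\<Sum>l<length e. ((e ! l) \<bullet> x) *\<^sub>R (e ! l)) = x"
proof -
  let ?p = "\<lambda>x. \<Sum>l<length e. ((e ! l) \<bullet> x) *\<^sub>R (e ! l)"
  have "x \<in> span (set e)" using assms by (simp add: onb_def)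
  moreover have "subspace {x. ?p x = x}"
    unfolding subspace_def
    by (auto simp: inner_add_right scaleR_left_distrib sum.distrib
        simp flip: scaleR_scaleR scaleR_sum_right)
  moreover have "x \<in> {x. ?p x = x}" if x: "x \<in> set e" for x
  proof -
    obtain j where j: "j < length e" "x = e ! j" using x by (auto simp: in_set_conv_nth)
    have "?p x = (\<Sum>l<length e. if l = j then e ! j else 0)"
      using assms(1) j by (intro sum.cong) (auto simp: onb_def)
    then show ?thesis using j by simp
  qed
  ultimately have "x \<in> {x. ?p x = x}"
    using span_minimal[of "set e" "{x. ?p x = x}"] by blast
  then show ?thesis by simp
qed

lemma onb_inner:
  assumes "onb e V" "x \<in> V"
  shows "(\<Sum>l<length e. ((e ! l) \<bullet> x) * ((e ! l) \<bullet> y)) = x \<bullet> y"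
proof -
  have "x \<bullet> y = (\<Sum>l<length e. ((e ! l) \<bullet> x) *\<^sub>R (e ! l)) \<bullet> y"
    using onb_expand[OF assms] by simp
  then show ?thesis by (simp add: inner_sum_left)
qed

lemma onb_length:
  fixes e :: "(real^'n::finite) list"
  assumes "onb e V"
  shows "length e = dim V"
proof -
  have o: "(e ! i) \<bullet> (e ! j) = (if i = j then 1 else 0)" if "i < length e" "j < length e" for i j
    using assms that by (simp add: onb_def)
  have "distinct e"
    unfolding distinct_conv_nth
  proof (intro allI impI notI)
    fix i j assume ij: "i < length e" "j < length e" "i \<noteq> j" "e ! i = e ! j"
    then have "(e ! i) \<bullet> (e ! j) = (e ! i) \<bullet> (e ! i)" by simp
    then show False using o[of i j] o[of i i] ij(1-3) by simp
  qed
  moreover have "independent (set e)"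
  proof (rule pairwise_orthogonal_independent)
    show "pairwise orthogonal (set e)"
      unfolding pairwise_def orthogonal_def
    proof (intro ballI impI)
      fix x y assume "x \<in> set e" "y \<in> set e" and ne: "x \<noteq> y"
      then obtain i j where "i < length e" "x = e ! i" "j < length e" "y = e ! j"
        by (auto simp: in_set_conv_nth)
      then show "x \<bullet> y = 0" using o[of i j] ne by auto
    qed
    show "0 \<notin> set e"
    proof
      assume "0 \<in> set e"
      then obtain i where "i < length e" "e ! i = 0" by (auto simp: in_set_conv_nth)
      then show False using o[of i i] by simp
    qed
  qed
  ultimately show ?thesis
    using assms dim_eq_card_independent[of "set e"] distinct_card[of e] dim_span[of "set e"]
    by (simp add: onb_def)
qed

lemma onb_exists:
  fixes V :: "(real^'n::finite) set"
  assumes "subspace V"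
  shows "\<exists>e. onb e V"
proof -
  obtain B where B: "B \<subseteq> V" "pairwise orthogonal B" "\<And>x. x \<in> B \<Longrightarrow> norm x = 1"
    "independent B" "card B = dim V" "span B = V"
    using orthonormal_basis_subspace[OF assms] by blast
  obtain e where e: "set e = B" "distinct e"
    using finite_distinct_list[OF independent_imp_finite[OF B(4)]] by blast
  have "(e ! i) \<bullet> (e ! j) = (if i = j then 1 else 0)" if "i < length e" "j < length e" for i j
  proof (cases "i = j")
    case True
    then show ?thesis using B(3)[of "e ! i"] that(1) e(1) nth_mem[OF that(1)] by (simp add: norm_eq_1)
  next
    case False
    then have "e ! i \<noteq> e ! j" using that e(2) by (simp add: nth_eq_iff_index_eq)
    then show ?thesis using B(2) that e(1) False nth_mem[of i e] nth_mem[of j e]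
      by (auto simp: pairwise_def orthogonal_def)
  qed
  then show ?thesis using e B(6) by (auto simp: onb_def)
qed

lemma onb_orthogonal:
  assumes "onb (u # e) V'" "onb e V" "x \<in> V"
  shows "u \<bullet> x = 0"
proof -
  have "u \<bullet> (e ! i) = 0" if "i < length e" for i
    using onb_nth[OF assms(1), of 0 "Suc i"] that by simp
  then have "u \<bullet> (\<Sum>l<length e. ((e ! l) \<bullet> x) *\<^sub>R (e ! l)) = 0"
    unfolding inner_sum_right by (intro sum.neutral) simp
  then show ?thesis using onb_expand[OF assms(2,3)] by simp
qed

text \<open>One step of Gram-Schmidt. The new vector goes in front, at the place where
  \<open>incidence\<close> puts the outward direction.\<close>

lemma onb_extend:
  fixes v :: "real^'n::finite"
  assumes e: "onb e (span C)" and v: "v \<notin> span C"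
  shows "\<exists>u. onb (u # e) (span (insert v C))"
proof -
  define y where "y = (\<Sum>l<length e. ((e ! l) \<bullet> v) *\<^sub>R (e ! l))"
  define z where "z = v - y"
  have eC: "e ! l \<in> span C" if "l < length e" for l
    using e span_base[OF nth_mem[OF that]] by (simp add: onb_def)
  have y: "y \<in> span C" unfolding y_def by (intro span_sum span_scale eC) simp
  have "z \<noteq> 0" using v y by (auto simp: z_def)
  have orth: "(e ! j) \<bullet> z = 0" if j: "j < length e" for j
  proof -
    have "(e ! j) \<bullet> y = (\<Sum>l<length e. if l = j then (e ! j) \<bullet> v else 0)"
      unfolding y_def inner_sum_right using e j by (intro sum.cong) (auto simp: onb_def)
    then show ?thesis using j by (simp add: z_def inner_diff_right)
  qed
  define u where "u = z /\<^sub>R norm z"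
  have zu: "z = norm z *\<^sub>R u" using \<open>z \<noteq> 0\<close> by (simp add: u_def)
  have uu: "u \<bullet> u = 1"
    using \<open>z \<noteq> 0\<close> by (simp add: u_def dot_square_norm power2_eq_square)
  have eu: "(e ! j) \<bullet> u = 0" if "j < length e" for j using orth[OF that] by (simp add: u_def)
  have ue: "u \<bullet> (e ! j) = 0" if "j < length e" for j using eu[OF that] by (simp add: inner_commute)
  have "((u # e) ! i) \<bullet> ((u # e) ! j) = (if i = j then 1 else 0)"
    if "i < Suc (length e)" "j < Suc (length e)" for i j
    using that uu eu ue onb_nth[OF e] by (cases i; cases j) auto
  moreover have "span (set (u # e)) = span (insert v C)"
  proof
    have "u \<in> span (insert v C)"
      unfolding u_def z_def
      using y span_mono[of C "insert v C"] by (intro span_scale span_diff) (auto intro: span_base)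
    moreover have "set e \<subseteq> span (insert v C)"
      using e span_superset[of "set e"] span_mono[of C "insert v C"] by (auto simp: onb_def)
    ultimately show "span (set (u # e)) \<subseteq> span (insert v C)"
      by (intro span_minimal) auto
    have sC: "span C \<subseteq> span (set (u # e))"
      using e span_mono[of "set e" "set (u # e)"] by (auto simp: onb_def)
    have "v = y + norm z *\<^sub>R u" using zu by (simp add: z_def)
    also have "\<dots> \<in> span (set (u # e))"
      using y sC by (intro span_add span_scale) (auto intro: span_base)
    finally show "span (insert v C) \<subseteq> span (set (u # e))"
      using sC span_superset[of C] by (intro span_minimal) auto
  qed
  ultimately show ?thesis unfolding onb_def by (intro exI[of _ u]) simp
qed

text \<open>In orthonormal coordinates the matrix of inner products is the transpose of one
  coordinate matrix times the other. So the sign splits into one factor for each list.\<close>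

lemma gdet_product:
  fixes b c :: "(real^'n::finite) list"
  assumes e: "onb e V" and len: "length b = length e" "length c = length e" and bV: "set b \<subseteq> V"
  shows "gdet b c = gdet e b * gdet e c"
proof -
  let ?k = "length e"
  have car: "gmat e b \<in> carrier_mat ?k ?k" "gmat e c \<in> carrier_mat ?k ?k"
    by (simp_all add: gmat_def)
  have "gmat b c = transpose_mat (gmat e b) * gmat e c"
  proof (rule eq_matI)
    fix i j assume "i < dim_row (transpose_mat (gmat e b) * gmat e c)"
      "j < dim_col (transpose_mat (gmat e b) * gmat e c)"
    then have ij: "i < ?k" "j < ?k" by (simp_all add: gmat_def)
    then have "b ! i \<in> V" using bV len nth_mem by force
    then have "(b ! i) \<bullet> (c ! j) = (\<Sum>l<?k. ((e ! l) \<bullet> (b ! i)) * ((e ! l) \<bullet> (c ! j)))"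
      by (simp add: onb_inner[OF e])
    then show "gmat b c $$ (i, j) = (transpose_mat (gmat e b) * gmat e c) $$ (i, j)"
      using ij len by (simp add: gmat_def scalar_prod_def atLeast0LessThan)
  qed (auto simp: gmat_def len)
  then show ?thesis
    unfolding gdet_eq_det using car det_mult[OF transpose_carrier_mat[THEN iffD2, OF car(1)] car(2)]
      Determinant.det_transpose[OF car(1)] by simp
qed

text \<open>A kernel vector of the matrix would give a combination of \<open>b\<close> orthogonal to
  the whole orthonormal basis. It lies in \<open>V\<close>, hence is 0, against
  independence.\<close>

lemma gdet_nonzero:
  fixes b :: "(real^'n::finite) list"
  assumes e: "onb e V" and len: "length b = length e" and b: "distinct b" "independent (set b)" "set b \<subseteq> V"
  shows "gdet e b \<noteq> 0"
proof
  let ?k = "length e"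
  assume "gdet e b = 0"
  then have "Determinant.det (gmat e b) = 0" by (simp add: gdet_eq_det)
  then obtain v where v: "v \<in> carrier_vec ?k" "v \<noteq> 0\<^sub>v ?k" "gmat e b *\<^sub>v v = 0\<^sub>v ?k"
    using det_0_iff_vec_prod_zero_field[OF gmat_carrier[of e b]] by blast
  define y where "y = (\<Sum>j<?k. vec_index v j *\<^sub>R (b ! j))"
  have V: "subspace V" using e by (auto simp: onb_def)
  have yV: "y \<in> V"
    unfolding y_def using V b(3) len by (intro subspace_sum subspace_scale) auto
  have "(e ! i) \<bullet> y = 0" if i: "i < ?k" for i
  proof -
    have "(e ! i) \<bullet> y = vec_index (gmat e b *\<^sub>v v) i"
      using i v(1) unfolding y_def inner_sum_right
      by (simp add: gmat_def scalar_prod_def atLeast0LessThan mult.commute)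
    then show ?thesis using i v(3) by simp
  qed
  then have "y \<bullet> y = 0" using onb_inner[OF e yV, of y] by simp
  then have y0: "y = 0" by simp
  obtain j where j: "j < ?k" "vec_index v j \<noteq> 0"
    using v(1,2) by (metis carrier_vecD eq_vecI index_zero_vec(1,2))
  \<comment> \<open>The kernel vector is indexed by positions; as \<open>b\<close> is distinct, its
    entries can be read as coefficients attached to vectors.\<close>
  define f where "f x = vec_index v (THE j. j < ?k \<and> b ! j = x)" for x
  have f: "f (b ! j) = vec_index v j" if "j < ?k" for j
  proof -
    have "(THE i. i < ?k \<and> b ! i = b ! j) = j"
      using that b(1) len by (intro the_equality) (auto simp: nth_eq_iff_index_eq)
    then show ?thesis by (simp add: f_def)
  qed
  have inj: "inj_on (\<lambda>j. b ! j) {..<?k}"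
    using b(1) len by (auto simp: inj_on_def nth_eq_iff_index_eq)
  have im: "(\<lambda>j. b ! j) ` {..<?k} = set b" using len by (auto simp: set_conv_nth)
  have "(\<Sum>x\<in>set b. f x *\<^sub>R x) = y"
    unfolding im[symmetric] y_def by (subst sum.reindex[OF inj]) (auto simp: f)
  then have "\<forall>x\<in>set b. f x = 0"
    using b(2) y0 independent_explicit[of "set b"] by blast
  then show False using j f[OF j(1)] len nth_mem[of j b] by auto
qed

text \<open>Since \<open>u\<close> is orthogonal to \<open>c\<close>, the first row has at most one
  nonzero entry, and expansion along it leaves the smaller determinant.\<close>

lemma gdet_block:
  fixes c :: "(real^'n::finite) list"
  assumes len: "length c = length e" and orth: "\<And>x. x \<in> set c \<Longrightarrow> u \<bullet> x = 0"
  shows "gdet (u # e) (w # c) = (u \<bullet> w) * gdet e c"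
proof -
  let ?n = "Suc (length e)" and ?A = "gmat (u # e) (w # c)"
  have A: "?A \<in> carrier_mat ?n ?n" by (simp add: gmat_def)
  have "mat_delete ?A 0 0 = gmat e c"
    by (rule eq_matI) (auto simp: mat_delete_def gmat_def)
  then have c0: "cofactor ?A 0 0 = gdet e c" by (simp add: cofactor_def gdet_eq_det)
  have "Determinant.det ?A = (\<Sum>j<?n. ?A $$ (0, j) * cofactor ?A 0 j)"
    by (rule laplace_expansion_row[OF A]) simp
  also have "\<dots> = (\<Sum>j<?n. if j = 0 then (u \<bullet> w) * gdet e c else 0)"
  proof (intro sum.cong refl)
    fix j assume "j \<in> {..<?n}"
    then show "?A $$ (0, j) * cofactor ?A 0 j = (if j = 0 then (u \<bullet> w) * gdet e c else 0)"
      using orth len c0 by (cases j) (auto simp: gmat_def)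
  qed
  finally show ?thesis by (simp add: gdet_eq_det)
qed

lemma gdet_swap:
  fixes b c :: "(real^'n::finite) list"
  assumes "length b = Suc (Suc (length c))"
  shows "gdet b (x # y # c) = - gdet b (y # x # c)"
proof -
  let ?n = "length b"
  have "gmat b (x # y # c) = mat_swapcols 0 1 (gmat b (y # x # c))"
  proof (rule eq_matI)
    fix i j assume "i < dim_row (mat_swapcols 0 1 (gmat b (y # x # c)))"
      "j < dim_col (mat_swapcols 0 1 (gmat b (y # x # c)))"
    then have "i < ?n" "j < ?n" by (simp_all add: gmat_def)
    then show "gmat b (x # y # c) $$ (i, j) = mat_swapcols 0 1 (gmat b (y # x # c)) $$ (i, j)"
      using assms by (auto simp: gmat_def nth_Cons split: nat.splits)
  qed (auto simp: gmat_def)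
  then show ?thesis
    unfolding gdet_eq_det using det_swapcols[OF _ _ _ gmat_carrier, of 0 b 1 "y # x # c"] assms
    by simp
qed

section \<open>Orientations and incidence numbers\<close>

lemma ori_spec:
  fixes \<gamma> :: "'n::finite cone"
  shows "length (ori \<gamma>) = dim \<gamma>" "distinct (ori \<gamma>)" "independent (set (ori \<gamma>))"
    "span (set (ori \<gamma>)) = span \<gamma>"
proof -
  obtain B where B: "B \<subseteq> span \<gamma>" "independent B" "span \<gamma> \<subseteq> span B" "card B = dim (span \<gamma>)"
    using basis_exists by blast
  obtain b where b: "set b = B" "distinct b"
    using finite_distinct_list[OF independent_imp_finite[OF B(2)]] by blast
  have "span B = span \<gamma>" using B(1,3) span_minimal[OF B(1)] by auto
  then have "length b = dim \<gamma> \<and> distinct b \<and> independent (set b) \<and> span (set b) = span \<gamma>"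
    using b B distinct_card[OF b(2)] by (simp add: dim_span)
  then have "length (ori \<gamma>) = dim \<gamma> \<and> distinct (ori \<gamma>) \<and> independent (set (ori \<gamma>)) \<and> span (set (ori \<gamma>)) = span \<gamma>"
    unfolding ori_def by (rule someI)
  then show "length (ori \<gamma>) = dim \<gamma>" "distinct (ori \<gamma>)" "independent (set (ori \<gamma>))"
    "span (set (ori \<gamma>)) = span \<gamma>" by auto
qed

lemma gdet_ori_nonzero:
  assumes "onb e (span \<gamma>)"
  shows "gdet e (ori \<gamma>) \<noteq> 0"
  by (rule gdet_nonzero[OF assms])
    (use ori_spec[of \<gamma>] onb_length[OF assms] span_superset[of "set (ori \<gamma>)"] in \<open>auto simp: dim_span\<close>)

text \<open>The sign separates into contributions of the two chosen orientations and of
  \<open>v\<close>. The arbitrary vector of \<open>\<gamma>\<close> used by \<open>incidence\<close>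
  has a positive coefficient at \<open>v\<close>, so \<open>v\<close> may replace it; the minus sign
  comes from the outward direction.\<close>

lemma incidence_sgn:
  fixes v :: "real^'n::finite"
  assumes ind: "independent (insert v C)" and v: "v \<notin> C"
    and e: "onb e (span C)" and ue: "onb (u # e) (span (insert v C))"
  defines "\<gamma> \<equiv> pos_hull (insert v C)" and "\<gamma>' \<equiv> pos_hull C"
  shows "real_of_int (incidence \<gamma> \<gamma>') = - sgn (gdet (u # e) (ori \<gamma>)) * sgn (u \<bullet> v) * sgn (gdet e (ori \<gamma>'))"
    and "u \<bullet> v \<noteq> 0"
proof -
  have fin: "finite (insert v C)" "finite C" using independent_imp_finite[OF ind] by auto
  have sp: "span \<gamma> = span (insert v C)" "span \<gamma>' = span C"
    using span_pos_hull fin by (auto simp: \<gamma>_def \<gamma>'_def)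
  have uC: "u \<bullet> x = 0" if "x \<in> span C" for x using onb_orthogonal[OF ue e that] .
  have vC: "v \<notin> span C" using ind v by (simp add: independent_insert)
  show uv: "u \<bullet> v \<noteq> 0"
  proof
    assume "u \<bullet> v = 0"
    then have "insert v C \<subseteq> {x. u \<bullet> x = 0}" using uC span_base by auto
    then have "span (insert v C) \<subseteq> {x. u \<bullet> x = 0}"
      by (intro span_minimal) (auto intro: subspace_hyperplane)
    moreover have "u \<in> span (insert v C)" using ue span_base[of u "set (u # e)"] by (auto simp: onb_def)
    moreover have "u \<bullet> u = 1" using onb_nth[OF ue, of 0 0] by simp
    ultimately show False by auto
  qed
  define w where "w = (SOME w. w \<in> \<gamma> \<and> w \<notin> span \<gamma>')"
  have "v \<in> \<gamma>" using pos_hull_superset[OF fin(1)] by (auto simp: \<gamma>_def)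
  then have w: "w \<in> \<gamma>" "w \<notin> span \<gamma>'"
    unfolding w_def using vC sp(2) someI[of "\<lambda>w. w \<in> \<gamma> \<and> w \<notin> span \<gamma>'" v] by auto
  obtain c where c: "w = (\<Sum>x\<in>insert v C. c x *\<^sub>R x)" "\<forall>x\<in>insert v C. 0 \<le> c x"
    using w(1) unfolding \<gamma>_def pos_hull_def by blast
  have "w = c v *\<^sub>R v + (\<Sum>x\<in>C. c x *\<^sub>R x)" using c(1) v fin by simp
  moreover have s: "(\<Sum>x\<in>C. c x *\<^sub>R x) \<in> span C"
    by (intro span_sum span_scale span_base)
  ultimately have "c v \<noteq> 0" "u \<bullet> w = c v * (u \<bullet> v)"
    using w(2) sp(2) uC[OF s] by (auto simp: inner_add_right)
  then have sgnw: "sgn (u \<bullet> w) = sgn (u \<bullet> v)" using c(2) by (auto simp: sgn_mult)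
  have d: "dim \<gamma> = length (u # e)" "dim \<gamma>' = length e"
    using onb_length[OF ue] onb_length[OF e] sp dim_span by metis+
  let ?c = "(- w) # ori \<gamma>'"
  have "ndet (dim \<gamma>) (\<lambda>i j. (ori \<gamma> ! i) \<bullet> (?c ! j)) = gdet (ori \<gamma>) ?c"
    by (simp add: gdet_def ori_spec(1))
  also have "\<dots> = gdet (u # e) (ori \<gamma>) * gdet (u # e) ?c"
    by (rule gdet_product[OF ue])
      (use d ori_spec(1)[of \<gamma>] ori_spec(1)[of \<gamma>'] ori_spec(4)[of \<gamma>] span_superset[of "set (ori \<gamma>)"] sp in auto)
  also have "gdet (u # e) ?c = (u \<bullet> (- w)) * gdet e (ori \<gamma>')"
    by (rule gdet_block)
      (use d ori_spec(1)[of \<gamma>'] ori_spec(4)[of \<gamma>'] span_superset[of "set (ori \<gamma>')"] sp uC in auto)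
  finally have nd: "ndet (dim \<gamma>) (\<lambda>i j. (ori \<gamma> ! i) \<bullet> (?c ! j))
      = - (gdet (u # e) (ori \<gamma>) * (u \<bullet> w) * gdet e (ori \<gamma>'))" by simp
  have ne: "gdet (u # e) (ori \<gamma>) \<noteq> 0" "gdet e (ori \<gamma>') \<noteq> 0" "u \<bullet> w \<noteq> 0"
    using gdet_ori_nonzero[of "u # e" \<gamma>] gdet_ori_nonzero[of e \<gamma>'] ue e sp sgnw uv
    by (auto simp: sgn_zero_iff)
  have "real_of_int (incidence \<gamma> \<gamma>') = sgn (ndet (dim \<gamma>) (\<lambda>i j. (ori \<gamma> ! i) \<bullet> (?c ! j)))"
    using nd ne unfolding incidence_def Let_def w_def[symmetric] by (auto simp: sgn_if)
  then show "real_of_int (incidence \<gamma> \<gamma>') = - sgn (gdet (u # e) (ori \<gamma>)) * sgn (u \<bullet> v) * sgn (gdet e (ori \<gamma>'))"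
    by (simp add: nd sgn_mult sgnw sgn_minus)
qed

text \<open>Along either path the product of the two incidence numbers is the orientation of
  \<open>\<epsilon>\<close> relative to the added generators followed by
  \<open>ori \<gamma>\<close>: the orientation of the middle cone enters twice and cancels, as do
  the two outward minus signs. The paths differ by an exchange of the first two columns.\<close>

lemma incidence_diamond:
  fixes v v' :: "real^'n::finite"
  assumes ind: "independent (insert v (insert v' C))" and vC: "v \<noteq> v'" "v \<notin> C" "v' \<notin> C"
  defines "\<epsilon> \<equiv> pos_hull (insert v (insert v' C))" and "\<gamma> \<equiv> pos_hull C"
    and "\<delta> \<equiv> pos_hull (insert v C)" and "\<delta>' \<equiv> pos_hull (insert v' C)"
  shows "incidence \<epsilon> \<delta> * incidence \<delta> \<gamma> = - (incidence \<epsilon> \<delta>' * incidence \<delta>' \<gamma>)"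
proof -
  obtain e where e: "onb e (span C)" using onb_exists[OF subspace_span] by blast
  have spC: "span \<gamma> = span C"
    using span_pos_hull independent_imp_finite[OF ind] by (auto simp: \<gamma>_def)
  have one_side: "real_of_int (incidence (pos_hull (insert y (insert x C))) (pos_hull (insert x C))
        * incidence (pos_hull (insert x C)) \<gamma>)
      = sgn (gdet (ori (pos_hull (insert y (insert x C)))) (y # x # ori \<gamma>))"
    if ind': "independent (insert y (insert x C))" and xy: "y \<noteq> x" "x \<notin> C" "y \<notin> C" for x y
  proof -
    let ?d = "pos_hull (insert x C)" and ?e = "pos_hull (insert y (insert x C))"
    have ix: "independent (insert x C)" using ind' independent_mono by blast
    have "x \<notin> span C" using ix xy by (simp add: independent_insert)
    then obtain u where u: "onb (u # e) (span (insert x C))" using onb_extend[OF e] by blast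
    have "y \<notin> span (insert x C)" using ind' xy by (simp add: independent_insert)
    then obtain t where t: "onb (t # u # e) (span (insert y (insert x C)))" using onb_extend[OF u] by blast
    have yn: "y \<notin> insert x C" using xy by blast
    note 1 = incidence_sgn[OF ind' yn u t]
    note 2 = incidence_sgn[OF ix xy(2) e u]
    have spd: "span ?d = span (insert x C)" and spe: "span ?e = span (insert y (insert x C))"
      using span_pos_hull[OF independent_imp_finite[OF ix]]
        span_pos_hull[OF independent_imp_finite[OF ind']] by auto
    have ne: "gdet (u # e) (ori ?d) \<noteq> 0" using gdet_ori_nonzero[of "u # e" ?d] u spd by simp
    have oC: "set (ori \<gamma>) \<subseteq> span C"
      using ori_spec(4)[of \<gamma>] span_superset[of "set (ori \<gamma>)"] spC by auto
    have le: "length (ori \<gamma>) = length e"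
      using ori_spec(1)[of \<gamma>] onb_length[OF e] spC dim_span by metis
    have "gdet (u # e) (x # ori \<gamma>) = (u \<bullet> x) * gdet e (ori \<gamma>)"
      by (rule gdet_block[OF le]) (use onb_orthogonal[OF u e] oC in blast)
    moreover have "gdet (t # u # e) (y # x # ori \<gamma>) = (t \<bullet> y) * gdet (u # e) (x # ori \<gamma>)"
    proof (rule gdet_block)
      show "t \<bullet> z = 0" if "z \<in> set (x # ori \<gamma>)" for z
      proof (rule onb_orthogonal[OF t u])
        show "z \<in> span (insert x C)"
          using that oC span_mono[of C "insert x C"] span_base[of x "insert x C"] by auto
      qed
    qed (simp add: le)
    moreover have "gdet (ori ?e) (y # x # ori \<gamma>)
        = gdet (t # u # e) (ori ?e) * gdet (t # u # e) (y # x # ori \<gamma>)"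
    proof (rule gdet_product[OF t])
      show "length (ori ?e) = length (t # u # e)"
        using ori_spec(1)[of ?e] onb_length[OF t] spe dim_span by metis
      show "set (ori ?e) \<subseteq> span (insert y (insert x C))"
        using ori_spec(4)[of ?e] span_superset[of "set (ori ?e)"] spe by auto
    qed (simp add: le)
    ultimately have "sgn (gdet (ori ?e) (y # x # ori \<gamma>))
        = sgn (gdet (t # u # e) (ori ?e)) * sgn (t \<bullet> y) * sgn (u \<bullet> x) * sgn (gdet e (ori \<gamma>))"
      by (simp add: sgn_mult mult.assoc)
    moreover have "sgn (gdet (u # e) (ori ?d)) * sgn (gdet (u # e) (ori ?d)) = 1"
      using ne by (simp add: sgn_if)
    ultimately show ?thesis
      unfolding of_int_mult 1(1) 2(1)[folded \<gamma>_def] by (simp add: algebra_simps)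
  qed
  have sw: "insert v (insert v' C) = insert v' (insert v C)" by blast
  have fin: "finite C" using independent_imp_finite[OF ind] by auto
  have "length (ori \<epsilon>) = Suc (Suc (length (ori \<gamma>)))"
    unfolding ori_spec(1) \<epsilon>_def \<gamma>_def dim_pos_hull[OF ind]
    using dim_pos_hull[of C] independent_mono[OF ind] vC fin by (metis card_insert_disjoint
        finite_insert insert_iff subset_insertI subset_trans)
  from gdet_swap[OF this, of v v']
  have "sgn (gdet (ori \<epsilon>) (v # v' # ori \<gamma>)) = - sgn (gdet (ori \<epsilon>) (v' # v # ori \<gamma>))"
    by (simp add: sgn_minus)
  then have "real_of_int (incidence \<epsilon> \<delta>' * incidence \<delta>' \<gamma>) = - real_of_int (incidence \<epsilon> \<delta> * incidence \<delta> \<gamma>)"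
    using one_side[of v v'] one_side[of v' v] ind vC sw unfolding \<epsilon>_def \<delta>_def \<delta>'_def by auto
  then show ?thesis by linarith
qed

section \<open>Chain complexes of a fan\<close>

abbreviation restr :: "'a set \<Rightarrow> ('a \<Rightarrow> 'b::zero) \<Rightarrow> 'a \<Rightarrow> 'b" where
  "restr K c \<equiv> (\<lambda>\<gamma>. if \<gamma> \<in> K then c \<gamma> else 0)"

abbreviation point_chain :: "'a \<Rightarrow> 'b::zero \<Rightarrow> 'a \<Rightarrow> 'b" where
  "point_chain \<delta> f \<equiv> (\<lambda>\<gamma>. if \<gamma> = \<delta> then f else 0)"

lemma cells_diff: "cells G G' = cells (G - G') {}"
  by (auto simp: cells_def fun_eq_iff)

text \<open>A relative complex is determined by the set of its cells. From here on, complexes are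
  therefore indexed by one set, with empty second argument.\<close>

lemma complex_diff:
  "chains G G' = chains (G - G') {}" "bd G G' = bd (G - G') {}"
  "cycles G G' = cycles (G - G') {}" "bounds G G' = bounds (G - G') {}"
  "hom_ann G G' = hom_ann (G - G') {}"
proof -
  show c: "chains G G' = chains (G - G') {}"
    by (intro ext) (simp add: chains_def cells_diff[of G G'])
  show b: "bd G G' = bd (G - G') {}"
    by (intro ext) (simp add: bd_def cells_diff[of G G'])
  show "cycles G G' = cycles (G - G') {}"
    by (intro ext) (simp only: cycles_def c b)
  show d: "bounds G G' = bounds (G - G') {}"
    by (intro ext) (simp only: bounds_def c b)
  show "hom_ann G G' = hom_ann (G - G') {}"
    by (intro ext) (simp only: hom_ann_def d)
qed

lemma chainsD: "c \<in> chains K {} i \<Longrightarrow> c \<gamma> \<noteq> 0 \<Longrightarrow> \<gamma> \<in> K \<and> dim \<gamma> = i"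
  by (auto simp: chains_def cells_def)

lemma chainsI: "(\<And>\<gamma>. c \<gamma> \<noteq> 0 \<Longrightarrow> \<gamma> \<in> K \<and> dim \<gamma> = i) \<Longrightarrow> c \<in> chains K {} i"
  by (auto simp: chains_def cells_def)

lemma bd_add: "bd G G' i (\<lambda>\<gamma>. b \<gamma> + c \<gamma>) = (\<lambda>\<gamma>. bd G G' i b \<gamma> + bd G G' i c \<gamma>)"
  by (auto simp: bd_def fun_eq_iff sum.distrib[symmetric] distrib_left intro!: sum.cong)

lemma bd_scale: "bd G G' i (\<lambda>\<gamma>. r * b \<gamma>) = (\<lambda>\<gamma>. r * bd G G' i b \<gamma>)"
  by (auto simp: bd_def fun_eq_iff sum_distrib_left mult.left_commute intro!: sum.cong)

lemma bd_diff: "bd G G' i (\<lambda>\<gamma>. b \<gamma> - c \<gamma>) = (\<lambda>\<gamma>. bd G G' i b \<gamma> - bd G G' i c \<gamma>)"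
  using bd_add[of G G' i b "\<lambda>\<gamma>. - 1 * c \<gamma>"] bd_scale[of G G' i "- 1" c] by simp

lemma bd_zero: "bd G G' i (\<lambda>\<gamma>. 0) = (\<lambda>\<gamma>. 0)"
  by (auto simp: bd_def fun_eq_iff intro!: sum.neutral)

lemma bd_cells: "bd G G' i b \<gamma> \<noteq> 0 \<Longrightarrow> \<gamma> \<in> cells G G' (i - 1)"
  by (auto simp: bd_def split: if_splits)

lemma dirderiv_of_int_mult: "dirderiv w (of_int k * p) = of_int k * dirderiv w p"
proof -
  have "(of_int k :: 'a spoly) = Const (of_int k)" by (simp add: Const_def)
  then show ?thesis by (simp add: dirderiv_mult dirderiv_Const)
qed

lemma bd_dirderiv: "bd G G' i (\<lambda>\<gamma>. dirderiv w (b \<gamma>)) = (\<lambda>\<gamma>. dirderiv w (bd G G' i b \<gamma>))"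
  by (auto simp: bd_def fun_eq_iff dirderiv_sum dirderiv_of_int_mult intro!: sum.cong)

lemma incidence_cases: "incidence \<gamma> \<gamma>' = 1 \<or> incidence \<gamma> \<gamma>' = -1"
  by (simp add: incidence_def Let_def)

lemma incidence_square: "incidence \<gamma> \<gamma>' * incidence \<gamma> \<gamma>' = 1"
  using incidence_cases[of \<gamma> \<gamma>'] by auto

lemma of_int_incidence_square:
  "of_int (incidence \<gamma> \<gamma>') * (of_int (incidence \<gamma> \<gamma>') * x) = (x :: 'a::ring_1)"
  using incidence_square[of \<gamma> \<gamma>'] by (metis mult.assoc mult_1 of_int_1 of_int_mult)

lemma bd_point_chain:
  assumes "finite K" "\<delta> \<in> K" "dim \<delta> = i"
  shows "bd K {} i (point_chain \<delta> f) \<gamma>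
    = (if \<gamma> \<in> K \<and> dim \<gamma> = i - 1 \<and> \<gamma> \<subseteq> \<delta> then of_int (incidence \<delta> \<gamma>) * f else 0)"
proof -
  have "(\<Sum>\<eta>\<in>cells K {} i. if \<gamma> \<subseteq> \<eta> then of_int (incidence \<eta> \<gamma>) * (if \<eta> = \<delta> then f else 0) else 0)
      = (\<Sum>\<eta>\<in>cells K {} i. if \<eta> = \<delta> then (if \<gamma> \<subseteq> \<delta> then of_int (incidence \<delta> \<gamma>) * f else 0) else 0)"
    by (intro sum.cong) auto
  also have "\<dots> = (if \<gamma> \<subseteq> \<delta> then of_int (incidence \<delta> \<gamma>) * f else 0)"
    using assms by (simp add: cells_def)
  finally show ?thesis by (simp add: bd_def cells_def)
qed

lemma point_chain_sum:
  assumes "finite K" "c \<in> chains K {} i"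
  shows "c = (\<lambda>\<gamma>. \<Sum>\<delta>\<in>{\<delta>\<in>K. dim \<delta> = i}. point_chain \<delta> (c \<delta>) \<gamma>)"
proof
  fix \<gamma>
  show "c \<gamma> = (\<Sum>\<delta>\<in>{\<delta>\<in>K. dim \<delta> = i}. point_chain \<delta> (c \<delta>) \<gamma>)"
    using assms chainsD[OF assms(2), of \<gamma>] by (auto simp: sum.delta')
qed

text \<open>Restriction to \<open>K\<close> is a chain map when \<open>K\<close> is closed upwards:
  a boundary coefficient at a cell of \<open>K\<close> involves cells above it only. The complex of
  \<open>K\<close> is then a quotient, not in general a subcomplex.\<close>

lemma bd_restr:
  assumes fin: "finite X" and KX: "K \<subseteq> X"
    and up: "\<forall>\<gamma>'\<in>K. \<forall>\<gamma>\<in>X. \<gamma>' \<subseteq> \<gamma> \<longrightarrow> \<gamma> \<in> K"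
    and g: "\<gamma> \<in> K"
  shows "bd K {} i (restr K b) \<gamma> = bd X {} i b \<gamma>"
proof -
  have "(\<Sum>\<eta>\<in>cells K {} i. if \<gamma> \<subseteq> \<eta> then of_int (incidence \<eta> \<gamma>) * restr K b \<eta> else 0)
      = (\<Sum>\<eta>\<in>cells X {} i. if \<gamma> \<subseteq> \<eta> then of_int (incidence \<eta> \<gamma>) * b \<eta> else 0)"
    by (rule sum.mono_neutral_cong_left) (use fin KX up g in \<open>auto simp: cells_def\<close>)
  then show ?thesis using g KX by (auto simp: bd_def cells_def)
qed

lemma bounds_iff:
  "x \<in> bounds G G' Jf i \<longleftrightarrow> (\<exists>b j. b \<in> chains G G' (i + 1) \<and> j \<in> chains G G' i
     \<and> (\<forall>\<gamma>. j \<gamma> \<in> Jf \<gamma>) \<and> (\<forall>\<gamma>. x \<gamma> = bd G G' (i + 1) b \<gamma> + j \<gamma>))"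
  unfolding bounds_def by (auto simp: fun_eq_iff)

lemma boundsI:
  assumes "b \<in> chains G G' (i + 1)" "j \<in> chains G G' i" "\<And>\<gamma>. j \<gamma> \<in> Jf \<gamma>"
    "\<And>\<gamma>. x \<gamma> = bd G G' (i + 1) b \<gamma> + j \<gamma>"
  shows "x \<in> bounds G G' Jf i"
  unfolding bounds_iff using assms by blast

lemma is_submodule_bounds:
  assumes I: "\<And>\<gamma>. is_ideal (Jf \<gamma>)"
  shows "is_submodule (bounds G G' Jf i)"
  unfolding is_submodule_def
proof (intro conjI ballI allI)
  show "(\<lambda>_. 0) \<in> bounds G G' Jf i"
    by (rule boundsI[of "\<lambda>_. 0" _ _ _ "\<lambda>_. 0"]) (auto simp: chains_def bd_zero is_idealD[OF I])
next
  fix x y assume "x \<in> bounds G G' Jf i" "y \<in> bounds G G' Jf i"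
  then obtain b j c k where bj: "b \<in> chains G G' (i + 1)" "j \<in> chains G G' i"
      "\<forall>\<gamma>. j \<gamma> \<in> Jf \<gamma>" "\<forall>\<gamma>. x \<gamma> = bd G G' (i + 1) b \<gamma> + j \<gamma>"
    and ck: "c \<in> chains G G' (i + 1)" "k \<in> chains G G' i"
      "\<forall>\<gamma>. k \<gamma> \<in> Jf \<gamma>" "\<forall>\<gamma>. y \<gamma> = bd G G' (i + 1) c \<gamma> + k \<gamma>"
    unfolding bounds_iff by blast
  show "(\<lambda>\<gamma>. x \<gamma> + y \<gamma>) \<in> bounds G G' Jf i"
    by (rule boundsI[of "\<lambda>\<gamma>. b \<gamma> + c \<gamma>" _ _ _ "\<lambda>\<gamma>. j \<gamma> + k \<gamma>"])
      (use bj ck in \<open>auto simp: chains_def bd_add is_idealD[OF I] algebra_simps\<close>)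
next
  fix r x assume "x \<in> bounds G G' Jf i"
  then obtain b j where bj: "b \<in> chains G G' (i + 1)" "j \<in> chains G G' i"
      "\<forall>\<gamma>. j \<gamma> \<in> Jf \<gamma>" "\<forall>\<gamma>. x \<gamma> = bd G G' (i + 1) b \<gamma> + j \<gamma>"
    unfolding bounds_iff by blast
  show "(\<lambda>\<gamma>. r * x \<gamma>) \<in> bounds G G' Jf i"
    by (rule boundsI[of "\<lambda>\<gamma>. r * b \<gamma>" _ _ _ "\<lambda>\<gamma>. r * j \<gamma>"])
      (use bj in \<open>auto simp: chains_def bd_scale is_idealD[OF I] distrib_left\<close>)
qed

lemma is_ideal_ideal_sum:
  assumes "\<And>t. t \<in> T \<Longrightarrow> is_ideal (I t)"
  shows "is_ideal (ideal_sum T I)"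
  unfolding is_ideal_def ideal_sum_def
proof (intro conjI ballI allI)
  show "0 \<in> {\<Sum>t\<in>T. f t |f. \<forall>t\<in>T. f t \<in> I t}"
    using is_idealD(1)[OF assms] by (auto intro!: exI[of _ "\<lambda>_. 0"])
next
  fix a b assume "a \<in> {\<Sum>t\<in>T. f t |f. \<forall>t\<in>T. f t \<in> I t}" "b \<in> {\<Sum>t\<in>T. f t |f. \<forall>t\<in>T. f t \<in> I t}"
  then obtain f g where "a = (\<Sum>t\<in>T. f t)" "\<forall>t\<in>T. f t \<in> I t" "b = (\<Sum>t\<in>T. g t)" "\<forall>t\<in>T. g t \<in> I t"
    by blast
  then show "a + b \<in> {\<Sum>t\<in>T. f t |f. \<forall>t\<in>T. f t \<in> I t}"
    using is_idealD(2)[OF assms] by (auto intro!: exI[of _ "\<lambda>t. f t + g t"] simp: sum.distrib)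
next
  fix r a assume "a \<in> {\<Sum>t\<in>T. f t |f. \<forall>t\<in>T. f t \<in> I t}"
  then obtain f where "a = (\<Sum>t\<in>T. f t)" "\<forall>t\<in>T. f t \<in> I t" by blast
  then show "r * a \<in> {\<Sum>t\<in>T. f t |f. \<forall>t\<in>T. f t \<in> I t}"
    using is_idealD(3)[OF assms] by (auto intro!: exI[of _ "\<lambda>t. r * f t"] simp: sum_distrib_left)
qed

lemma ideal_sum_cong:
  assumes "\<And>t. t \<in> T \<Longrightarrow> I t = I' t"
  shows "ideal_sum T I = ideal_sum T I'"
proof -
  have "(\<forall>t\<in>T. f t \<in> I t) \<longleftrightarrow> (\<forall>t\<in>T. f t \<in> I' t)" for f using assms by auto
  then show ?thesis by (simp add: ideal_sum_def)
qed

lemma ideal_sum_member: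
  assumes "finite T" "t \<in> T" "x \<in> I t" "\<And>s. s \<in> T \<Longrightarrow> 0 \<in> I s"
  shows "x \<in> ideal_sum T I"
  unfolding ideal_sum_def using assms
  by (auto intro!: exI[of _ "\<lambda>s. if s = t then x else 0"])

lemma is_ideal_zero: "is_ideal {0}"
  by (simp add: is_ideal_def)

lemma is_ideal_Jfun: "is_ideal (Jfun G Gm \<alpha> \<gamma>)"
  by (auto simp: Jfun_def is_ideal_zero intro!: is_ideal_ideal_sum is_ideal_pideal)

definition normal_vec :: "'n::finite cone \<Rightarrow> real^'n" where
  "normal_vec \<tau> = (SOME a. a \<noteq> 0 \<and> span \<tau> = {x. a \<bullet> x = 0})"

lemma normal_vec:
  fixes \<tau> :: "'n::finite cone"
  assumes "dim \<tau> + 1 = CARD('n)"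
  shows "normal_vec \<tau> \<noteq> 0" "span \<tau> = {x. normal_vec \<tau> \<bullet> x = 0}"
proof -
  have "dim \<tau> = DIM(real^'n) - 1" using assms by simp
  then obtain a where "a \<noteq> 0 \<and> span \<tau> = {x. a \<bullet> x = 0}" unfolding dim_eq_hyperplane by blast
  then have "normal_vec \<tau> \<noteq> 0 \<and> span \<tau> = {x. normal_vec \<tau> \<bullet> x = 0}"
    unfolding normal_vec_def by (rule someI)
  then show "normal_vec \<tau> \<noteq> 0" "span \<tau> = {x. normal_vec \<tau> \<bullet> x = 0}" by auto
qed

lemma pideal_lform_power:
  fixes \<tau> :: "'n::finite cone"
  assumes "dim \<tau> + 1 = CARD('n)"
  shows "pideal (lform \<tau> ^ k) = pideal (lin (normal_vec \<tau>) ^ k)"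
  by (rule pideal_power_cong[OF pideal_lform[OF normal_vec(2,1)[OF assms]]])

section \<open>The relative complex of a fan with smoothness parameters\<close>

locale smooth_fan =
  fixes \<Sigma> :: "'n::finite cone set" and \<alpha> :: "'n cone \<Rightarrow> int" and i :: nat
  assumes fan: "is_fan \<Sigma>" and pure: "pure_full \<Sigma>" and her: "hereditary \<Sigma>"
    and alpha: "smoothness_params \<Sigma> \<alpha>" and i: "1 \<le> i" "i + 1 \<le> CARD('n)"
begin

definition "Sm = sigma_m1 \<Sigma> \<alpha>"
definition "X = \<Sigma> - Sm"
definition "J = Jfun \<Sigma> Sm \<alpha>"
definition "T = {\<tau>\<in>\<Sigma>. dim \<tau> + 1 = CARD('n) \<and> \<tau> \<notin> Sm}"

lemma finX: "finite X" using is_fanD(1)[OF fan] by (simp add: X_def)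

lemma X_fan: "X \<subseteq> \<Sigma>" by (auto simp: X_def)

lemma finT: "finite T" using is_fanD(1)[OF fan] by (simp add: T_def)

lemma J_ideal: "is_ideal (J \<gamma>)"
  by (simp add: J_def is_ideal_Jfun)

lemma J_nonfacet:
  assumes "\<gamma> \<in> \<Sigma>" "dim \<gamma> < CARD('n)"
  shows "J \<gamma> = ideal_sum {\<tau>\<in>T. \<gamma> \<subseteq> \<tau>} (\<lambda>\<tau>. pideal (lin (normal_vec \<tau>) ^ nat (\<alpha> \<tau> + 1)))"
proof -
  have "\<not> facet \<Sigma> \<gamma>" using facet_iff_dim[OF fan pure assms(1)] assms(2) by simp
  moreover have "{\<tau>\<in>\<Sigma>. dim \<tau> + 1 = CARD('n) \<and> \<tau> \<notin> Sm \<and> \<gamma> \<subseteq> \<tau>} = {\<tau>\<in>T. \<gamma> \<subseteq> \<tau>}"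
    by (auto simp: T_def)
  moreover have "ideal_sum {\<tau>\<in>T. \<gamma> \<subseteq> \<tau>} (\<lambda>\<tau>. pideal (lform \<tau> ^ nat (\<alpha> \<tau> + 1)))
      = ideal_sum {\<tau>\<in>T. \<gamma> \<subseteq> \<tau>} (\<lambda>\<tau>. pideal (lin (normal_vec \<tau>) ^ nat (\<alpha> \<tau> + 1)))"
    by (rule ideal_sum_cong) (simp add: T_def pideal_lform_power)
  ultimately show ?thesis by (simp add: J_def Jfun_def)
qed

lemma J_memberI:
  assumes "\<gamma> \<in> \<Sigma>" "dim \<gamma> < CARD('n)" "\<tau> \<in> T" "\<gamma> \<subseteq> \<tau>"
    "p \<in> pideal (lin (normal_vec \<tau>) ^ nat (\<alpha> \<tau> + 1))"
  shows "p \<in> J \<gamma>"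
  unfolding J_nonfacet[OF assms(1,2)]
  by (rule ideal_sum_member[where t = \<tau>])
    (use assms finT is_idealD(1)[OF is_ideal_pideal] in auto)

text \<open>Every wall \<open>\<tau>\<close> above \<open>\<gamma>\<close> has \<open>w\<close> in
  its span, so the generator belonging to it is constant along \<open>w\<close> and differentiation
  affects the coefficients only.\<close>

lemma J_dirderiv:
  assumes g: "\<gamma> \<in> \<Sigma>" and w: "w \<in> span \<gamma>" and p: "p \<in> J \<gamma>"
  shows "dirderiv w p \<in> J \<gamma>"
proof (cases "facet \<Sigma> \<gamma>")
  case True
  then have "p = 0" using p by (simp add: J_def Jfun_def)
  then show ?thesis using p by simp
next
  case False
  then have "dim \<gamma> < CARD('n)"
    using facet_iff_dim[OF fan pure g] dim_subset_UNIV[of \<gamma>] by simp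
  note J = J_nonfacet[OF g this]
  obtain f where f: "p = (\<Sum>\<tau>\<in>{\<tau>\<in>T. \<gamma> \<subseteq> \<tau>}. f \<tau>)"
    "\<forall>\<tau>\<in>{\<tau>\<in>T. \<gamma> \<subseteq> \<tau>}. f \<tau> \<in> pideal (lin (normal_vec \<tau>) ^ nat (\<alpha> \<tau> + 1))"
    using p unfolding J ideal_sum_def by blast
  have "dirderiv w (f \<tau>) \<in> pideal (lin (normal_vec \<tau>) ^ nat (\<alpha> \<tau> + 1))"
    if t: "\<tau> \<in> {\<tau>\<in>T. \<gamma> \<subseteq> \<tau>}" for \<tau>
  proof -
    let ?l = "lin (normal_vec \<tau>) ^ nat (\<alpha> \<tau> + 1)"
    have "f \<tau> \<in> pideal ?l" using f(2) t by blast
    then obtain c where c: "f \<tau> = c * ?l" unfolding pideal_def by blast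
    have "w \<in> span \<tau>" using w t span_mono[of \<gamma> \<tau>] by blast
    then have "normal_vec \<tau> \<bullet> w = 0" using normal_vec(2)[of \<tau>] t by (auto simp: T_def)
    then have "dirderiv w (f \<tau>) = dirderiv w c * ?l"
      by (simp add: c dirderiv_mult dirderiv_lin_power_eq_0)
    then show ?thesis by (simp add: pideal_def)
  qed
  then show ?thesis unfolding J ideal_sum_def f(1) dirderiv_sum by blast
qed

lemma Sm_down:
  assumes "\<gamma> \<in> Sm" "\<gamma>' \<in> \<Sigma>" "\<gamma>' \<subseteq> \<gamma>"
  shows "\<gamma>' \<in> Sm"
proof -
  obtain \<tau> \<tau>' where t: "boundary_nface \<Sigma> \<tau>" "\<gamma> \<subseteq> \<tau>" "\<tau>' \<in> \<Sigma>" "dim \<tau>' + 1 = CARD('n)" "\<alpha> \<tau>' = -1" "\<gamma> \<subseteq> \<tau>'"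
    using assms(1) unfolding Sm_def sigma_m1_def fan_boundary_def by auto
  then have "\<gamma>' \<in> fan_boundary \<Sigma>" "\<gamma>' \<subseteq> \<tau>'" using assms unfolding fan_boundary_def by blast+
  then show ?thesis using t unfolding Sm_def sigma_m1_def by blast
qed

lemma X_up: "\<gamma>' \<in> X \<Longrightarrow> \<gamma> \<in> \<Sigma> \<Longrightarrow> \<gamma>' \<subseteq> \<gamma> \<Longrightarrow> \<gamma> \<in> X"
  using Sm_down by (auto simp: X_def)

section \<open>Classes of cells belonging to a subspace\<close>

definition wclass :: "(real^'n) set \<Rightarrow> 'n cone \<Rightarrow> 'n cone set" where
  "wclass W \<sigma> = sigma_W \<Sigma> W \<sigma> - sigma_m1_W \<Sigma> \<alpha> W \<sigma>"

text \<open>Of the two parts that are removed, one leaves the cells whose span contains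
  \<open>W\<close>, the other leaves cells of \<open>X\<close>. A class can thus be treated as a set
  of cells of the whole relative complex.\<close>

lemma wclass_iff:
  "\<gamma> \<in> wclass W \<sigma> \<longleftrightarrow> \<gamma> \<in> X \<and> W \<subseteq> span \<gamma> \<and> (\<exists>\<sigma>'. (W_adj \<Sigma> W)\<^sup>*\<^sup>* \<sigma> \<sigma>' \<and> facet \<Sigma> \<sigma>' \<and> \<gamma> \<subseteq> \<sigma>')"
  by (auto simp: wclass_def sigma_W_def sigma_m1_W_def sigma_c_def X_def Sm_def)

text \<open>The facets in a chain given by heredity all contain \<open>\<gamma>\<close>, so each
  wall crossed contains \<open>\<gamma>\<close> and its span contains \<open>W\<close>.\<close>

lemma star_connected:
  assumes g: "\<gamma> \<in> \<Sigma>" and W: "W \<subseteq> span \<gamma>"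
    and s: "facet \<Sigma> \<sigma>" "\<gamma> \<subseteq> \<sigma>" "facet \<Sigma> \<sigma>'" "\<gamma> \<subseteq> \<sigma>'"
  shows "(W_adj \<Sigma> W)\<^sup>*\<^sup>* \<sigma> \<sigma>'"
proof -
  let ?R = "\<lambda>s s'. facet \<Sigma> s \<and> \<gamma> \<subseteq> s \<and> facet \<Sigma> s' \<and> \<gamma> \<subseteq> s' \<and> dim (s \<inter> s') + 1 = CARD('n)"
  have "?R\<^sup>*\<^sup>* \<sigma> \<sigma>'" using her g s unfolding hereditary_def by blast
  moreover have "?R s s' \<longrightarrow> W_adj \<Sigma> W s s'" for s s'
    using fan_Int_mem[OF fan, of s s'] W span_mono[of \<gamma> "s \<inter> s'"]
    unfolding W_adj_def facet_def by blast
  ultimately show ?thesis using mono_rtranclp[of ?R "W_adj \<Sigma> W"] by blast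
qed

lemma W_adj_sym: "(W_adj \<Sigma> W)\<^sup>*\<^sup>* s s' \<Longrightarrow> (W_adj \<Sigma> W)\<^sup>*\<^sup>* s' s"
proof -
  have "symp (W_adj \<Sigma> W)" by (auto simp: symp_def W_adj_def Int_commute)
  then show "(W_adj \<Sigma> W)\<^sup>*\<^sup>* s s' \<Longrightarrow> (W_adj \<Sigma> W)\<^sup>*\<^sup>* s' s"
    using symp_rtranclp by (metis sympD)
qed

lemma wclass_X: "wclass W \<sigma> \<subseteq> X" by (auto simp: wclass_iff)

lemma wclass_span: "\<gamma> \<in> wclass W \<sigma> \<Longrightarrow> W \<subseteq> span \<gamma>" by (simp add: wclass_iff)

lemma wclass_fin: "finite (wclass W \<sigma>)" using finX wclass_X finite_subset by blast

lemma wclass_fan: "\<gamma> \<in> wclass W \<sigma> \<Longrightarrow> \<gamma> \<in> \<Sigma>" using wclass_X X_fan by blast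

text \<open>A facet above the larger cell lies in the star of the smaller one and is reached without
  leaving the adjacency class.\<close>

lemma wclass_up:
  assumes g: "\<gamma>' \<in> wclass W \<sigma>" and "\<gamma> \<in> X" "\<gamma>' \<subseteq> \<gamma>"
  shows "\<gamma> \<in> wclass W \<sigma>"
proof -
  obtain \<sigma>1 where s1: "(W_adj \<Sigma> W)\<^sup>*\<^sup>* \<sigma> \<sigma>1" "facet \<Sigma> \<sigma>1" "\<gamma>' \<subseteq> \<sigma>1"
    using g by (auto simp: wclass_iff)
  obtain \<sigma>2 where s2: "facet \<Sigma> \<sigma>2" "\<gamma> \<subseteq> \<sigma>2"
    using fan_facet_exists[OF fan] assms(2) X_fan by blast
  have "(W_adj \<Sigma> W)\<^sup>*\<^sup>* \<sigma>1 \<sigma>2"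
    using star_connected[OF wclass_fan[OF g] wclass_span[OF g] s1(2,3) s2(1)] s2(2) assms(3) by blast
  then have "(W_adj \<Sigma> W)\<^sup>*\<^sup>* \<sigma> \<sigma>2" using s1(1) by simp
  then show ?thesis
    using assms s2 wclass_span[OF g] span_mono[of \<gamma>' \<gamma>] by (auto simp: wclass_iff)
qed

lemma wclass_upclosed: "\<forall>\<gamma>'\<in>wclass W \<sigma>. \<forall>\<gamma>\<in>X. \<gamma>' \<subseteq> \<gamma> \<longrightarrow> \<gamma> \<in> wclass W \<sigma>"
  using wclass_up by blast

lemma wclass_cover:
  assumes "\<gamma> \<in> X" "W \<subseteq> span \<gamma>"
  shows "\<exists>\<sigma>. facet \<Sigma> \<sigma> \<and> \<gamma> \<in> wclass W \<sigma>"
proof -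
  obtain \<sigma> where "facet \<Sigma> \<sigma>" "\<gamma> \<subseteq> \<sigma>"
    using fan_facet_exists[OF fan] assms(1) X_fan by blast
  then show ?thesis using assms by (auto simp: wclass_iff intro!: exI[of _ \<sigma>])
qed

text \<open>Together with \<open>wclass_cover\<close> this shows that the classes partition the
  cells of \<open>X\<close> whose span contains \<open>W\<close>.\<close>

lemma wclass_disjoint:
  assumes g: "\<gamma> \<in> wclass W \<sigma>" "\<gamma> \<in> wclass W \<sigma>'"
  shows "wclass W \<sigma> = wclass W \<sigma>'"
proof -
  obtain \<sigma>1 \<sigma>2 where s: "(W_adj \<Sigma> W)\<^sup>*\<^sup>* \<sigma> \<sigma>1" "facet \<Sigma> \<sigma>1" "\<gamma> \<subseteq> \<sigma>1"
    "(W_adj \<Sigma> W)\<^sup>*\<^sup>* \<sigma>' \<sigma>2" "facet \<Sigma> \<sigma>2" "\<gamma> \<subseteq> \<sigma>2"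
    using g by (auto simp: wclass_iff)
  have "(W_adj \<Sigma> W)\<^sup>*\<^sup>* \<sigma>1 \<sigma>2"
    using star_connected[OF wclass_fan[OF g(1)] wclass_span[OF g(1)]] s by blast
  then have a: "(W_adj \<Sigma> W)\<^sup>*\<^sup>* \<sigma> \<sigma>'" using s(1,4) W_adj_sym by (meson rtranclp_trans)
  then have "(W_adj \<Sigma> W)\<^sup>*\<^sup>* \<sigma> \<rho> \<longleftrightarrow> (W_adj \<Sigma> W)\<^sup>*\<^sup>* \<sigma>' \<rho>" for \<rho>
    using W_adj_sym by (meson rtranclp_trans)
  then show ?thesis by (auto simp: wclass_iff)
qed

lemma bounds_dirderiv:
  assumes K: "K \<subseteq> X" and w: "\<And>\<gamma>. \<gamma> \<in> K \<Longrightarrow> w \<in> span \<gamma>" and x: "x \<in> bounds K {} J i"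
  shows "(\<lambda>\<gamma>. dirderiv w (x \<gamma>)) \<in> bounds K {} J i"
proof -
  obtain b j where bj: "b \<in> chains K {} (i + 1)" "j \<in> chains K {} i"
      "\<forall>\<gamma>. j \<gamma> \<in> J \<gamma>" "\<forall>\<gamma>. x \<gamma> = bd K {} (i + 1) b \<gamma> + j \<gamma>"
    using x unfolding bounds_iff by blast
  show ?thesis
  proof (rule boundsI[of "\<lambda>\<gamma>. dirderiv w (b \<gamma>)" _ _ _ "\<lambda>\<gamma>. dirderiv w (j \<gamma>)"])
    show "(\<lambda>\<gamma>. dirderiv w (b \<gamma>)) \<in> chains K {} (i + 1)" "(\<lambda>\<gamma>. dirderiv w (j \<gamma>)) \<in> chains K {} i"
      using bj(1,2) by (auto simp: chains_def)
    show "dirderiv w (j \<gamma>) \<in> J \<gamma>" for \<gamma>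
    proof (cases "\<gamma> \<in> K")
      case True
      then show ?thesis using J_dirderiv[of \<gamma> w "j \<gamma>"] K X_fan w bj(3) by blast
    next
      case False
      then have "j \<gamma> = 0" using chainsD[OF bj(2)] by blast
      then show ?thesis using is_idealD(1)[OF J_ideal] by simp
    qed
    show "dirderiv w (x \<gamma>) = bd K {} (i + 1) (\<lambda>\<gamma>. dirderiv w (b \<gamma>)) \<gamma> + dirderiv w (j \<gamma>)" for \<gamma>
      using bj(4) by (simp add: dirderiv_add bd_dirderiv)
  qed
qed

lemma bounds_restr:
  assumes K: "K \<subseteq> X" and up: "\<forall>\<gamma>'\<in>K. \<forall>\<gamma>\<in>X. \<gamma>' \<subseteq> \<gamma> \<longrightarrow> \<gamma> \<in> K"
    and x: "x \<in> bounds X {} J i"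
  shows "restr K x \<in> bounds K {} J i"
proof -
  obtain b j where bj: "b \<in> chains X {} (i + 1)" "j \<in> chains X {} i"
      "\<forall>\<gamma>. j \<gamma> \<in> J \<gamma>" "\<forall>\<gamma>. x \<gamma> = bd X {} (i + 1) b \<gamma> + j \<gamma>"
    using x unfolding bounds_iff by blast
  show ?thesis
  proof (rule boundsI[of "restr K b" _ _ _ "restr K j"])
    show "restr K b \<in> chains K {} (i + 1)" "restr K j \<in> chains K {} i"
      using chainsD[OF bj(1)] chainsD[OF bj(2)] by (auto intro!: chainsI split: if_splits)
    show "restr K j \<gamma> \<in> J \<gamma>" for \<gamma> using bj(3) is_idealD(1)[OF J_ideal] by simp
    show "restr K x \<gamma> = bd K {} (i + 1) (restr K b) \<gamma> + restr K j \<gamma>" for \<gamma>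
    proof (cases "\<gamma> \<in> K")
      case True
      then show ?thesis using bd_restr[OF finX K up True, of "i + 1" b] bj(4) by simp
    next
      case False
      then show ?thesis by (simp add: bd_def cells_def)
    qed
  qed
qed

end

text \<open>Such a vector \<open>a\<close> lies in the span of \<open>N\<close>: its component
  orthogonal to \<open>N\<close> is in the common kernel, hence orthogonal to \<open>a\<close> and
  so to itself.\<close>

lemma linear_forms_in_ideal:
  fixes N :: "(real^'n::finite) set"
  assumes I: "is_ideal I" and N: "\<And>b. b \<in> N \<Longrightarrow> lin b \<in> I" and a: "\<And>x. (\<And>b. b \<in> N \<Longrightarrow> b \<bullet> x = 0) \<Longrightarrow> a \<bullet> x = 0"
  shows "lin a \<in> I"
proof -
  have "subspace {b. lin b \<in> I}"
  proof -
    have "lin 0 = (0 :: 'n spoly)" by (rule peval_eqI) simp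
    moreover have "lin (x + y) = lin x + lin y" for x y :: "real^'n"
      by (rule peval_eqI) (simp add: inner_add_left)
    moreover have "lin (c *\<^sub>R x) = Const c * lin x" for c and x :: "real^'n"
      by (rule peval_eqI) simp
    ultimately show ?thesis using is_idealD[OF I] by (simp add: subspace_def)
  qed
  then have sp: "span N \<subseteq> {b. lin b \<in> I}" using N by (intro span_minimal) auto
  obtain y z where yz: "y \<in> span N" "\<And>w. w \<in> span N \<Longrightarrow> orthogonal z w" "a = y + z"
    using orthogonal_subspace_decomp_exists[of N a] by blast
  have "b \<bullet> z = 0" if "b \<in> N" for b
    using yz(2)[OF span_base[OF that]] by (simp add: orthogonal_def inner_commute)
  then have "a \<bullet> z = 0" by (rule a)
  moreover have "y \<bullet> z = 0" using yz(2)[OF yz(1)] by (simp add: orthogonal_def inner_commute)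
  ultimately have "z = 0" using yz(3) by (simp add: inner_add_left)
  then show ?thesis using yz sp by auto
qed

context smooth_fan
begin

section \<open>Comparison of the whole complex with its classes\<close>

lemma is_submodule_bounds_J: "is_submodule (bounds K {} J i)"
  by (rule is_submodule_bounds[OF J_ideal])

text \<open>A boundary in a class, computed in \<open>X\<close>, may acquire components outside the
  class. These occur only at cells whose span does not contain \<open>W\<close>, and the factor
  \<open>h\<close> moves them into the ideals.\<close>

lemma bounds_extend:
  assumes x: "x \<in> bounds (wclass W \<sigma>) {} J i"
    and h: "\<And>\<gamma>. \<gamma> \<in> X \<Longrightarrow> dim \<gamma> = i \<Longrightarrow> \<not> W \<subseteq> span \<gamma> \<Longrightarrow> h \<in> J \<gamma>"
  shows "(\<lambda>\<gamma>. h * x \<gamma>) \<in> bounds X {} J i"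
proof -
  let ?K = "wclass W \<sigma>"
  obtain b j where bj: "b \<in> chains ?K {} (i + 1)" "j \<in> chains ?K {} i"
      "\<forall>\<gamma>. j \<gamma> \<in> J \<gamma>" "\<forall>\<gamma>. x \<gamma> = bd ?K {} (i + 1) b \<gamma> + j \<gamma>"
    using x unfolding bounds_iff by blast
  define k where "k \<gamma> = h * x \<gamma> - h * bd X {} (i + 1) b \<gamma>" for \<gamma>
  have b_restr: "restr ?K b = b" using chainsD[OF bj(1)] by (auto simp: fun_eq_iff)
  have k_in: "k \<gamma> = h * j \<gamma>" if "\<gamma> \<in> ?K" for \<gamma>
    using bd_restr[OF finX wclass_X wclass_upclosed that, of "i + 1" b] bj(4)
    by (simp add: k_def b_restr distrib_left)
  have x_out: "x \<gamma> = 0" if "\<gamma> \<notin> ?K" for \<gamma>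
    using that bj(4) chainsD[OF bj(2), of \<gamma>] by (auto simp: bd_def cells_def)
  \<comment> \<open>Such a cell belongs to a different class, and so do all cells of
    \<open>X\<close> above it, where \<open>b\<close> vanishes.\<close>
  have bd0: "bd X {} (i + 1) b \<gamma> = 0" if g: "\<gamma> \<notin> ?K" "\<gamma> \<in> X" "W \<subseteq> span \<gamma>" for \<gamma>
  proof -
    obtain \<sigma>' where s: "\<gamma> \<in> wclass W \<sigma>'" using wclass_cover[OF g(2,3)] by blast
    have "b \<eta> = 0" if "\<eta> \<in> X" "\<gamma> \<subseteq> \<eta>" for \<eta>
    proof (rule ccontr)
      assume "b \<eta> \<noteq> 0"
      then have "\<eta> \<in> ?K" using chainsD[OF bj(1)] by blast
      moreover have "\<eta> \<in> wclass W \<sigma>'" by (rule wclass_up[OF s that])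
      ultimately show False using wclass_disjoint s g(1) by blast
    qed
    then show ?thesis by (auto simp: bd_def cells_def intro!: sum.neutral)
  qed
  show ?thesis
  proof (rule boundsI[of "\<lambda>\<gamma>. h * b \<gamma>" _ _ _ k])
    show "(\<lambda>\<gamma>. h * b \<gamma>) \<in> chains X {} (i + 1)"
    proof (rule chainsI)
      fix \<gamma> assume "h * b \<gamma> \<noteq> 0"
      then have "b \<gamma> \<noteq> 0" by auto
      then show "\<gamma> \<in> X \<and> dim \<gamma> = i + 1" using chainsD[OF bj(1)] wclass_X by blast
    qed
    have kc: "\<gamma> \<in> X \<and> dim \<gamma> = i" if k: "k \<gamma> \<noteq> 0" for \<gamma>
    proof (cases "\<gamma> \<in> ?K")
      case True
      then have "j \<gamma> \<noteq> 0" using k k_in by auto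
      then show ?thesis using chainsD[OF bj(2)] wclass_X by blast
    next
      case False
      then have "bd X {} (i + 1) b \<gamma> \<noteq> 0" using k x_out by (auto simp: k_def)
      then show ?thesis using bd_cells[of X "{}" "i + 1" b \<gamma>] by (simp add: cells_def)
    qed
    then show "k \<in> chains X {} i" by (rule chainsI)
    show "k \<gamma> \<in> J \<gamma>" for \<gamma>
    proof (cases "k \<gamma> = 0")
      case True
      then show ?thesis using is_idealD(1)[OF J_ideal] by simp
    next
      case False
      note kX = kc[OF False]
      show ?thesis
      proof (cases "\<gamma> \<in> ?K")
        case True
        then show ?thesis using k_in bj(3) is_idealD(3)[OF J_ideal] by simp
      next
        case out: False
        have "\<not> W \<subseteq> span \<gamma>"
        proof
          assume "W \<subseteq> span \<gamma>"
          then have "k \<gamma> = 0" using bd0[OF out] kX x_out[OF out] by (simp add: k_def)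
          then show False using False by simp
        qed
        then have "h \<in> J \<gamma>" using h kX by blast
        moreover have "k \<gamma> = h * (x \<gamma> - bd X {} (i + 1) b \<gamma>)" by (simp add: k_def right_diff_distrib)
        ultimately show ?thesis using is_idealD(4)[OF J_ideal] by simp
      qed
    qed
    show "h * x \<gamma> = bd X {} (i + 1) (\<lambda>\<gamma>. h * b \<gamma>) \<gamma> + k \<gamma>" for \<gamma>
      by (simp add: bd_scale k_def)
  qed
qed

text \<open>\<open>P\<close> annihilates every component of \<open>z\<close>. If each component had
  an annihilator outside \<open>P\<close>, the product of these elements would kill all components
  and \<open>h\<close> would kill what is left of \<open>z\<close>; then \<open>P\<close> would
  contain a product of elements outside \<open>P\<close>.\<close>

lemma localize_to_class:
  assumes P: "prime_ideal P" and Pz: "P = quot_ann (bounds X {} J i) z" and z: "z \<in> chains X {} i"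
    and h: "\<And>\<gamma>. \<gamma> \<in> X \<Longrightarrow> dim \<gamma> = i \<Longrightarrow> \<not> W \<subseteq> span \<gamma> \<Longrightarrow> h \<in> J \<gamma>" and hP: "h \<notin> P"
  shows "\<exists>\<sigma>. facet \<Sigma> \<sigma> \<and> P = quot_ann (bounds (wclass W \<sigma>) {} J i) (restr (wclass W \<sigma>) z)"
proof -
  \<comment> \<open>Indexing by classes, not by facets, counts each component of \<open>z\<close>
    once although many facets give the same class.\<close>
  define KK where "KK = wclass W ` {\<sigma>. facet \<Sigma> \<sigma>}"
  have "finite {\<sigma>. facet \<Sigma> \<sigma>}"
    using is_fanD(1)[OF fan] by (rule finite_subset[rotated]) (auto simp: facet_def)
  then have finKK: "finite KK" by (simp add: KK_def)
  let ?A = "\<lambda>K. quot_ann (bounds K {} J i) (restr K z)"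
  have PA: "P \<subseteq> ?A K" if K: "K \<in> KK" for K
  proof
    fix f assume "f \<in> P"
    then have "(\<lambda>\<gamma>. f * z \<gamma>) \<in> bounds X {} J i" by (simp add: Pz quot_ann_def)
    moreover obtain \<sigma> where "K = wclass W \<sigma>" using K by (auto simp: KK_def)
    ultimately have "restr K (\<lambda>\<gamma>. f * z \<gamma>) \<in> bounds K {} J i"
      using bounds_restr[OF wclass_X wclass_upclosed] by blast
    moreover have "restr K (\<lambda>\<gamma>. f * z \<gamma>) = (\<lambda>\<gamma>. f * restr K z \<gamma>)" by auto
    ultimately show "f \<in> ?A K" by (simp add: quot_ann_def)
  qed
  have "\<exists>K\<in>KK. ?A K \<subseteq> P"
  proof (rule ccontr)
    assume "\<not> (\<exists>K\<in>KK. ?A K \<subseteq> P)"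
    then have "\<forall>K\<in>KK. \<exists>f. f \<in> ?A K \<and> f \<notin> P" by blast
    from bchoice[OF this] obtain f where "\<forall>K\<in>KK. f K \<in> ?A K \<and> f K \<notin> P" ..
    then have f: "f K \<in> ?A K" "f K \<notin> P" if "K \<in> KK" for K using that by auto
    define F where "F = (\<Prod>K\<in>KK. f K)"
    have FP: "F \<notin> P" unfolding F_def using prime_ideal_prod[OF P finKK, of f] f(2) by blast
    have FA: "F \<in> ?A K" if K: "K \<in> KK" for K
    proof -
      have "F = f K * (\<Prod>K\<in>KK - {K}. f K)" unfolding F_def using finKK K by (rule prod.remove)
      then show ?thesis
        using is_idealD(4)[OF is_ideal_quot_ann[OF is_submodule_bounds_J]] f(1)[OF K] by simp
    qed
    have 1: "(\<lambda>\<gamma>. h * (F * restr K z \<gamma>)) \<in> bounds X {} J i" if K: "K \<in> KK" for K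
    proof -
      obtain \<sigma> where K': "K = wclass W \<sigma>" using K by (auto simp: KK_def)
      have "(\<lambda>\<gamma>. F * restr K z \<gamma>) \<in> bounds K {} J i" using FA[OF K] by (simp add: quot_ann_def)
      then show ?thesis unfolding K' by (rule bounds_extend[OF _ h])
    qed
    have 2: "(\<lambda>\<gamma>. \<Sum>K\<in>KK. h * (F * restr K z \<gamma>)) \<in> bounds X {} J i"
      by (rule is_submodule_sum[OF is_submodule_bounds_J 1])
    \<comment> \<open>This is the part of the chain on cells in no class, that is, on cells whose
      span does not contain \<open>W\<close>.\<close>
    define r where "r \<gamma> = (if \<gamma> \<in> \<Union>KK then 0 else h * (F * z \<gamma>))" for \<gamma>
    have 3: "r \<in> bounds X {} J i"
    proof (rule boundsI[of "\<lambda>_. 0" _ _ _ r])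
      show "(\<lambda>_. 0) \<in> chains X {} (i + 1)" by (simp add: chains_def)
      have r: "\<gamma> \<in> X \<and> dim \<gamma> = i \<and> \<gamma> \<notin> \<Union>KK" if "r \<gamma> \<noteq> 0" for \<gamma>
        using that chainsD[OF z, of \<gamma>] by (cases "z \<gamma> = 0") (auto simp: r_def split: if_splits)
      then show "r \<in> chains X {} i" by (intro chainsI) blast
      show "r \<gamma> \<in> J \<gamma>" for \<gamma>
      proof (cases "r \<gamma> = 0")
        case True
        then show ?thesis using is_idealD(1)[OF J_ideal] by simp
      next
        case False
        note rg = r[OF False]
        have "\<not> W \<subseteq> span \<gamma>" using wclass_cover[of \<gamma> W] rg by (auto simp: KK_def)
        then have "h \<in> J \<gamma>" using h rg by blast
        moreover have "r \<gamma> = h * (F * z \<gamma>)" using rg by (simp add: r_def)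
        ultimately show ?thesis using is_idealD(4)[OF J_ideal] by simp
      qed
      show "r \<gamma> = bd X {} (i + 1) (\<lambda>_. 0) \<gamma> + r \<gamma>" for \<gamma> by (simp add: bd_zero)
    qed
    have "(\<Sum>K\<in>KK. h * (F * restr K z \<gamma>)) + r \<gamma> = h * F * z \<gamma>" for \<gamma>
    proof (cases "\<gamma> \<in> \<Union>KK")
      case True
      then obtain K where K: "K \<in> KK" "\<gamma> \<in> K" by blast
      have uniq: "\<gamma> \<notin> K'" if "K' \<in> KK" "K' \<noteq> K" for K'
        using that K wclass_disjoint unfolding KK_def by blast
      have "(\<Sum>K'\<in>KK. h * (F * restr K' z \<gamma>)) = (\<Sum>K'\<in>KK. if K' = K then h * (F * z \<gamma>) else 0)"
        using uniq K by (intro sum.cong) auto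
      then show ?thesis using True finKK K by (simp add: r_def mult.assoc)
    next
      case False
      then have "(\<Sum>K'\<in>KK. h * (F * restr K' z \<gamma>)) = 0" by (intro sum.neutral) auto
      then show ?thesis using False by (simp add: r_def mult.assoc)
    qed
    then have "(\<lambda>\<gamma>. h * F * z \<gamma>) \<in> bounds X {} J i"
      using is_submoduleD(2)[OF is_submodule_bounds_J 2 3] by simp
    then have "h * F \<in> P" by (simp add: Pz quot_ann_def)
    then show False using prime_ideal_mult[OF P] hP FP by blast
  qed
  then obtain K where "K \<in> KK" "?A K \<subseteq> P" by blast
  then show ?thesis using PA[of K] unfolding KK_def by blast
qed

text \<open>If \<open>dim W \<ge> i\<close>, every \<open>i\<close>-cell \<open>\<gamma>\<close> of the class spans \<open>W\<close>, so \<open>\<gamma>\<close> is the only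
  \<open>i\<close>-cell of the class below any \<open>(i+1)\<close>-cell \<open>\<delta> \<supset> \<gamma>\<close> and is the boundary of \<open>\<delta>\<close>.\<close>

lemma chain_in_bounds_high_dim:
  assumes W: "subspace W" "i \<le> dim W" and z: "z \<in> chains (wclass W \<sigma>) {} i"
  shows "z \<in> bounds (wclass W \<sigma>) {} J i"
proof -
  let ?K = "wclass W \<sigma>"
  have sp: "span \<gamma> = W" if "\<gamma> \<in> ?K" "dim \<gamma> = i" for \<gamma>
    using subspace_dim_equal[OF W(1) subspace_span wclass_span[OF that(1)]] W(2) that(2)
    by (simp add: dim_span)
  have pt: "point_chain \<gamma> f \<in> bounds ?K {} J i" if g: "\<gamma> \<in> ?K" "dim \<gamma> = i" for \<gamma> f
  proof -
    obtain s where s: "facet \<Sigma> s" "\<gamma> \<subseteq> s" using fan_facet_exists[OF fan wclass_fan[OF g(1)]] by blast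
    have "dim s = CARD('n)" "s \<in> \<Sigma>" using s pure by (auto simp: pure_full_def facet_def)
    then obtain \<delta> where d: "\<delta> \<in> \<Sigma>" "\<gamma> \<subseteq> \<delta>" "dim \<delta> = i + 1"
      using fan_intermediate_face[OF fan wclass_fan[OF g(1)], of s "i + 1"] s g i by auto
    have dK: "\<delta> \<in> ?K" using wclass_up[OF g(1) _ d(2)] X_up[OF _ d(1,2)] g(1) wclass_X by blast
    have only: "\<gamma>' = \<gamma>" if "\<gamma>' \<in> ?K" "dim \<gamma>' = i" "\<gamma>' \<subseteq> \<delta>" for \<gamma>'
      using fan_subset_Int_span[OF fan wclass_fan[OF that(1)] d(1) that(3)]
        fan_subset_Int_span[OF fan wclass_fan[OF g(1)] d(1,2)] sp[OF g] sp[OF that(1,2)] by simp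
    show ?thesis
    proof (rule boundsI[of "point_chain \<delta> (of_int (incidence \<delta> \<gamma>) * f)" _ _ _ "\<lambda>_. 0"])
      show "point_chain \<delta> (of_int (incidence \<delta> \<gamma>) * f) \<in> chains ?K {} (i + 1)"
        using dK d by (auto intro!: chainsI split: if_splits)
      show "(\<lambda>_. 0) \<in> chains ?K {} i" by (simp add: chains_def)
      show "0 \<in> J \<gamma>'" for \<gamma>' by (rule is_idealD(1)[OF J_ideal])
      show "point_chain \<gamma> f \<gamma>' = bd ?K {} (i + 1) (point_chain \<delta> (of_int (incidence \<delta> \<gamma>) * f)) \<gamma>' + 0" for \<gamma>'
      proof (cases "\<gamma>' = \<gamma>")
        case True
        then show ?thesis
          unfolding bd_point_chain[OF wclass_fin dK d(3)]
          using g d(2) of_int_incidence_square[of \<delta> \<gamma> f] by simp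
      next
        case False
        then have "\<not> (\<gamma>' \<in> ?K \<and> dim \<gamma>' = i \<and> \<gamma>' \<subseteq> \<delta>)" using only by blast
        then show ?thesis
          unfolding bd_point_chain[OF wclass_fin dK d(3)] using False by auto
      qed
    qed
  qed
  have "(\<lambda>\<gamma>. \<Sum>\<delta>\<in>{\<delta>\<in>?K. dim \<delta> = i}. point_chain \<delta> (z \<delta>) \<gamma>) \<in> bounds ?K {} J i"
    by (rule is_submodule_sum[OF is_submodule_bounds_J]) (use pt in auto)
  then show ?thesis using point_chain_sum[OF wclass_fin z] by simp
qed

text \<open>If \<open>dim W = i - 1\<close>, the ideal part of the class complex is onto in degree \<open>i - 1\<close>, so a cycle
  modulo the ideals can be corrected to a cycle with constant coefficients.\<close>

lemma chain_in_bounds_next_dim: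
  assumes W: "subspace W" "dim W + 1 = i" and z: "z \<in> chains (wclass W \<sigma>) {} i"
    and bz: "\<And>\<gamma>. bd (wclass W \<sigma>) {} i z \<gamma> \<in> J \<gamma>"
    and H: "cycles (wclass W \<sigma>) {} (\<lambda>_. {0}) i \<subseteq> bounds (wclass W \<sigma>) {} (\<lambda>_. {0}) i"
  shows "z \<in> bounds (wclass W \<sigma>) {} J i"
proof -
  let ?K = "wclass W \<sigma>"
  \<comment> \<open>The image of the ideal part in degree \<open>i - 1\<close>; the aim is to show
    that the boundary of \<open>z\<close> lies in it.\<close>
  define Q where "Q = {bd ?K {} i j | j. j \<in> chains ?K {} i \<and> (\<forall>\<gamma>. j \<gamma> \<in> J \<gamma>)}"
  have QI: "y \<in> Q" if "j \<in> chains ?K {} i" "\<And>\<gamma>. j \<gamma> \<in> J \<gamma>" "\<And>\<gamma>. y \<gamma> = bd ?K {} i j \<gamma>" for y j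
    using that unfolding Q_def by auto
  have Q0: "(\<lambda>_. 0) \<in> Q"
    by (rule QI[of "\<lambda>_. 0"]) (auto simp: chains_def bd_zero is_idealD(1)[OF J_ideal])
  have Qadd: "(\<lambda>\<gamma>. x \<gamma> + y \<gamma>) \<in> Q" if "x \<in> Q" "y \<in> Q" for x y
  proof -
    obtain j k where jk: "x = bd ?K {} i j" "j \<in> chains ?K {} i" "\<forall>\<gamma>. j \<gamma> \<in> J \<gamma>"
      "y = bd ?K {} i k" "k \<in> chains ?K {} i" "\<forall>\<gamma>. k \<gamma> \<in> J \<gamma>"
      using \<open>x \<in> Q\<close> \<open>y \<in> Q\<close> unfolding Q_def by blast
    show ?thesis
      by (rule QI[of "\<lambda>\<gamma>. j \<gamma> + k \<gamma>"])
        (use jk is_idealD(2)[OF J_ideal] in \<open>auto simp: bd_add chains_def\<close>)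
  qed
  have Qsum: "(\<lambda>\<gamma>. \<Sum>a\<in>A. x a \<gamma>) \<in> Q" if "\<And>a. a \<in> A \<Longrightarrow> x a \<in> Q" for A and x :: "'b \<Rightarrow> _"
    using that by (induct A rule: infinite_finite_induct) (auto simp: Q0 intro!: Qadd)
  have sp: "span \<gamma> = W" if "\<gamma> \<in> ?K" "dim \<gamma> = i - 1" for \<gamma>
    using subspace_dim_equal[OF W(1) subspace_span wclass_span[OF that(1)]] W(2) that(2)
    by (simp add: dim_span)
  have pt: "point_chain \<gamma> f \<in> Q" if g: "\<gamma> \<in> ?K" "dim \<gamma> = i - 1" and f: "f \<in> J \<gamma>" for \<gamma> f
  proof -
    let ?T = "{\<tau>\<in>T. \<gamma> \<subseteq> \<tau>}"
    have g\<Sigma>: "\<gamma> \<in> \<Sigma>" by (rule wclass_fan[OF g(1)])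
    have "dim \<gamma> < CARD('n)" using g i by simp
    then obtain k where k: "f = (\<Sum>\<tau>\<in>?T. k \<tau>)"
      "\<forall>\<tau>\<in>?T. k \<tau> \<in> pideal (lin (normal_vec \<tau>) ^ nat (\<alpha> \<tau> + 1))"
      using f unfolding J_nonfacet[OF g\<Sigma> \<open>dim \<gamma> < CARD('n)\<close>] ideal_sum_def by blast
    have "point_chain \<gamma> (k \<tau>) \<in> Q" if t: "\<tau> \<in> ?T" for \<tau>
    proof -
      have t': "\<tau> \<in> \<Sigma>" "dim \<tau> + 1 = CARD('n)" "\<gamma> \<subseteq> \<tau>" "\<tau> \<in> T" using t by (auto simp: T_def)
      \<comment> \<open>The cell has to lie below \<open>\<tau>\<close> so that the summand
        \<open>k \<tau>\<close>, taken from the ideal of this wall, also belongs to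
        \<open>J \<delta>\<close>.\<close>
      obtain \<delta> where d: "\<delta> \<in> \<Sigma>" "\<gamma> \<subseteq> \<delta>" "\<delta> \<subseteq> \<tau>" "dim \<delta> = i"
        using fan_intermediate_face[OF fan g\<Sigma> t'(1,3), of i] g t' i by auto
      have dK: "\<delta> \<in> ?K" using wclass_up[OF g(1) _ d(2)] X_up[OF _ d(1,2)] g(1) wclass_X by blast
      have only: "\<gamma>' = \<gamma>" if "\<gamma>' \<in> ?K" "dim \<gamma>' = i - 1" "\<gamma>' \<subseteq> \<delta>" for \<gamma>'
        using fan_subset_Int_span[OF fan wclass_fan[OF that(1)] d(1) that(3)]
          fan_subset_Int_span[OF fan g\<Sigma> d(1,2)] sp[OF g] sp[OF that(1,2)] by simp
      have "dim \<delta> < CARD('n)" using d i by simp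
      then have kJ: "k \<tau> \<in> J \<delta>" using J_memberI[OF d(1) _ t'(4) d(3)] k(2) t by blast
      show ?thesis
      proof (rule QI[of "point_chain \<delta> (of_int (incidence \<delta> \<gamma>) * k \<tau>)"])
        show "point_chain \<delta> (of_int (incidence \<delta> \<gamma>) * k \<tau>) \<in> chains ?K {} i"
          using dK d by (auto intro!: chainsI split: if_splits)
        show "point_chain \<delta> (of_int (incidence \<delta> \<gamma>) * k \<tau>) \<gamma>' \<in> J \<gamma>'" for \<gamma>'
          using kJ is_idealD(1,3)[OF J_ideal] by simp
        show "point_chain \<gamma> (k \<tau>) \<gamma>' = bd ?K {} i (point_chain \<delta> (of_int (incidence \<delta> \<gamma>) * k \<tau>)) \<gamma>'" for \<gamma>'
        proof (cases "\<gamma>' = \<gamma>")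
          case True
          then show ?thesis
            unfolding bd_point_chain[OF wclass_fin dK d(4)]
            using g d(2) of_int_incidence_square[of \<delta> \<gamma> "k \<tau>"] by simp
        next
          case False
          then have "\<not> (\<gamma>' \<in> ?K \<and> dim \<gamma>' = i - 1 \<and> \<gamma>' \<subseteq> \<delta>)" using only by blast
          then show ?thesis
            unfolding bd_point_chain[OF wclass_fin dK d(4)] using False by auto
        qed
      qed
    qed
    then have "(\<lambda>\<gamma>'. \<Sum>\<tau>\<in>?T. point_chain \<gamma> (k \<tau>) \<gamma>') \<in> Q" by (rule Qsum)
    moreover have "(\<lambda>\<gamma>'. \<Sum>\<tau>\<in>?T. point_chain \<gamma> (k \<tau>) \<gamma>') = point_chain \<gamma> f" by (auto simp: k(1))
    ultimately show ?thesis by simp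
  qed
  let ?y = "bd ?K {} i z"
  have "?y \<in> chains ?K {} (i - 1)"
    by (rule chainsI) (use bd_cells[of ?K "{}" i z] in \<open>auto simp: cells_def\<close>)
  note y = point_chain_sum[OF wclass_fin this]
  have "(\<lambda>\<gamma>. \<Sum>\<delta>\<in>{\<delta>\<in>?K. dim \<delta> = i - 1}. point_chain \<delta> (?y \<delta>) \<gamma>) \<in> Q"
    by (rule Qsum) (use pt bz in auto)
  then have "?y \<in> Q" using y by simp
  then obtain j where j: "?y = bd ?K {} i j" "j \<in> chains ?K {} i" "\<forall>\<gamma>. j \<gamma> \<in> J \<gamma>"
    unfolding Q_def by blast
  \<comment> \<open>Here the boundary vanishes exactly and not just modulo the ideals, so the
    hypothesis on constant coefficients applies.\<close>
  have "(\<lambda>\<gamma>. z \<gamma> - j \<gamma>) \<in> cycles ?K {} (\<lambda>_. {0}) i"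
    using z j by (auto simp: cycles_def bd_diff chains_def)
  then have "(\<lambda>\<gamma>. z \<gamma> - j \<gamma>) \<in> bounds ?K {} (\<lambda>_. {0}) i" using H by blast
  then obtain b where b: "b \<in> chains ?K {} (i + 1)" "\<forall>\<gamma>. z \<gamma> - j \<gamma> = bd ?K {} (i + 1) b \<gamma>"
    unfolding bounds_iff by auto
  show ?thesis
    by (rule boundsI[OF b(1) j(2)]) (use b(2) j(3) in \<open>auto simp: diff_eq_eq\<close>)
qed

text \<open>The smallest face of a facet whose span contains \<open>W\<close> lies in every wall \<open>\<tau>\<close> with
  \<open>W \<subseteq> span \<tau>\<close>, so it does not change along the chains that define a class.\<close>

lemma simplicial_class_core:
  assumes simp: "simplicial \<Sigma>" and s: "facet \<Sigma> \<sigma>"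
  shows "\<exists>\<gamma>0\<in>\<Sigma>. \<gamma>0 \<subseteq> \<sigma> \<and> W \<subseteq> span \<gamma>0 \<and> (\<forall>\<gamma>\<in>wclass W \<sigma>. \<gamma>0 \<subseteq> \<gamma>)"
proof -
  have full: "W \<subseteq> span s" if "facet \<Sigma> s" for s
    using that pure dim_eq_full[of s] by (simp add: pure_full_def)
  have mem: "s \<in> \<Sigma>" if "facet \<Sigma> s" for s using that by (simp add: facet_def)
  obtain \<gamma>0 where g0: "\<gamma>0 \<in> \<Sigma>" "\<gamma>0 \<subseteq> \<sigma>" "W \<subseteq> span \<gamma>0"
    "\<forall>\<delta>\<in>\<Sigma>. \<delta> \<subseteq> \<sigma> \<and> W \<subseteq> span \<delta> \<longrightarrow> \<gamma>0 \<subseteq> \<delta>"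
    using simplicial_minimal_face[OF fan simp mem[OF s] full[OF s]] by blast
  have "\<gamma>0 \<subseteq> s \<and> (\<forall>\<delta>\<in>\<Sigma>. \<delta> \<subseteq> s \<and> W \<subseteq> span \<delta> \<longrightarrow> \<gamma>0 \<subseteq> \<delta>)"
    if "(W_adj \<Sigma> W)\<^sup>*\<^sup>* \<sigma> s" for s
    using that
  proof (induct rule: rtranclp_induct)
    case base
    then show ?case using g0 by blast
  next
    case (step s s')
    have adj: "facet \<Sigma> s'" "s \<inter> s' \<in> \<Sigma>" "W \<subseteq> span (s \<inter> s')"
      using step(2) by (auto simp: W_adj_def)
    obtain \<gamma>1 where g1: "\<gamma>1 \<in> \<Sigma>" "\<gamma>1 \<subseteq> s'" "W \<subseteq> span \<gamma>1"
      "\<forall>\<delta>\<in>\<Sigma>. \<delta> \<subseteq> s' \<and> W \<subseteq> span \<delta> \<longrightarrow> \<gamma>1 \<subseteq> \<delta>"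
      using simplicial_minimal_face[OF fan simp mem[OF adj(1)] full[OF adj(1)]] by blast
    have "\<gamma>0 \<subseteq> s \<inter> s'" using step(3) adj by blast
    moreover have "\<gamma>1 \<subseteq> s \<inter> s'" using g1 adj by blast
    then have "\<gamma>0 \<subseteq> \<gamma>1" using step(3) g1 by blast
    moreover have "\<gamma>1 \<subseteq> \<gamma>0" using g1(4) g0(1,3) \<open>\<gamma>0 \<subseteq> s \<inter> s'\<close> by blast
    ultimately show ?case using g1(4) by blast
  qed
  then have "\<gamma>0 \<subseteq> \<gamma>" if "\<gamma> \<in> wclass W \<sigma>" for \<gamma>
    using that wclass_fan[OF that] unfolding wclass_iff by blast
  then show ?thesis using g0 by blast
qed

text \<open>Crossing a wall whose span contains \<open>\<gamma>0\<close> keeps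
  \<open>\<gamma>0\<close> inside the next facet, because a facet meets the span of the wall in the
  wall itself. Conversely, heredity connects all facets of the star.\<close>

lemma span_class_iff:
  assumes g0: "\<gamma>0 \<in> \<Sigma>" "\<gamma>0 \<subseteq> \<sigma>" and s: "facet \<Sigma> \<sigma>"
  shows "\<gamma> \<in> wclass (span \<gamma>0) \<sigma> \<longleftrightarrow> \<gamma> \<in> X \<and> \<gamma>0 \<subseteq> \<gamma>"
proof
  let ?W = "span \<gamma>0"
  assume g: "\<gamma> \<in> wclass ?W \<sigma>"
  then obtain \<sigma>' where s': "(W_adj \<Sigma> ?W)\<^sup>*\<^sup>* \<sigma> \<sigma>'" "facet \<Sigma> \<sigma>'" "\<gamma> \<subseteq> \<sigma>'"
    by (auto simp: wclass_iff)
  have "\<gamma>0 \<subseteq> \<sigma>'" using s'(1)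
  proof (induct rule: rtranclp_induct)
    case (step t t')
    have t: "t \<in> \<Sigma>" "t \<inter> t' \<in> \<Sigma>" "?W \<subseteq> span (t \<inter> t')"
      using step(2) by (auto simp: W_adj_def facet_def)
    have "t \<inter> span (t \<inter> t') = t \<inter> t'" by (rule fan_subset_Int_span[OF fan t(2,1)]) blast
    then show ?case using step(3) t(3) span_superset[of \<gamma>0] by blast
  qed (rule g0(2))
  moreover have "\<sigma>' \<in> \<Sigma>" using s' by (simp add: facet_def)
  ultimately have "\<gamma>0 \<subseteq> \<gamma>"
    using fan_subset_Int_span[OF fan wclass_fan[OF g] _ s'(3)] wclass_span[OF g] span_superset[of \<gamma>0]
    by blast
  then show "\<gamma> \<in> X \<and> \<gamma>0 \<subseteq> \<gamma>" using g wclass_X by blast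
next
  assume g: "\<gamma> \<in> X \<and> \<gamma>0 \<subseteq> \<gamma>"
  obtain s' where s': "facet \<Sigma> s'" "\<gamma> \<subseteq> s'"
    using fan_facet_exists[OF fan] g X_fan by blast
  have "(W_adj \<Sigma> (span \<gamma>0))\<^sup>*\<^sup>* \<sigma> s'"
    using star_connected[OF g0(1) subset_refl s g0(2) s'(1)] g s' by blast
  then show "\<gamma> \<in> wclass (span \<gamma>0) \<sigma>" using g s' span_mono[of \<gamma>0 \<gamma>] by (auto simp: wclass_iff)
qed

text \<open>A wall with parameter -1 cannot be interior, so the wall that puts
  \<open>\<gamma>\<close> into \<open>Sm\<close> belongs to \<open>Sm\<close> itself.\<close>

lemma smooth_boundary:
  assumes "\<gamma> \<in> Sm"
  obtains \<tau> where "\<tau> \<in> Sm" "dim \<tau> + 1 = CARD('n)" "\<gamma> \<subseteq> \<tau>"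
proof -
  obtain \<tau> where t: "\<tau> \<in> \<Sigma>" "dim \<tau> + 1 = CARD('n)" "\<alpha> \<tau> = -1" "\<gamma> \<subseteq> \<tau>"
    using assms unfolding Sm_def sigma_m1_def by blast
  have "\<tau> \<in> fan_boundary \<Sigma>"
    using alpha t(1-3) unfolding smoothness_params_def by force
  then have "\<tau> \<in> Sm" using t unfolding Sm_def sigma_m1_def by blast
  then show ?thesis using that t by blast
qed

text \<open>The class of \<open>span \<gamma>0\<close> is the star of \<open>\<gamma>0\<close>; in degree \<open>dim \<gamma>0 + 1\<close> its homology is the reduced
  zeroth homology of the link, which is connected because the fan is hereditary. When \<open>\<gamma>0\<close> lies
  in \<open>Sm\<close>, the homology is relative to a non-empty part of the link instead.\<close>

lemma simplicial_H_zero: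
  assumes simp: "simplicial \<Sigma>" and s: "facet \<Sigma> \<sigma>" and g0: "\<gamma>0 \<in> \<Sigma>" "\<gamma>0 \<subseteq> \<sigma>" "dim \<gamma>0 + 1 = i"
  shows "cycles (wclass (span \<gamma>0) \<sigma>) {} (\<lambda>_. {0}) i \<subseteq> bounds (wclass (span \<gamma>0) \<sigma>) {} (\<lambda>_. {0}) i"
proof
  let ?K = "wclass (span \<gamma>0) \<sigma>"
  let ?B = "bounds ?K {} (\<lambda>_. {0 :: 'n spoly}) i"
  fix z assume z: "z \<in> cycles ?K {} (\<lambda>_. {0}) i"
  note K = span_class_iff[OF g0(1,2) s]
  have B: "is_submodule ?B" by (rule is_submodule_bounds[OF is_ideal_zero])
  define V where "V = {\<delta>\<in>\<Sigma>. \<gamma>0 \<subseteq> \<delta> \<and> dim \<delta> = i}"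
  \<comment> \<open>Vertices of the link, normalised so that every surviving one has coefficient 1
    at \<open>\<gamma>0\<close> in its boundary. Cells that are not in the class give 0, as in a
    relative complex.\<close>
  define e :: "'n cone \<Rightarrow> 'n cone \<Rightarrow> 'n spoly" where
    "e \<delta> \<gamma> = (if \<gamma> = \<delta> \<and> \<delta> \<in> ?K then of_int (incidence \<delta> \<gamma>0) else 0)" for \<delta> \<gamma>
  have coface: "\<exists>\<eta>\<in>V. \<eta> \<subseteq> \<tau>" if "\<tau> \<in> \<Sigma>" "\<gamma>0 \<subseteq> \<tau>" "dim \<tau> + 1 = CARD('n)" for \<tau>
    using fan_intermediate_face[OF fan g0(1) that(1,2), of i] that(3) g0(3) i by (auto simp: V_def)
  \<comment> \<open>In one simplicial cone the two cofaces span a cone \<open>\<epsilon>\<close>, an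
    edge of the link. By the diamond relation its boundary is, up to sign, the difference of the two
    vertices.\<close>
  have adj: "(\<lambda>\<gamma>. e \<delta> \<gamma> - e \<delta>' \<gamma>) \<in> ?B"
    if d: "\<delta> \<in> V" "\<delta>' \<in> V" "\<delta> \<subseteq> t" "\<delta>' \<subseteq> t" "t \<in> \<Sigma>" for \<delta> \<delta>' t
  proof (cases "\<delta> = \<delta>'")
    case True
    then show ?thesis using is_submoduleD(1)[OF B] by simp
  next
    case False
    have dm: "\<delta> \<in> \<Sigma>" "\<delta>' \<in> \<Sigma>" "\<gamma>0 \<subseteq> \<delta>" "\<gamma>0 \<subseteq> \<delta>'" "dim \<delta> = i" "dim \<delta>' = i"
      "dim \<delta> = Suc (dim \<gamma>0)" "dim \<delta>' = Suc (dim \<gamma>0)"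
      using d g0(3) by (auto simp: V_def)
    obtain C v v' where C: "independent (insert v (insert v' C))" "v \<noteq> v'" "v \<notin> C" "v' \<notin> C"
      "\<gamma>0 = pos_hull C" "\<delta> = pos_hull (insert v C)" "\<delta>' = pos_hull (insert v' C)"
      "pos_hull (insert v (insert v' C)) \<in> \<Sigma>"
      using simplicial_two_cofaces[OF fan simp d(5) g0(1) dm(1,2,3,4) d(3,4) dm(7,8) False] .
    define \<epsilon> where "\<epsilon> = pos_hull (insert v (insert v' C))"
    have fin: "finite (insert v (insert v' C))" by (rule independent_imp_finite[OF C(1)])
    have sub: "\<delta> \<subseteq> \<epsilon>" "\<delta>' \<subseteq> \<epsilon>" "\<gamma>0 \<subseteq> \<epsilon>"
      unfolding \<epsilon>_def C(5,6,7) by (rule pos_hull_mono[OF fin], blast)+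
    have e\<Sigma>: "\<epsilon> \<in> \<Sigma>" using C(8) by (simp add: \<epsilon>_def)
    have "independent C" by (rule independent_mono[OF C(1)]) blast
    from dim_pos_hull[OF this] have cardC: "card C = dim \<gamma>0" by (simp add: C(5))
    have dime: "dim \<epsilon> = i + 1"
      using dim_pos_hull[OF C(1)] fin C(2-4) cardC g0(3) by (simp add: \<epsilon>_def)
    show ?thesis
    proof (cases "\<epsilon> \<in> Sm")
      case True
      \<comment> \<open>If the edge is removed, both of its vertices are removed with it and the
        difference is 0.\<close>
      then have "\<delta> \<notin> ?K" "\<delta>' \<notin> ?K"
        using Sm_down[OF True dm(1) sub(1)] Sm_down[OF True dm(2) sub(2)] by (auto simp: K X_def)
      then show ?thesis using is_submoduleD(1)[OF B] by (simp add: e_def)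
    next
      case False
      have eK: "\<epsilon> \<in> ?K" unfolding K using False e\<Sigma> sub by (simp add: X_def)
      define f :: "'n spoly" where "f = of_int (incidence \<epsilon> \<delta> * incidence \<delta> \<gamma>0)"
      have diamond: "incidence \<epsilon> \<delta> * incidence \<delta> \<gamma>0 = - (incidence \<epsilon> \<delta>' * incidence \<delta>' \<gamma>0)"
        unfolding \<epsilon>_def C(5,6,7) by (rule incidence_diamond[OF C(1-4)])
      have sq: "incidence a b * (incidence a b * x) = x" for a b x
        using incidence_square[of a b] by (metis mult.assoc mult_1)
      have f1: "of_int (incidence \<epsilon> \<delta>) * f = of_int (incidence \<delta> \<gamma>0)"
        unfolding f_def of_int_mult[symmetric] sq ..
      have f2: "of_int (incidence \<epsilon> \<delta>') * f = - of_int (incidence \<delta>' \<gamma>0)"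
        unfolding f_def diamond of_int_mult[symmetric] mult_minus_right sq by simp
      show ?thesis
      proof (rule boundsI[of "point_chain \<epsilon> f" _ _ _ "\<lambda>_. 0"])
        show "point_chain \<epsilon> f \<in> chains ?K {} (i + 1)"
          using eK dime by (auto intro!: chainsI split: if_splits)
        show "(\<lambda>_. 0) \<in> chains ?K {} i" by (simp add: chains_def)
        show "0 \<in> {0 :: 'n spoly}" by simp
        fix \<gamma>
        consider "\<gamma> = \<delta>" | "\<gamma> = \<delta>'" | "\<gamma> \<noteq> \<delta>" "\<gamma> \<noteq> \<delta>'" by blast
        then show "e \<delta> \<gamma> - e \<delta>' \<gamma> = bd ?K {} (i + 1) (point_chain \<epsilon> f) \<gamma> + 0"
        proof cases
          case 1
          then show ?thesis
            unfolding bd_point_chain[OF wclass_fin eK dime]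
            using \<open>\<delta> \<noteq> \<delta>'\<close> sub(1) dm(5) f1 by (simp add: e_def)
        next
          case 2
          then show ?thesis
            unfolding bd_point_chain[OF wclass_fin eK dime]
            using \<open>\<delta> \<noteq> \<delta>'\<close> sub(2) dm(6) f2 by (simp add: e_def)
        next
          case 3
          have "\<not> (\<gamma> \<in> ?K \<and> dim \<gamma> = i \<and> \<gamma> \<subseteq> \<epsilon>)"
          proof
            assume g: "\<gamma> \<in> ?K \<and> dim \<gamma> = i \<and> \<gamma> \<subseteq> \<epsilon>"
            then have "\<gamma> \<in> \<Sigma>" "pos_hull C \<subseteq> \<gamma>" "\<gamma> \<subseteq> pos_hull (insert v (insert v' C))"
              "dim \<gamma> = Suc (card C)"
              using K X_fan C(5) cardC g0(3) by (auto simp: \<epsilon>_def)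
            from simplicial_between[OF fan C(1-4,8) this] show False using 3 C(6,7) by simp
          qed
          then show ?thesis
            unfolding bd_point_chain[OF wclass_fin eK dime] using 3 by (auto simp: e_def)
        qed
      qed
    qed
  qed
  have conn: "(\<lambda>\<gamma>. e \<delta> \<gamma> - e \<delta>' \<gamma>) \<in> ?B" if d: "\<delta> \<in> V" "\<delta>' \<in> V" for \<delta> \<delta>'
  proof -
    have dm: "\<delta> \<in> \<Sigma>" "\<delta>' \<in> \<Sigma>" "\<gamma>0 \<subseteq> \<delta>" "\<gamma>0 \<subseteq> \<delta>'" using d by (auto simp: V_def)
    obtain s1 where s1: "facet \<Sigma> s1" "\<delta> \<subseteq> s1" using fan_facet_exists[OF fan dm(1)] by blast
    obtain s2 where s2: "facet \<Sigma> s2" "\<delta>' \<subseteq> s2" using fan_facet_exists[OF fan dm(2)] by blast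
    let ?R = "\<lambda>s s'. facet \<Sigma> s \<and> \<gamma>0 \<subseteq> s \<and> facet \<Sigma> s' \<and> \<gamma>0 \<subseteq> s' \<and> dim (s \<inter> s') + 1 = CARD('n)"
    have "\<gamma>0 \<subseteq> s1" "\<gamma>0 \<subseteq> s2" using s1 s2 dm by auto
    then have "?R\<^sup>*\<^sup>* s1 s2" using her g0(1) s1(1) s2(1) unfolding hereditary_def by blast
    \<comment> \<open>The chain of facets is followed through vertices: a wall between consecutive
      facets contains some \<open>\<eta>\<close> in \<open>V\<close>, which joins the vertices of
      one facet to those of the next.\<close>
    then have "\<forall>\<eta>\<in>V. \<eta> \<subseteq> s2 \<longrightarrow> (\<lambda>\<gamma>. e \<delta> \<gamma> - e \<eta> \<gamma>) \<in> ?B"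
    proof (induct rule: rtranclp_induct)
      case base
      then show ?case using adj[OF d(1) _ s1(2)] s1(1) by (auto simp: facet_def)
    next
      case (step s s')
      have mem: "s \<in> \<Sigma>" "s' \<in> \<Sigma>" using step(2) by (auto simp: facet_def)
      obtain \<eta> where \<eta>: "\<eta> \<in> V" "\<eta> \<subseteq> s \<inter> s'"
        using coface[OF fan_Int_mem[OF fan mem]] step(2) by blast
      have 1: "(\<lambda>\<gamma>. e \<delta> \<gamma> - e \<eta> \<gamma>) \<in> ?B" using step(3) \<eta> by blast
      show ?case
      proof (intro ballI impI)
        fix \<zeta> assume \<zeta>: "\<zeta> \<in> V" "\<zeta> \<subseteq> s'"
        have "(\<lambda>\<gamma>. e \<eta> \<gamma> - e \<zeta> \<gamma>) \<in> ?B" using adj[OF \<eta>(1) \<zeta>(1) _ \<zeta>(2) mem(2)] \<eta>(2) by blast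
        from is_submoduleD(2)[OF B 1 this] show "(\<lambda>\<gamma>. e \<delta> \<gamma> - e \<zeta> \<gamma>) \<in> ?B" by simp
      qed
    qed
    then show ?thesis using d(2) s2(2) by blast
  qed
  have zc: "z \<in> chains ?K {} i" using z by (simp add: cycles_def)
  define Ki where "Ki = {\<delta>\<in>?K. dim \<delta> = i}"
  have KiV: "\<delta> \<in> V" if "\<delta> \<in> Ki" for \<delta> using that K X_fan by (auto simp: Ki_def V_def)
  define c where "c \<delta> = of_int (incidence \<delta> \<gamma>0) * z \<delta>" for \<delta>
  have ze: "z \<gamma> = (\<Sum>\<delta>\<in>Ki. c \<delta> * e \<delta> \<gamma>)" for \<gamma>
  proof -
    have "z \<gamma> = (\<Sum>\<delta>\<in>Ki. point_chain \<delta> (z \<delta>) \<gamma>)"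
      using point_chain_sum[OF wclass_fin zc] unfolding Ki_def by (rule fun_cong)
    also have "\<dots> = (\<Sum>\<delta>\<in>Ki. c \<delta> * e \<delta> \<gamma>)"
    proof (rule sum.cong[OF refl])
      fix \<delta> assume "\<delta> \<in> Ki"
      then have "\<delta> \<in> ?K" by (simp add: Ki_def)
      moreover have "c \<delta> * of_int (incidence \<delta> \<gamma>0) = z \<delta>"
        using of_int_incidence_square[of \<delta> \<gamma>0 "z \<delta>"] by (simp add: c_def mult.commute mult.left_commute)
      ultimately show "point_chain \<delta> (z \<delta>) \<gamma> = c \<delta> * e \<delta> \<gamma>" by (simp add: e_def)
    qed
    finally show ?thesis .
  qed
  \<comment> \<open>Replacing every vertex by one base vertex \<open>\<delta>0\<close> changes
    \<open>z\<close> by boundaries and leaves the sum of its coefficients times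
    \<open>e \<delta>0\<close>.\<close>
  have via: "z \<in> ?B" if d0: "\<delta>0 \<in> V" and rest: "(\<lambda>\<gamma>. (\<Sum>\<delta>\<in>Ki. c \<delta>) * e \<delta>0 \<gamma>) \<in> ?B" for \<delta>0
  proof -
    have "(\<lambda>\<gamma>. \<Sum>\<delta>\<in>Ki. c \<delta> * (e \<delta> \<gamma> - e \<delta>0 \<gamma>)) \<in> ?B"
      by (rule is_submodule_sum[OF B]) (rule is_submoduleD(3)[OF B conn[OF KiV d0]])
    from is_submoduleD(2)[OF B this rest]
    have "(\<lambda>\<gamma>. (\<Sum>\<delta>\<in>Ki. c \<delta> * (e \<delta> \<gamma> - e \<delta>0 \<gamma>)) + (\<Sum>\<delta>\<in>Ki. c \<delta>) * e \<delta>0 \<gamma>) \<in> ?B" .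
    moreover have "(\<Sum>\<delta>\<in>Ki. c \<delta> * (e \<delta> \<gamma> - e \<delta>0 \<gamma>)) + (\<Sum>\<delta>\<in>Ki. c \<delta>) * e \<delta>0 \<gamma> = z \<gamma>" for \<gamma>
      by (simp add: ze right_diff_distrib sum_subtractf sum_distrib_right)
    ultimately show ?thesis by simp
  qed
  show "z \<in> ?B"
  proof (cases "\<gamma>0 \<in> Sm")
    case True
    obtain \<tau> where t: "\<tau> \<in> Sm" "dim \<tau> + 1 = CARD('n)" "\<gamma>0 \<subseteq> \<tau>" using smooth_boundary[OF True] .
    have "\<tau> \<in> \<Sigma>" using t(1) by (auto simp: Sm_def sigma_m1_def fan_boundary_def)
    then obtain \<delta>0 where d0: "\<delta>0 \<in> V" "\<delta>0 \<subseteq> \<tau>" using coface t by blast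
    \<comment> \<open>A removed base vertex has \<open>e \<delta>0 = 0\<close>, so nothing
      remains.\<close>
    have "\<delta>0 \<in> Sm" using Sm_down[OF t(1) _ d0(2)] d0(1) by (simp add: V_def)
    then have "\<delta>0 \<notin> ?K" by (simp add: K X_def)
    then show ?thesis using via[OF d0(1)] is_submoduleD(1)[OF B] by (simp add: e_def)
  next
    case False
    then have g0K: "\<gamma>0 \<in> ?K" using g0 by (simp add: K X_def)
    \<comment> \<open>If \<open>\<gamma>0\<close> itself is a cell, the cycle condition there states
      that the coefficients sum to 0.\<close>
    have "bd ?K {} i z \<gamma>0 = 0" using z by (simp add: cycles_def)
    moreover have "bd ?K {} i z \<gamma>0 = (\<Sum>\<delta>\<in>Ki. c \<delta>)"
    proof -
      have "cells ?K {} i = Ki" by (auto simp: cells_def Ki_def)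
      moreover have "\<gamma>0 \<in> cells ?K {} (i - 1)" using g0K g0(3) by (auto simp: cells_def)
      ultimately show ?thesis
        unfolding bd_def c_def using KiV by (auto simp: V_def intro!: sum.cong)
    qed
    ultimately have c0: "(\<Sum>\<delta>\<in>Ki. c \<delta>) = 0" by simp
    show ?thesis
    proof (cases "Ki = {}")
      case True
      then have "z = (\<lambda>_. 0)" using ze by (simp add: fun_eq_iff)
      then show ?thesis using is_submoduleD(1)[OF B] by simp
    next
      case False
      then obtain \<delta>0 where "\<delta>0 \<in> Ki" by blast
      then show ?thesis using via[OF KiV] c0 is_submoduleD(1)[OF B] by simp
    qed
  qed
qed

text \<open>One pair \<open>W\<close>, \<open>\<sigma>\<close> is produced with all properties at
  once, because the homology in (2) and the face in (3) must belong to the same class.\<close>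

lemma associated_prime:
  assumes "P \<in> Ass_H \<Sigma> Sm J i"
  shows "\<exists>W\<in>hyp_lattice \<Sigma> Sm. \<exists>\<sigma>. facet \<Sigma> \<sigma> \<and> P = ideal_of W \<and> dim W + 1 \<le> i
    \<and> (dim W + 1 = i \<longrightarrow> \<not> H_zero (sigma_W \<Sigma> W \<sigma>) (sigma_m1_W \<Sigma> \<alpha> W \<sigma>) (\<lambda>_. {0}) i)
    \<and> (simplicial \<Sigma> \<longrightarrow> (\<exists>\<gamma>0\<in>\<Sigma>. \<gamma>0 \<subseteq> \<sigma> \<and> W = span \<gamma>0))"
proof -
  obtain z where P: "prime_ideal P" and z: "z \<in> cycles X {} J i" and Pz: "P = hom_ann X {} J i z"
    using assms unfolding Ass_H_def complex_diff[of \<Sigma> Sm] X_def by blast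
  have Pq: "P = quot_ann (bounds X {} J i) z" using Pz by (simp add: hom_ann_def quot_ann_def)
  have zc: "z \<in> chains X {} i" and zb: "\<And>\<gamma>. bd X {} i z \<gamma> \<in> J \<gamma>" using z by (auto simp: cycles_def)
  note I = prime_ideal_is_ideal[OF P]
  have one: "1 \<notin> P" using P by (simp add: prime_ideal_def)
  define TP where "TP = {\<tau>\<in>T. lin (normal_vec \<tau>) \<in> P}"
  define W where "W = \<Inter>(span ` TP)"
  have WL: "W \<in> hyp_lattice \<Sigma> Sm"
    \<comment> \<open>If no form lies in \<open>P\<close>, the intersection is the whole space,
      which the lattice contains.\<close>
    unfolding hyp_lattice_def W_def by (rule imageI) (auto simp: TP_def T_def)
  have Wsub: "subspace W" unfolding W_def by (rule subspace_Inter) auto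
  have normal: "span \<tau> = {x. normal_vec \<tau> \<bullet> x = 0}" if "\<tau> \<in> T" for \<tau>
    using normal_vec(2)[of \<tau>] that by (simp add: T_def)
  have WP: "ideal_of W \<subseteq> P"
  proof (rule ideal_of_subspace_le[OF Wsub I])
    fix a assume a: "\<forall>x\<in>W. a \<bullet> x = 0"
    show "lin a \<in> P"
    proof (rule linear_forms_in_ideal[OF I])
      show "lin b \<in> P" if "b \<in> normal_vec ` TP" for b using that by (auto simp: TP_def)
      fix x assume x: "\<And>b. b \<in> normal_vec ` TP \<Longrightarrow> b \<bullet> x = 0"
      have "x \<in> W" unfolding W_def using x normal by (auto simp: TP_def)
      then show "a \<bullet> x = 0" using a by blast
    qed
  qed
  define h where "h = (\<Prod>\<tau>\<in>T - TP. lin (normal_vec \<tau>) ^ nat (\<alpha> \<tau> + 1))"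
  have hP: "h \<notin> P"
  proof
    assume "h \<in> P"
    then obtain \<tau> where "\<tau> \<in> T - TP" "lin (normal_vec \<tau>) ^ nat (\<alpha> \<tau> + 1) \<in> P"
      unfolding h_def using prime_ideal_prod[OF P, of "T - TP"] finT by blast
    then show False using prime_ideal_power[OF P] by (auto simp: TP_def)
  qed
  have hJ: "h \<in> J \<gamma>" if g: "\<gamma> \<in> X" "dim \<gamma> = i" "\<not> W \<subseteq> span \<gamma>" for \<gamma>
  proof -
    have g\<Sigma>: "\<gamma> \<in> \<Sigma>" using g(1) X_fan by blast
    obtain s where s: "facet \<Sigma> s" "\<gamma> \<subseteq> s" using fan_facet_exists[OF fan g\<Sigma>] by blast
    have s': "s \<in> \<Sigma>" "dim s = CARD('n)" using s pure by (auto simp: facet_def pure_full_def)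
    have "\<gamma> \<noteq> s" using g(2) s'(2) i by auto
    \<comment> \<open>A wall above \<open>\<gamma>\<close> whose span does not contain
      \<open>W\<close> cannot belong to \<open>TP\<close>. Since \<open>X\<close> is closed upwards,
      it is in \<open>T\<close>, and its power is a factor of \<open>h\<close>.\<close>
    then obtain \<tau> where t: "\<tau> \<in> \<Sigma>" "dim \<tau> + 1 = CARD('n)" "\<gamma> \<subseteq> \<tau>" "\<not> W \<subseteq> span \<tau>"
      using subset_span_if_subset_facet_spans[OF fan s' g\<Sigma> s(2), of W] g(3) by blast
    have "\<tau> \<in> X" by (rule X_up[OF g(1) t(1,3)])
    then have tT: "\<tau> \<in> T" using t by (simp add: T_def X_def)
    moreover have "\<tau> \<notin> TP" using t(4) by (auto simp: W_def)
    ultimately have "h = (\<Prod>\<tau>\<in>T - TP - {\<tau>}. lin (normal_vec \<tau>) ^ nat (\<alpha> \<tau> + 1)) * lin (normal_vec \<tau>) ^ nat (\<alpha> \<tau> + 1)"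
      unfolding h_def using finT by (subst prod.remove[of _ \<tau>]) (auto simp: mult.commute)
    then have "h \<in> pideal (lin (normal_vec \<tau>) ^ nat (\<alpha> \<tau> + 1))" by (simp add: pideal_def)
    then show ?thesis using J_memberI[OF g\<Sigma> _ tT t(3)] g(2) i by simp
  qed
  obtain \<sigma> where s: "facet \<Sigma> \<sigma>"
    and PK: "P = quot_ann (bounds (wclass W \<sigma>) {} J i) (restr (wclass W \<sigma>) z)"
    using localize_to_class[OF P Pq zc hJ hP] by blast
  let ?K = "wclass W \<sigma>"
  let ?z = "restr ?K z"
  have zK: "?z \<in> chains ?K {} i" using chainsD[OF zc] by (auto intro!: chainsI split: if_splits)
  have fin: "finite {\<gamma>. ?z \<gamma> \<noteq> 0}"
    by (rule finite_subset[OF _ wclass_fin[of W \<sigma>]]) auto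
  have notB: "?z \<notin> bounds ?K {} J i"
    using one unfolding PK quot_ann_def by simp
  \<comment> \<open>The direction may be any vector common to the spans of all cells of the class:
    first a vector of \<open>W\<close>, and in the simplicial case one of the span of the common
    face.\<close>
  have D: "dirderiv w f \<in> P" if w: "\<And>\<gamma>. \<gamma> \<in> ?K \<Longrightarrow> w \<in> span \<gamma>" and f: "f \<in> P" for w f
  proof -
    have "dirderiv w f \<in> quot_ann (bounds ?K {} J i) ?z"
    proof (rule quot_ann_dirderiv[OF is_submodule_bounds_J _ fin])
      show "(\<lambda>\<gamma>. dirderiv w (x \<gamma>)) \<in> bounds ?K {} J i" if "x \<in> bounds ?K {} J i" for x
        by (rule bounds_dirderiv[OF wclass_X w that])
      show "prime_ideal (quot_ann (bounds ?K {} J i) ?z)" "f \<in> quot_ann (bounds ?K {} J i) ?z"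
        using P f unfolding PK .
    qed
    then show ?thesis unfolding PK .
  qed
  have eq: "P = ideal_of W"
    by (rule prime_ideal_eq_ideal_of[OF P Wsub WP D]) (use wclass_span in blast)
  have dimW: "dim W + 1 \<le> i"
    using chain_in_bounds_high_dim[OF Wsub _ zK] notB by force
  have nonzero: "\<not> H_zero (sigma_W \<Sigma> W \<sigma>) (sigma_m1_W \<Sigma> \<alpha> W \<sigma>) (\<lambda>_. {0}) i" if d: "dim W + 1 = i"
  proof
    assume "H_zero (sigma_W \<Sigma> W \<sigma>) (sigma_m1_W \<Sigma> \<alpha> W \<sigma>) (\<lambda>_. {0}) i"
    then have H: "cycles ?K {} (\<lambda>_. {0}) i \<subseteq> bounds ?K {} (\<lambda>_. {0}) i"
      unfolding H_zero_def complex_diff[of "sigma_W \<Sigma> W \<sigma>"] wclass_def .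
    have "bd ?K {} i ?z \<gamma> \<in> J \<gamma>" for \<gamma>
    proof (cases "\<gamma> \<in> ?K")
      case True
      then show ?thesis using bd_restr[OF finX wclass_X wclass_upclosed True, of i z] zb by simp
    next
      case False
      then show ?thesis using is_idealD(1)[OF J_ideal] by (simp add: bd_def cells_def)
    qed
    from chain_in_bounds_next_dim[OF Wsub d zK this H] show False using notB by blast
  qed
  have core: "\<exists>\<gamma>0\<in>\<Sigma>. \<gamma>0 \<subseteq> \<sigma> \<and> W = span \<gamma>0" if simp: "simplicial \<Sigma>"
  proof -
    obtain \<gamma>0 where g0: "\<gamma>0 \<in> \<Sigma>" "\<gamma>0 \<subseteq> \<sigma>" "W \<subseteq> span \<gamma>0" "\<forall>\<gamma>\<in>?K. \<gamma>0 \<subseteq> \<gamma>"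
      using simplicial_class_core[OF simp s, of W] by blast
    have "span \<gamma>0 \<subseteq> span \<tau>" if t: "\<tau> \<in> TP" for \<tau>
    proof
      fix w assume w: "w \<in> span \<gamma>0"
      \<comment> \<open>The derivative of a linear form is the constant
        \<open>normal_vec \<tau> \<bullet> w\<close>, and a constant in a prime ideal is 0.\<close>
      have "dirderiv w (lin (normal_vec \<tau>)) \<in> P"
      proof (rule D)
        show "w \<in> span \<gamma>" if "\<gamma> \<in> ?K" for \<gamma> using w g0(4) that span_mono[of \<gamma>0 \<gamma>] by blast
        show "lin (normal_vec \<tau>) \<in> P" using t by (simp add: TP_def)
      qed
      then have "normal_vec \<tau> \<bullet> w = 0" using prime_ideal_Const[OF P] by (simp add: dirderiv_lin)
      then show "w \<in> span \<tau>" using normal[of \<tau>] t by (simp add: TP_def)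
    qed
    then have "W = span \<gamma>0" using g0(3) unfolding W_def by blast
    then show ?thesis using g0 by blast
  qed
  show ?thesis using WL s eq dimW nonzero core by blast
qed

end

theorem theorem5p5:
  fixes \<Sigma> :: "('n::finite) cone set" and \<alpha> :: "'n cone \<Rightarrow> int" and i :: nat
  assumes fan: "is_fan \<Sigma>" and pure: "pure_full \<Sigma>" and her: "hereditary \<Sigma>"
    and alpha: "smoothness_params \<Sigma> \<alpha>"
    and i: "1 \<le> i" "i + 1 \<le> CARD('n)"
  defines "Sm \<equiv> sigma_m1 \<Sigma> \<alpha>"
  defines "L \<equiv> hyp_lattice \<Sigma> Sm"
  defines "A \<equiv> Ass_H \<Sigma> Sm (Jfun \<Sigma> Sm \<alpha>) i"
  shows "A \<subseteq> {ideal_of W | W. W \<in> L \<and> dim W + 1 \<le> i}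
    \<and> ((\<forall>W \<sigma>. W \<in> L \<and> dim W + 1 = i \<and> facet \<Sigma> \<sigma> \<longrightarrow>
            H_zero (sigma_W \<Sigma> W \<sigma>) (sigma_m1_W \<Sigma> \<alpha> W \<sigma>) (\<lambda>_. {0}) i)
         \<longrightarrow> A \<subseteq> {ideal_of W | W. W \<in> L \<and> dim W + 2 \<le> i})
    \<and> (simplicial \<Sigma> \<longrightarrow>
         A \<subseteq> {ideal_of (span \<gamma>) | \<gamma>. \<gamma> \<in> \<Sigma> \<and> span \<gamma> \<in> L \<and> dim \<gamma> + 2 \<le> i})"
proof -
  interpret F: smooth_fan \<Sigma> \<alpha> i
    by unfold_locales (fact fan pure her alpha i)+
  have Sm: "F.Sm = Sm" by (simp add: Sm_def F.Sm_def)
  have main: "\<exists>W\<in>L. \<exists>\<sigma>. facet \<Sigma> \<sigma> \<and> P = ideal_of W \<and> dim W + 1 \<le> i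
    \<and> (dim W + 1 = i \<longrightarrow> \<not> H_zero (sigma_W \<Sigma> W \<sigma>) (sigma_m1_W \<Sigma> \<alpha> W \<sigma>) (\<lambda>_. {0}) i)
    \<and> (simplicial \<Sigma> \<longrightarrow> (\<exists>\<gamma>0\<in>\<Sigma>. \<gamma>0 \<subseteq> \<sigma> \<and> W = span \<gamma>0))" if "P \<in> A" for P
    using F.associated_prime[of P] that unfolding A_def L_def F.J_def Sm by simp
  show ?thesis
  proof (intro conjI impI subsetI)
    fix P assume "P \<in> A"
    then show "P \<in> {ideal_of W | W. W \<in> L \<and> dim W + 1 \<le> i}" using main by blast
  next
    fix P assume H: "\<forall>W \<sigma>. W \<in> L \<and> dim W + 1 = i \<and> facet \<Sigma> \<sigma> \<longrightarrow>
      H_zero (sigma_W \<Sigma> W \<sigma>) (sigma_m1_W \<Sigma> \<alpha> W \<sigma>) (\<lambda>_. {0}) i" and "P \<in> A"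
    then obtain W \<sigma> where W: "W \<in> L" "facet \<Sigma> \<sigma>" "P = ideal_of W" "dim W + 1 \<le> i"
      "dim W + 1 = i \<longrightarrow> \<not> H_zero (sigma_W \<Sigma> W \<sigma>) (sigma_m1_W \<Sigma> \<alpha> W \<sigma>) (\<lambda>_. {0}) i"
      using main[of P] by blast
    then have "dim W + 1 \<noteq> i" using H by blast
    then have "dim W + 2 \<le> i" using W(4) by linarith
    then show "P \<in> {ideal_of W | W. W \<in> L \<and> dim W + 2 \<le> i}" using W by blast
  next
    fix P assume simp: "simplicial \<Sigma>" and "P \<in> A"
    then obtain W \<sigma> \<gamma> where W: "W \<in> L" "facet \<Sigma> \<sigma>" "P = ideal_of W" "dim W + 1 \<le> i"
      "dim W + 1 = i \<longrightarrow> \<not> H_zero (sigma_W \<Sigma> W \<sigma>) (sigma_m1_W \<Sigma> \<alpha> W \<sigma>) (\<lambda>_. {0}) i"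
      and g: "\<gamma> \<in> \<Sigma>" "\<gamma> \<subseteq> \<sigma>" "W = span \<gamma>"
      using main[of P] by blast
    \<comment> \<open>The top dimension is excluded as in (2): for the span of a face of a
      simplicial fan the required vanishing has been proved.\<close>
    have "dim \<gamma> + 1 \<noteq> i"
    proof
      assume d: "dim \<gamma> + 1 = i"
      have "H_zero (sigma_W \<Sigma> W \<sigma>) (sigma_m1_W \<Sigma> \<alpha> W \<sigma>) (\<lambda>_. {0}) i"
        using F.simplicial_H_zero[OF simp W(2) g(1,2) d]
        unfolding H_zero_def g(3) complex_diff[of "sigma_W \<Sigma> (span \<gamma>) \<sigma>"] F.wclass_def .
      then show False using W(5) d g(3) by (simp add: dim_span)
    qed
    then have "dim \<gamma> + 2 \<le> i" using W(4) g(3) by (simp add: dim_span)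
    then show "P \<in> {ideal_of (span \<gamma>) | \<gamma>. \<gamma> \<in> \<Sigma> \<and> span \<gamma> \<in> L \<and> dim \<gamma> + 2 \<le> i}"
      using W g by blast
  qed
qed

end
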